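(* Let $n\ge2$, let $\alpha_1,\dots,\alpha_n>0$ and $\alpha=\alpha_1+\dots+\alpha_n$, and let $X_1,\dots,X_n$ be (completely) independent random variables, $X_j$ having the gamma density $\Gamma(\alpha_j)^{-1}e^{-x}x^{\alpha_j-1}$, $x>0$. Let $$U_n^2=\left(\sum_{i=1}^nX_i\right)^{-2}\sum_{i=1}^nX_i^2 .$$ If $\alpha>1$, then for every $x>0$ $$P\{U_n^2\le x\}=\pi^{-3/2}\sqrt2\,\Gamma(\alpha)\,x^{(\alpha-1)/2}\int_0^\infty\Re\left(\left(\prod_{j=1}^n\exp\left(-\frac{is^2}{4}\right)D_{-\alpha_j}\left(i\sqrt i\,s\right)\right)\exp\left(\frac{is^2}{4x}\right)D_{-\alpha}\left(\sqrt{-i}\,s\,x^{-1/2}\right)\sqrt i\right)ds .$$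
   Context: $D_{-\alpha}$ denotes the parabolic cylinder function (Abramowitz–Stegun 19.3.1); for $\alpha>0$ it is the entire function $$D_{-\alpha}(z)=\frac{e^{-z^2/4}}{\Gamma(\alpha)}\int_0^\infty t^{\alpha-1}e^{-t^2/2-zt}\,dt,\qquad z\in\mathbb C .$$ Principal square roots are used: $\sqrt i=e^{i\pi/4}$, $\sqrt{-i}=e^{-i\pi/4}$. The factor $\exp(-is^2/4)$ belongs to each of the $n$ factors of the product. $\Re$ denotes the real part. *)

theory Defs
  imports "HOL-Probability.Probability"
begin

definition gamma_density :: "real \<Rightarrow> real \<Rightarrow> real" where
  "gamma_density a x = (if 0 < x then exp (- x) * x powr (a - 1) / Gamma a else 0)"

text \<open>
  The parabolic cylinder function \<open>D\<^bsub>-a\<^esub>(z)\<close>. The parameter is \<open>a\<close>, the negative of the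
  usual index, and the integral representation is meaningful for \<open>a > 0\<close> only.
\<close>

definition parabolic_cylinder_neg :: "real \<Rightarrow> complex \<Rightarrow> complex" where
  "parabolic_cylinder_neg a z =
     exp (- (z\<^sup>2) / 4) / of_real (Gamma a) *
     (CLINT t:{0<..}|lborel. of_real (t powr (a - 1)) * exp (- (of_real (t\<^sup>2) / 2) - z * of_real t))"

end

theory Submission
  imports Defs "HOL-Complex_Analysis.Complex_Analysis" "HOL-Real_Asymp.Real_Asymp"
begin

text \<open>
Let \<open>S\<close> be the sum of the \<open>X\<^sub>i\<close>, let \<open>V = U\<^sub>n\<^sup>2\<close>, and let \<open>A\<close> be the sum of the \<open>\<alpha>\<^sub>j\<close>. Up to the gamma
constants, each of the \<open>n\<close> factors of the integrand is a half-line Gaussian transform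
\<open>\<integral>t\<^bsup>a-1\<^esup> e\<^bsup>zt - t\<^sup>2/2\<^esup> dt\<close> at the point \<open>z = e\<^bsup>-i\<pi>/4\<^esup> s\<close>.

The law of \<open>V\<close> enters through the product \<open>H(z)\<close> of these transforms. For independent gamma
variables \<open>S\<close> and \<open>V\<close> are independent and \<open>S\<close> has the gamma law with parameter \<open>A\<close>
(\<open>polar_law\<close>). Hence \<open>H(z) = \<integral>\<rho>(r) e\<^bsup>zr\<^esup> dr\<close>, where
\<open>\<rho>(r) = r\<^bsup>A-1\<^esup> E exp(-r\<^sup>2V/2) / \<Gamma>(A)\<close> (\<open>H_superposition\<close>).

The parameter \<open>x\<close> enters through the remaining factors. After multiplication by \<open>x\<^bsup>(A-1)/2\<^esup>\<close> they
are the integral of \<open>w\<^bsup>A-1\<^esup>\<close> against a heat kernel \<open>x\<^bsup>-1/2\<^esup> exp(-(w+z)\<^sup>2/(2x))\<close> at a complex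
point (\<open>K_heat\<close>), and the Laplace transform in \<open>x\<close> of the heat kernel is an exponential
(\<open>laplace_inverse_gauss\<close>). So the Laplace transform at \<open>q\<close> of the right-hand side of the
theorem, as a function of \<open>x\<close>, is a multiple of the real part of \<open>i \<integral>H(z) e\<^bsup>-kz\<^esup> dz\<close> along the ray
\<open>arg z = -\<pi>/4\<close>, where \<open>k = sqrt(2q)\<close>. Cauchy's theorem turns the ray into the negative
imaginary axis (\<open>H_rotate\<close>), where the real part is half of the Fourier inversion integral of \<open>\<rho>\<close> at
\<open>k\<close> (\<open>H_fourier\<close>), and the constants combine to \<open>E e\<^bsup>-qV\<^esup> / q\<close>, which is the Laplace transform of the
distribution function of \<open>V\<close> (\<open>cdf_laplace\<close>). A right-continuous function is determined by its
Laplace transform (\<open>laplace_injective\<close>), and both sides are right-continuous in \<open>x\<close>.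

All convergence questions are settled by one estimate of the half-line Gaussian transform in the
sector between the ray and the axis (\<open>gauss_laplace_sector_bound\<close>). It shows that the integrand
of the theorem is \<open>O(s\<^bsup>-p\<^esup>)\<close> with \<open>p\<close> the sum of \<open>min 1 (2\<alpha>\<^sub>j)\<close>, and \<open>p > 1\<close> because \<open>n \<ge> 2\<close> and
\<open>A > 1\<close> (\<open>sum_exponents\<close>); on the imaginary axis \<open>H\<close> is \<open>O(y\<^bsup>-A\<^esup>)\<close>, which is integrable because
\<open>A > 1\<close>.
\<close>

section \<open>Gamma integrals and half-line Gaussian transforms\<close>

lemma set_integrable_Gamma:
  fixes a c :: real
  assumes "a > 0" "c > 0"
  shows "set_integrable lborel {0<..} (\<lambda>t. t powr (a - 1) * exp (- (c * t)))"
proof -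
  have "(\<lambda>t. complex_of_real t powr (complex_of_real a - 1) / of_real (exp (c * t))) absolutely_integrable_on {0<..}"
    using assms by (intro absolutely_integrable_Gamma_integral) auto
  then have "(\<lambda>t. norm (complex_of_real t powr (complex_of_real a - 1) / of_real (exp (c * t)))) absolutely_integrable_on {0<..}"
    by (rule set_integrable_norm)
  then have "set_integrable lebesgue {0<..} (\<lambda>t. t powr (a - 1) * exp (- (c * t)))"
    by (rule set_integrable_cong[THEN iffD1, rotated -1])
       (auto simp: norm_divide norm_powr_real_powr exp_minus field_simps)
  then show ?thesis
    unfolding set_integrable_def by (subst (asm) integrable_completion) auto
qed

lemma set_integral_Gamma_one:
  fixes a :: real
  assumes "a > 0"
  shows "(LINT t:{0<..}|lborel. t powr (a - 1) * exp (- t)) = Gamma a"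
proof -
  have "((\<lambda>t. t powr (a - 1) / exp t) has_integral Gamma a) {0..}"
    using Gamma_integral_real assms by blast
  then have "((\<lambda>t. t powr (a - 1) * exp (- t)) has_integral Gamma a) {0<..}"
    by (subst (asm) has_integral_spike_set_eq[where T="{0<..}"])
       (auto simp: exp_minus divide_inverse intro: negligible_subset[OF negligible_sing[of 0]])
  then show ?thesis
    using set_borel_integral_eq_integral(2)[OF set_integrable_Gamma[OF assms, of 1]]
    by (simp add: integral_unique)
qed

lemma set_integral_real_scale:
  fixes f :: "real \<Rightarrow> 'b::{banach, second_countable_topology}"
  assumes "c > 0"
  shows "(LINT t:{0<..}|lborel. f t) = c *\<^sub>R (LINT t:{0<..}|lborel. f (c * t))"
  unfolding set_lebesgue_integral_def
  using lborel_integral_real_affine[of c "\<lambda>t. indicator {0<..} t *\<^sub>R f t" 0] assms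
  by (simp add: indicator_def zero_less_mult_iff)

lemma set_integral_Gamma:
  fixes a c :: real
  assumes "a > 0" "c > 0"
  shows "(LINT t:{0<..}|lborel. t powr (a - 1) * exp (- (c * t))) = Gamma a * c powr (- a)"
proof -
  have "Gamma a = c * (LINT t:{0<..}|lborel. (c * t) powr (a - 1) * exp (- (c * t)))"
    using set_integral_Gamma_one[OF assms(1)] set_integral_real_scale[OF assms(2), of "\<lambda>t. t powr (a - 1) * exp (- t)"]
    by simp
  also have "(LINT t:{0<..}|lborel. (c * t) powr (a - 1) * exp (- (c * t)))
      = (LINT t:{0<..}|lborel. c powr (a-1) * (t powr (a - 1) * exp (- (c * t))))"
    using assms by (intro set_lebesgue_integral_cong) (auto simp: powr_mult)
  also have "\<dots> = c powr (a - 1) * (LINT t:{0<..}|lborel. t powr (a - 1) * exp (- (c * t)))"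
    by simp
  finally show ?thesis
    using assms by (simp add: powr_minus powr_diff field_simps)
qed

text \<open>
Up to elementary factors this is the parabolic cylinder function \<open>D\<^bsub>-a\<^esub>(-z)\<close>. Without the factor
\<open>e\<^bsup>-z\<^sup>2/4\<^esup> / \<Gamma>(a)\<close> it is a superposition of exponentials in \<open>z\<close> with a positive weight.
\<close>
definition gauss_laplace :: "real \<Rightarrow> complex \<Rightarrow> complex" where
  "gauss_laplace a z =
     (CLINT t:{0<..}|lborel. of_real (t powr (a - 1)) * exp (z * of_real t - of_real (t\<^sup>2) / 2))"

text \<open>
Completing the square gives \<open>ut - t\<^sup>2/2 \<le> (u+1)\<^sup>2/2 - t\<close>, which leaves a gamma integral.
\<close>
lemma real_gauss_laplace_integrable:
  fixes a u :: real
  assumes "a > 0"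
  shows "set_integrable lborel {0<..} (\<lambda>t. t powr (a - 1) * exp (u * t - t\<^sup>2 / 2))"
proof (rule set_integrable_bound)
  show "set_integrable lborel {0<..} (\<lambda>t. exp ((u+1)\<^sup>2/2) * (t powr (a - 1) * exp (- (1 * t))))"
    by (intro set_integrable_mult_right set_integrable_Gamma assms) auto
  show "set_borel_measurable lborel {0<..} (\<lambda>t. t powr (a - 1) * exp (u * t - t\<^sup>2 / 2))"
    unfolding set_borel_measurable_def by measurable
  have "u * t - t\<^sup>2/2 \<le> (u+1)\<^sup>2/2 - t" for t
    using zero_le_power2[of "u+1-t"] by (simp add: power2_eq_square algebra_simps)
  then have "exp (u * t - t\<^sup>2/2) \<le> exp ((u+1)\<^sup>2/2) * exp (- t)" for t
    by (simp flip: exp_add)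
  then show "AE t in lborel. t \<in> {0<..} \<longrightarrow>
      norm (t powr (a - 1) * exp (u * t - t\<^sup>2 / 2)) \<le> norm (exp ((u+1)\<^sup>2/2) * (t powr (a - 1) * exp (- (1 * t))))"
    by (intro AE_I2 impI) (auto simp: abs_mult mult.left_commute intro!: mult_left_mono)
qed

lemma gauss_laplace_integrable:
  assumes "a > 0"
  shows "set_integrable lborel {0<..}
    (\<lambda>t. of_real (t powr (a - 1)) * exp (z * of_real t - of_real (t\<^sup>2) / 2) :: complex)"
proof (rule set_integrable_bound[OF real_gauss_laplace_integrable[OF assms, of "Re z"]])
  show "set_borel_measurable lborel {0<..} (\<lambda>t. of_real (t powr (a - 1)) * exp (z * of_real t - of_real (t\<^sup>2) / 2))"
    unfolding set_borel_measurable_def by measurable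
qed (auto simp: norm_mult abs_mult)

lemma norm_gauss_laplace_le:
  assumes "a > 0"
  shows "norm (gauss_laplace a z) \<le> (LINT t:{0<..}|lborel. t powr (a - 1) * exp (Re z * t - t\<^sup>2 / 2))"
proof -
  have "norm (gauss_laplace a z) \<le> (LINT t:{0<..}|lborel. norm (of_real (t powr (a - 1)) * exp (z * of_real t - of_real (t\<^sup>2) / 2)))"
    unfolding gauss_laplace_def using gauss_laplace_integrable[OF assms] by (rule set_integral_norm_bound)
  also have "\<dots> = (LINT t:{0<..}|lborel. t powr (a - 1) * exp (Re z * t - t\<^sup>2 / 2))"
    by (intro set_lebesgue_integral_cong) (auto simp: norm_mult)
  finally show ?thesis .
qed

lemma gauss_laplace_cnj: "gauss_laplace a (cnj z) = cnj (gauss_laplace a z)"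
  unfolding gauss_laplace_def set_lebesgue_integral_def Bochner_Integration.integral_cnj[symmetric]
  by (rule Bochner_Integration.integral_cong) (auto simp: exp_cnj)

section \<open>Contour estimates and growth in a sector\<close>

lemma set_integral_norm_le:
  fixes f :: "'a \<Rightarrow> 'b::{banach, second_countable_topology}"
  assumes "set_integrable M T g" "A \<subseteq> T" "\<And>t. t \<in> T \<Longrightarrow> 0 \<le> g t"
    and "\<And>t. t \<in> A \<Longrightarrow> norm (f t) \<le> g t"
  shows "norm (LINT t:A|M. f t) \<le> (LINT t:T|M. g t)"
proof -
  have "norm (LINT t:A|M. f t) \<le> (LINT t|M. norm (indicator A t *\<^sub>R f t))"
    unfolding set_lebesgue_integral_def by (rule integral_norm_bound)
  also have "\<dots> \<le> (LINT t:T|M. g t)"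
    unfolding set_lebesgue_integral_def using assms
    by (intro integral_mono') (auto simp: set_integrable_def indicator_def)
  finally show ?thesis .
qed

text \<open>
Contour integrals are only needed along straight segments, where they are differences of a
primitive, and over a closed polygon these differences telescope.
\<close>
lemma segment_integral:
  fixes p \<Psi> :: "complex \<Rightarrow> complex"
  assumes "\<alpha> \<le> \<beta>" and cont: "continuous_on S p"
    and der: "\<And>z. z \<in> S \<Longrightarrow> (\<Psi> has_field_derivative p z) (at z within S)"
    and path: "\<And>\<tau>. \<tau> \<in> {\<alpha>..\<beta>} \<Longrightarrow> c + of_real \<tau> * d \<in> S"
  shows "(CLINT \<tau>:{\<alpha>..\<beta>}|lborel. d * p (c + of_real \<tau> * d)) = \<Psi> (c + of_real \<beta> * d) - \<Psi> (c + of_real \<alpha> * d)"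
  unfolding set_lebesgue_integral_def
proof (rule integral_FTC_Icc)
  fix \<tau> assume "\<alpha> \<le> \<tau>" "\<tau> \<le> \<beta>"
  moreover have "((\<lambda>\<tau>. c + of_real \<tau> * d) has_vector_derivative d) (at \<tau> within {\<alpha>..\<beta>})"
    by (auto intro!: derivative_eq_intros)
  moreover have "(\<lambda>\<tau>. c + of_real \<tau> * d) ` {\<alpha>..\<beta>} \<subseteq> S"
    using path by auto
  ultimately have "(\<Psi> \<circ> (\<lambda>\<tau>. c + of_real \<tau> * d) has_vector_derivative d * p (c + of_real \<tau> * d)) (at \<tau> within {\<alpha>..\<beta>})"
    using path by (intro field_vector_diff_chain_within DERIV_subset[OF der]) auto
  then show "((\<lambda>\<tau>. \<Psi> (c + of_real \<tau> * d)) has_vector_derivative d * p (c + of_real \<tau> * d)) (at \<tau> within {\<alpha>..\<beta>})"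
    by (simp add: o_def)
next
  show "continuous_on {\<alpha>..\<beta>} (\<lambda>\<tau>. d * p (c + of_real \<tau> * d))"
    using path by (intro continuous_intros continuous_on_compose2[OF cont]) auto
qed fact

lemma segment_bound:
  fixes p \<Psi> :: "complex \<Rightarrow> complex"
  assumes "\<alpha> \<le> \<beta>" and cont: "continuous_on S p"
    and der: "\<And>z. z \<in> S \<Longrightarrow> (\<Psi> has_field_derivative p z) (at z within S)"
    and path: "\<And>\<tau>. \<tau> \<in> {\<alpha>..\<beta>} \<Longrightarrow> c + of_real \<tau> * d \<in> S"
    and g: "set_integrable lborel T g" "{\<alpha>..\<beta>} \<subseteq> T" "\<And>\<tau>. \<tau> \<in> T \<Longrightarrow> 0 \<le> g \<tau>"
    and le: "\<And>\<tau>. \<tau> \<in> {\<alpha>..\<beta>} \<Longrightarrow> cmod (p (c + of_real \<tau> * d)) \<le> g \<tau>"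
  shows "cmod (\<Psi> (c + of_real \<beta> * d) - \<Psi> (c + of_real \<alpha> * d)) \<le> cmod d * (LINT \<tau>:T|lborel. g \<tau>)"
proof -
  have "cmod (\<Psi> (c + of_real \<beta> * d) - \<Psi> (c + of_real \<alpha> * d)) \<le> (LINT \<tau>:T|lborel. cmod d * g \<tau>)"
  proof -
    have "\<Psi> (c + of_real \<beta> * d) - \<Psi> (c + of_real \<alpha> * d) = (CLINT \<tau>:{\<alpha>..\<beta>}|lborel. d * p (c + of_real \<tau> * d))"
      by (rule segment_integral[OF assms(1-4), symmetric])
    then show ?thesis
      using g le by (simp only:) (intro set_integral_norm_le, auto simp: norm_mult intro: mult_left_mono)
  qed
  then show ?thesis by simp
qed

text \<open>
The exponent \<open>a - 1\<close> has either sign: for \<open>a \<ge> 1\<close> the upper bound on \<open>r\<close> is used, for \<open>a < 1\<close> the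
lower one. A bound of this common form saves the case distinction later.
\<close>
lemma powr_minus_one_le:
  fixes a c m r z :: real
  assumes "a > 0" "0 < c" "c \<le> 1" "0 < m" "1 \<le> z" "c * m \<le> r" "r \<le> m * z"
  shows "r powr (a - 1) \<le> m powr (a - 1) * z powr a / c"
proof (cases "a \<ge> 1")
  case True
  have "0 < c * m" using assms by simp
  then have "r > 0" using assms by linarith
  have "r powr (a - 1) \<le> (m * z) powr (a - 1)"
    using True \<open>r > 0\<close> assms by (intro powr_mono2) auto
  also have "\<dots> = m powr (a - 1) * z powr (a - 1)"
    using assms by (simp add: powr_mult)
  also have "\<dots> \<le> m powr (a - 1) * z powr a"
    using assms by (intro mult_left_mono powr_mono) auto
  also have "\<dots> \<le> m powr (a - 1) * z powr a / c"
    using assms by (simp add: field_simps mult_left_le)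
  finally show ?thesis .
next
  case False
  have "r powr (a - 1) \<le> (c * m) powr (a - 1)"
    using False assms by (intro powr_mono2') auto
  also have "\<dots> = m powr (a - 1) * c powr (a - 1)"
    using assms by (simp add: powr_mult)
  also have "\<dots> \<le> m powr (a - 1) * (1 / c)"
    using assms powr_mono'[of "-1" "a - 1" c]
    by (intro mult_left_mono) (auto simp: powr_minus_divide)
  also have "\<dots> \<le> m powr (a - 1) * (z powr a / c)"
    using assms by (intro mult_left_mono divide_right_mono ge_one_powr_ge_zero) auto
  finally show ?thesis by simp
qed

text \<open>
With \<open>K = max 1 (a/e)\<close> one has \<open>1 + x \<le> K (1 + ex/a) \<le> K e\<^bsup>ex/a\<^esup>\<close>; raise this to the power \<open>a\<close>.
\<close>
lemma powr_le_exp: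
  fixes a e x :: real
  assumes "a > 0" "e > 0" "x \<ge> 0"
  shows "(1 + x) powr a \<le> (max 1 (a / e)) powr a * exp (e * x)"
proof -
  define K where "K = max 1 (a / e)"
  have "1 \<le> K" "x \<le> K * (e * x / a)"
    using assms mult_right_mono[of "a / e" K "e * x / a"] unfolding K_def by auto
  then have "1 + x \<le> K * (1 + e * x / a)"
    by (simp add: distrib_left)
  also have "\<dots> \<le> K * exp (e * x / a)"
    using \<open>1 \<le> K\<close> by (intro mult_left_mono exp_ge_add_one_self) auto
  finally have "(1 + x) powr a \<le> (K * exp (e * x / a)) powr a"
    using assms by (intro powr_mono2) auto
  also have "\<dots> = K powr a * exp (e * x)"
    using assms \<open>1 \<le> K\<close> by (simp add: powr_mult exp_powr_real)
  finally show ?thesis unfolding K_def .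
qed

lemma set_integrable_exp_neg:
  fixes c :: real
  assumes "c > 0"
  shows "set_integrable lborel {0..} (\<lambda>t. exp (- (c * t)))"
proof -
  have "set_integrable lborel {0<..} (\<lambda>t. exp (- (c * t)))"
    using set_integrable_Gamma[of 1 c] assms
    by (subst set_integrable_cong[where f'="\<lambda>t. t powr (1 - 1) * exp (- (c * t))"]) auto
  then show ?thesis
    unfolding set_integrable_def
  proof (rule integrable_cong_AE_imp)
    show "AE t in lborel. indicator {0<..} t *\<^sub>R exp (- (c * t)) = indicator {0..} t *\<^sub>R exp (- (c * t))"
      using AE_lborel_singleton[of 0] by eventually_elim (auto simp: indicator_def)
  qed auto
qed

lemma set_integrable_poly_exp:
  fixes a c m :: real
  assumes "a > 0" "c > 0" "m > 0"
  shows "set_integrable lborel {0..} (\<lambda>t. (1 + m * t) powr a * exp (- (c * t)))"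
proof (rule set_integrable_bound)
  define e where "e = c / (2 * m)"
  have "e > 0" using assms by (simp add: e_def)
  show "set_integrable lborel {0..} (\<lambda>t. (max 1 (a / e)) powr a * exp (- ((c/2) * t)))"
    using assms by (intro set_integrable_mult_right set_integrable_exp_neg) auto
  show "set_borel_measurable lborel {0..} (\<lambda>t. (1 + m * t) powr a * exp (- (c * t)))"
    unfolding set_borel_measurable_def by measurable
  have "(1 + m * t) powr a * exp (- (c * t)) \<le> (max 1 (a / e)) powr a * exp (- ((c/2) * t))" if "t \<ge> 0" for t
  proof -
    have "(1 + m * t) powr a * exp (- (c * t)) \<le> ((max 1 (a / e)) powr a * exp (e * (m * t))) * exp (- (c * t))"
      using assms that \<open>e > 0\<close> by (intro mult_right_mono powr_le_exp) auto
    also have "\<dots> = (max 1 (a / e)) powr a * exp (- ((c/2) * t))"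
      using assms by (simp add: e_def mult.assoc flip: exp_add)
    finally show ?thesis .
  qed
  then show "AE t in lborel. t \<in> {0..} \<longrightarrow>
      norm ((1 + m * t) powr a * exp (- (c * t))) \<le> norm ((max 1 (a / e)) powr a * exp (- ((c/2) * t)))"
    by auto
qed

lemma integrable_poly_gauss:
  fixes a :: real
  assumes "a > 0"
  shows "integrable lborel (\<lambda>y. (1 + \<bar>y\<bar>) powr a * exp (- (y\<^sup>2 / 2)))"
proof (rule Bochner_Integration.integrable_bound)
  show "integrable lborel (\<lambda>y. sqrt (4 * pi) * exp 1 * (max 1 (a / 1)) powr a * normal_density 0 (sqrt 2) y)"
    by (intro integrable_mult_right integrable_normal_density) auto
  have "(1 + \<bar>y\<bar>) powr a * exp (- (y\<^sup>2 / 2)) \<le> exp 1 * (max 1 (a / 1)) powr a * exp (- (y\<^sup>2 / 4))" for y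
  proof -
    have "(1 + \<bar>y\<bar>) powr a * exp (- (y\<^sup>2 / 2)) \<le> ((max 1 (a / 1)) powr a * exp (1 * \<bar>y\<bar>)) * exp (- (y\<^sup>2 / 2))"
      using assms by (intro mult_right_mono powr_le_exp) auto
    also have "\<dots> = (max 1 (a / 1)) powr a * exp (\<bar>y\<bar> - y\<^sup>2 / 2)"
      by (simp add: mult.assoc flip: exp_add)
    also have "\<dots> \<le> (max 1 (a / 1)) powr a * exp (1 - y\<^sup>2 / 4)"
      using zero_le_power2[of "\<bar>y\<bar> / 2 - 1"]
      by (intro mult_left_mono) (auto simp: power2_eq_square algebra_simps)
    also have "\<dots> = exp 1 * (max 1 (a / 1)) powr a * exp (- (y\<^sup>2 / 4))"
      by (simp flip: exp_add)
    finally show ?thesis .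
  qed
  then show "AE y in lborel. norm ((1 + \<bar>y\<bar>) powr a * exp (- (y\<^sup>2 / 2)))
      \<le> norm (sqrt (4 * pi) * exp 1 * (max 1 (a / 1)) powr a * normal_density 0 (sqrt 2) y)"
    by (intro AE_I2) (simp add: normal_density_def abs_mult real_sqrt_mult mult.assoc)
qed auto

lemma set_integral_poly_exp_scale:
  fixes a b :: real
  assumes "b > 0"
  shows "(LINT t:{0..}|lborel. (1 + 2 * b * t) powr a * exp (- (b / 2 * t)))
    = (LINT t:{0..}|lborel. (1 + 2 * t) powr a * exp (- (1 / 2 * t))) / b"
  unfolding set_lebesgue_integral_def
  using lborel_integral_real_affine[of b "\<lambda>t. indicator {0..} t *\<^sub>R ((1 + 2 * t) powr a * exp (- (1 / 2 * t)))" 0] assms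
  by (simp add: indicator_def zero_le_mult_iff mult_ac)

text \<open>
The two terms are the contributions of the end point \<open>t = 0\<close> and of the saddle point \<open>t = \<sigma>\<close> of the
integrand \<open>t\<^bsup>a-1\<^esup> e\<^bsup>\<sigma>t - t\<^sup>2/2\<^esup>\<close>, where \<open>\<sigma> = u - ib\<close>. The half-line is deformed into a segment from
near \<open>0\<close> in the direction \<open>-1 - i\<close>, along which \<open>e\<^bsup>\<sigma>t\<^esup>\<close> decays and \<open>e\<^bsup>-t\<^sup>2/2\<^esup>\<close> has modulus about one,
followed by the horizontal line through the saddle point, on which the integrand has modulus
\<open>|t|\<^bsup>a-1\<^esup> e\<^bsup>(u\<^sup>2-b\<^sup>2)/2 - y\<^sup>2/2\<^esup>\<close> at distance \<open>y\<close> from the saddle. The deformation starts at \<open>\<delta> = 1/b\<close> in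
order to avoid the branch point; the piece below \<open>\<delta>\<close> has the size of the first term. Both exponents
are sharp, as the integrability of the final integrand requires.
\<close>
lemma gauss_laplace_sector_bound:
  fixes a :: real
  assumes "a > 0"
  shows "\<exists>C\<ge>0. \<forall>u b. 0 \<le> u \<longrightarrow> u \<le> b \<longrightarrow> 2 \<le> b \<longrightarrow>
    cmod (gauss_laplace a (Complex u (- b))) \<le> C * (b powr (- a) + b powr (a - 1) * exp ((u\<^sup>2 - b\<^sup>2) / 2))"
proof -
  define I1 where "I1 = (LINT t:{0..}|lborel. (1 + 2 * t) powr a * exp (- (1 / 2 * t)))"
  define I2 where "I2 = (LINT y|lborel. (1 + \<bar>y\<bar>) powr a * exp (- (y\<^sup>2 / 2)))"
  have "I1 \<ge> 0" "I2 \<ge> 0"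
    unfolding I1_def I2_def set_lebesgue_integral_def by (auto intro!: integral_nonneg)
  define C where "C = exp 2 * Gamma a + 4 * exp 1 * I1 + 2 powr a * I2"
  have "Gamma a > 0" using assms by (rule Gamma_real_pos)
  have main: "cmod (gauss_laplace a (Complex u (- b))) \<le> C * (b powr (- a) + b powr (a - 1) * exp ((u\<^sup>2 - b\<^sup>2) / 2))"
    if u: "0 \<le> u" "u \<le> b" and b: "2 \<le> b" for u b
  proof -
    define \<sigma> where "\<sigma> = Complex u (- b)"
    define \<delta> where "\<delta> = 1 / b"
    have \<delta>: "0 < \<delta>" "\<delta> \<le> 1/2" "b * \<delta> = 1" "\<delta> \<le> b / 2"
      using b order_trans[of "1 / b" "1/2" "b/2"] by (auto simp: \<delta>_def field_simps)
    define S where "S = {t::complex. Re t - Im t > 0}"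
    define p where "p = (\<lambda>t. t powr (of_real a - 1) * exp (\<sigma> * t - t\<^sup>2 / 2))"
    have "S = {t. (1 - \<i>) \<bullet> t > 0}"
      by (auto simp: S_def inner_complex_def)
    then have S: "convex S" "open S"
      by (auto simp: convex_halfspace_gt open_halfspace_gt)
    have "t \<notin> \<real>\<^sub>\<le>\<^sub>0" if "t \<in> S" for t
      using that by (auto simp: S_def complex_nonpos_Reals_iff)
    then have hol: "p holomorphic_on S"
      unfolding p_def by (intro holomorphic_intros) auto
    then have cont: "continuous_on S p"
      by (rule holomorphic_on_imp_continuous_on)
    obtain \<Psi> where der: "\<And>z. z \<in> S \<Longrightarrow> (\<Psi> has_field_derivative p z) (at z within S)"
      using holomorphic_convex_primitive'[OF S hol] by blast
    have norm_p: "cmod (p t) = cmod t powr (a - 1) * exp (Re (\<sigma> * t - t\<^sup>2 / 2))" for t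
      unfolding p_def by (simp add: norm_mult norm_powr_real_powr' del: Re_divide_numeral)
    have Re_exponent: "Re (\<sigma> * t - t\<^sup>2 / 2) = u * Re t + b * Im t - ((Re t)\<^sup>2 - (Im t)\<^sup>2) / 2" for t
      by (simp add: \<sigma>_def Re_power2)
    define q where "q = (\<lambda>t. of_real (t powr (a - 1)) * exp (\<sigma> * of_real t - of_real (t\<^sup>2) / 2) :: complex)"
    have q_int: "set_integrable lborel {0<..} q"
      unfolding q_def by (rule gauss_laplace_integrable[OF assms])

    \<comment> \<open>Here \<open>ut\<close> and \<open>bt\<close> are at most \<open>1\<close>, so \<open>1 \<le> e e\<^bsup>-bt\<^esup>\<close> brings in a gamma integral of the right size.\<close>
    have small: "cmod (CLINT t:{0<..<\<delta>}|lborel. q t) \<le> exp 2 * Gamma a * b powr (- a)"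
    proof -
      have "cmod (CLINT t:{0<..<\<delta>}|lborel. q t) \<le> (LINT t:{0<..}|lborel. exp 2 * (t powr (a - 1) * exp (- (b * t))))"
      proof (rule set_integral_norm_le)
        fix t assume t: "t \<in> {0<..<\<delta>}"
        have "b * t \<le> 1" "u * t \<le> b * t"
          using t \<delta> b u mult_left_mono[of t \<delta> b] mult_right_mono[of u b t] by auto
        then have "u * t - t\<^sup>2/2 \<le> 2 - b * t"
          using zero_le_power2[of t] by linarith
        then have "exp (u * t - t\<^sup>2/2) \<le> exp (2 - b * t)"
          by simp
        then show "cmod (q t) \<le> exp 2 * (t powr (a - 1) * exp (- (b * t)))"
          using t by (auto simp: q_def norm_mult \<sigma>_def exp_diff exp_minus field_simps intro!: mult_left_mono)
      qed (use assms b set_integrable_Gamma[of a b] in auto)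
      then show ?thesis
        using set_integral_Gamma[of a b] assms b by simp
    qed

    \<comment> \<open>The segment ends at \<open>\<delta> - b - ib\<close>, at the height of the saddle point.\<close>
    have left: "cmod (\<Psi> (of_real \<delta> + of_real b * (-1 - \<i>)) - \<Psi> (of_real \<delta>)) \<le> 4 * exp 1 * I1 * b powr (- a)"
    proof -
      define g where "g = (\<lambda>\<tau>. (2 * exp 1 * \<delta> powr (a - 1)) * ((1 + 2 * b * \<tau>) powr a * exp (- (b / 2 * \<tau>))))"
      have "cmod (\<Psi> (of_real \<delta> + of_real b * (-1 - \<i>)) - \<Psi> (of_real \<delta> + of_real 0 * (-1 - \<i>)))
        \<le> cmod (-1 - \<i>) * (LINT \<tau>:{0..}|lborel. g \<tau>)"
      proof (rule segment_bound[OF _ cont der])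
        show "set_integrable lborel {0..} g"
          unfolding g_def using assms b set_integrable_poly_exp[of a "b/2" "2*b"] by (intro set_integrable_mult_right) auto
        fix \<tau> assume \<tau>: "\<tau> \<in> {0..b}"
        define w where "w = of_real \<delta> + of_real \<tau> * (-1 - \<i>)"
        have w: "Re w = \<delta> - \<tau>" "Im w = - \<tau>" by (auto simp: w_def)
        show "of_real \<delta> + of_real \<tau> * (-1 - \<i>) \<in> S"
          using \<delta> by (simp add: S_def)
        have lo: "1/2 * \<delta> \<le> cmod w"
          using abs_Re_le_cmod[of w] abs_Im_le_cmod[of w] w by linarith
        have "cmod w \<le> \<bar>\<delta> - \<tau>\<bar> + \<bar>\<tau>\<bar>"
          using cmod_le[of w] w by simp
        also have "\<dots> \<le> \<delta> + 2 * (b * \<delta>) * \<tau>"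
          using \<delta> \<tau> by auto
        also have "\<dots> = \<delta> * (1 + 2 * b * \<tau>)"
          by (simp add: algebra_simps)
        finally have "cmod w powr (a - 1) \<le> \<delta> powr (a - 1) * (1 + 2 * b * \<tau>) powr a / (1/2)"
          using assms \<delta> \<tau> b lo by (intro powr_minus_one_le) auto
        moreover have "Re (\<sigma> * w - w\<^sup>2 / 2) \<le> 1 - b / 2 * \<tau>"
        proof -
          have "u * \<delta> \<le> 1"
            using u \<delta> mult_right_mono[of u b \<delta>] by auto
          moreover have "\<delta> * \<tau> \<le> b / 2 * \<tau>" "0 \<le> u * \<tau>" "0 \<le> \<delta>\<^sup>2"
            using \<delta> \<tau> u mult_right_mono[of \<delta> "b/2" \<tau>] by auto
          moreover have "Re (\<sigma> * w - w\<^sup>2 / 2) = u * \<delta> - u * \<tau> - b * \<tau> - \<delta>\<^sup>2 / 2 + \<delta> * \<tau>"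
            unfolding Re_exponent w by (simp add: power2_eq_square field_simps)
          ultimately show ?thesis by linarith
        qed
        ultimately have "cmod (p w) \<le> (\<delta> powr (a - 1) * (1 + 2 * b * \<tau>) powr a / (1/2)) * exp (1 - b / 2 * \<tau>)"
          unfolding norm_p by (intro mult_mono) auto
        also have "exp (1 - b / 2 * \<tau>) = exp 1 * exp (- (b / 2 * \<tau>))"
          by (simp only: mult_exp_exp) simp
        finally show "cmod (p (of_real \<delta> + of_real \<tau> * (-1 - \<i>))) \<le> g \<tau>"
          unfolding w_def[symmetric] by (simp add: g_def mult_ac)
      qed (use b in \<open>auto simp: g_def\<close>)
      also have "(LINT \<tau>:{0..}|lborel. g \<tau>) = 2 * exp 1 * \<delta> powr (a - 1) * (I1 / b)"
        unfolding g_def I1_def using set_integral_poly_exp_scale[of b a] b by simp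
      also have "\<dots> = 2 * exp 1 * I1 * b powr (- a)"
        using b by (simp add: \<delta>_def powr_divide powr_diff powr_minus field_simps)
      also have "cmod (-1 - \<i>) * \<dots> \<le> 2 * \<dots>"
        using \<open>I1 \<ge> 0\<close> cmod_le[of "-1 - \<i>"] by (intro mult_right_mono) auto
      finally show ?thesis by simp
    qed

    \<comment> \<open>Parametrised by the distance \<open>y\<close> from the saddle point \<open>\<sigma>\<close>; the left end is the end of the segment.\<close>
    have horizontal: "cmod (\<Psi> (\<sigma> + of_real (R - u) * 1) - \<Psi> (\<sigma> + of_real (\<delta> - b - u) * 1))
        \<le> 2 powr a * I2 * (b powr (a - 1) * exp ((u\<^sup>2 - b\<^sup>2) / 2))" if "R \<ge> 1" for R
    proof -
      define g where "g = (\<lambda>y. (2 powr a * (b powr (a - 1) * exp ((u\<^sup>2 - b\<^sup>2) / 2))) * ((1 + \<bar>y\<bar>) powr a * exp (- (y\<^sup>2 / 2))))"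
      have "cmod (\<Psi> (\<sigma> + of_real (R - u) * 1) - \<Psi> (\<sigma> + of_real (\<delta> - b - u) * 1))
        \<le> cmod 1 * (LINT y:UNIV|lborel. g y)"
      proof (rule segment_bound[OF _ cont der])
        show "set_integrable lborel UNIV g"
          unfolding g_def using integrable_poly_gauss[OF assms]
          by (intro set_integrable_mult_right) (auto simp: set_integrable_def)
        fix y assume y: "y \<in> {\<delta> - b - u..R - u}"
        define w where "w = \<sigma> + of_real y * 1"
        have w: "Re w = u + y" "Im w = - b" by (auto simp: w_def \<sigma>_def)
        show "\<sigma> + of_real y * 1 \<in> S"
          using \<delta> y by (simp add: S_def \<sigma>_def)
        have lo: "1 * b \<le> cmod w"
          using abs_Im_le_cmod[of w] w b by linarith
        have "cmod w \<le> \<bar>u + y\<bar> + \<bar>b\<bar>"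
          using cmod_le[of w] w by simp
        also have "\<dots> \<le> b * (2 * (1 + \<bar>y\<bar>))"
          using b u mult_right_mono[of 2 b "\<bar>y\<bar>"] by (simp add: algebra_simps) 
        finally have "cmod w powr (a - 1) \<le> b powr (a - 1) * (2 * (1 + \<bar>y\<bar>)) powr a / 1"
          using assms b lo by (intro powr_minus_one_le) auto
        also have "\<dots> = 2 powr a * b powr (a - 1) * (1 + \<bar>y\<bar>) powr a"
          using powr_mult[of 2 "1 + \<bar>y\<bar>" a] by (simp only: mult_ac div_by_1)
        finally have "cmod (p w) \<le> (2 powr a * b powr (a - 1) * (1 + \<bar>y\<bar>) powr a) * exp ((u\<^sup>2 - b\<^sup>2) / 2 - y\<^sup>2 / 2)"
          unfolding norm_p Re_exponent w
          by (intro mult_mono) (auto simp: power2_eq_square field_simps)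
        also have "exp ((u\<^sup>2 - b\<^sup>2) / 2 - y\<^sup>2 / 2) = exp ((u\<^sup>2 - b\<^sup>2) / 2) * exp (- (y\<^sup>2 / 2))"
          by (simp only: mult_exp_exp) simp
        finally show "cmod (p (\<sigma> + of_real y * 1)) \<le> g y"
          unfolding w_def[symmetric] by (simp add: g_def mult_ac)
      qed (use b u \<delta> that in \<open>auto simp: g_def\<close>)
      also have "(LINT y:UNIV|lborel. g y) = (2 powr a * (b powr (a - 1) * exp ((u\<^sup>2 - b\<^sup>2) / 2))) * I2"
        unfolding g_def I2_def by (simp add: set_lebesgue_integral_def)
      finally show ?thesis by (simp add: mult_ac)
    qed

    define V where "V = (\<lambda>R. b * ((R + b) powr a * exp (u * R + b\<^sup>2 / 2 - R\<^sup>2 / 2)))"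
    \<comment> \<open>The side that closes the contour at real part \<open>R\<close>; it vanishes in the limit.\<close>
    have vertical: "cmod (\<Psi> (of_real R + of_real b * (- \<i>)) - \<Psi> (of_real R + of_real 0 * (- \<i>))) \<le> V R"
      if R: "R \<ge> 1" for R
    proof -
      define G where "G = (R + b) powr a * exp (u * R + b\<^sup>2 / 2 - R\<^sup>2 / 2)"
      have "cmod (\<Psi> (of_real R + of_real b * (- \<i>)) - \<Psi> (of_real R + of_real 0 * (- \<i>)))
        \<le> cmod (- \<i>) * (LINT y:{0..b}|lborel. G)"
      proof (rule segment_bound[OF _ cont der])
        fix y assume y: "y \<in> {0..b}"
        define w where "w = of_real R + of_real y * (- \<i>)"
        have w: "Re w = R" "Im w = - y" by (auto simp: w_def)
        show "of_real R + of_real y * (- \<i>) \<in> S"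
          using R y by (simp add: S_def)
        have lo: "1 \<le> cmod w"
          using abs_Re_le_cmod[of w] w R by linarith
        have hi: "cmod w \<le> R + b"
          using cmod_le[of w] w R y by simp
        have "cmod w powr (a - 1) \<le> cmod w powr a"
          using lo by (intro powr_mono) auto
        also have "\<dots> \<le> (R + b) powr a"
          using hi assms by (intro powr_mono2) auto
        moreover have exponent: "u * R + b * (- y) - (R\<^sup>2 - (- y)\<^sup>2) / 2 \<le> u * R + b\<^sup>2 / 2 - R\<^sup>2 / 2"
        proof -
          have "y\<^sup>2 \<le> b\<^sup>2" "0 \<le> b * y"
            using y b by (auto intro: power_mono)
          then show ?thesis unfolding power2_minus by (simp add: diff_divide_distrib)
        qed
        ultimately have "cmod (p w) \<le> (R + b) powr a * exp (u * R + b\<^sup>2 / 2 - R\<^sup>2 / 2)"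
          unfolding norm_p Re_exponent w using exponent by (intro mult_mono) auto
        then show "cmod (p (of_real R + of_real y * (- \<i>))) \<le> G"
          unfolding w_def[symmetric] G_def .
      qed (use b in \<open>auto simp: G_def set_integrable_def\<close>)
      also have "\<dots> = V R"
        using b by (simp add: G_def V_def set_lebesgue_integral_def)
      finally show ?thesis .
    qed

    define B where "B = 4 * exp 1 * I1 * b powr (- a) + 2 powr a * I2 * (b powr (a - 1) * exp ((u\<^sup>2 - b\<^sup>2) / 2))"
    have truncated: "cmod (CLINT t:{\<delta>..R}|lborel. q t) \<le> B + V R" if "R \<ge> 1" for R
    proof -
      have "(CLINT t:{\<delta>..R}|lborel. q t) = (CLINT t:{\<delta>..R}|lborel. 1 * p (0 + of_real t * 1))"
        using \<delta> by (intro set_lebesgue_integral_cong) (auto simp: p_def q_def powr_of_real[symmetric])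
      also have "\<dots> = \<Psi> (0 + of_real R * 1) - \<Psi> (0 + of_real \<delta> * 1)"
        by (rule segment_integral[OF _ cont der]) (use \<delta> that in \<open>auto simp: S_def\<close>)
      also have "\<dots> = (\<Psi> (of_real \<delta> + of_real b * (-1 - \<i>)) - \<Psi> (of_real \<delta>))
          + (\<Psi> (\<sigma> + of_real (R - u) * 1) - \<Psi> (\<sigma> + of_real (\<delta> - b - u) * 1))
          - (\<Psi> (of_real R + of_real b * (- \<i>)) - \<Psi> (of_real R + of_real 0 * (- \<i>)))"
      proof -
        have "\<sigma> + of_real (R - u) * 1 = of_real R + of_real b * (- \<i>)"
          "\<sigma> + of_real (\<delta> - b - u) * 1 = of_real \<delta> + of_real b * (-1 - \<i>)"
          by (auto simp: \<sigma>_def complex_eq_iff)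
        then show ?thesis by (simp only:) simp
      qed
      finally have eq: "(CLINT t:{\<delta>..R}|lborel. q t) = (\<Psi> (of_real \<delta> + of_real b * (-1 - \<i>)) - \<Psi> (of_real \<delta>))
          + (\<Psi> (\<sigma> + of_real (R - u) * 1) - \<Psi> (\<sigma> + of_real (\<delta> - b - u) * 1))
          - (\<Psi> (of_real R + of_real b * (- \<i>)) - \<Psi> (of_real R + of_real 0 * (- \<i>)))" .
      have triangle: "cmod (x + y - z) \<le> r + s + t" if "cmod x \<le> r" "cmod y \<le> s" "cmod z \<le> t" for x y z r s t
        using that norm_triangle_ineq4[of "x + y" z] norm_triangle_ineq[of x y] by linarith
      show ?thesis
        unfolding eq B_def by (rule triangle[OF left horizontal[OF that] vertical[OF that]])
    qed
    have V0: "(V \<longlongrightarrow> 0) at_top"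
    proof (rule Lim_null_comparison)
      define K where "K = b * ((max 1 (a / 1)) powr a)"
      have "norm (V R) \<le> K * exp ((R + b) + (u * R + b\<^sup>2 / 2 - R\<^sup>2 / 2))" if "R \<ge> 1" for R
      proof -
        have "(R + b) powr a \<le> (1 + (R + b)) powr a"
          using that b assms by (intro powr_mono2) auto
        also have "\<dots> \<le> (max 1 (a / 1)) powr a * exp (1 * (R + b))"
          using that b assms by (intro powr_le_exp) auto
        finally have "V R \<le> b * (((max 1 (a / 1)) powr a * exp (1 * (R + b))) * exp (u * R + b\<^sup>2 / 2 - R\<^sup>2 / 2))"
          unfolding V_def using b by (intro mult_left_mono mult_right_mono) auto
        moreover have "V R \<ge> 0" using b by (simp add: V_def)
        ultimately show ?thesis by (simp add: K_def exp_add mult_ac)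
      qed
      then show "\<forall>\<^sub>F R in at_top. norm (V R) \<le> K * exp ((R + b) + (u * R + b\<^sup>2 / 2 - R\<^sup>2 / 2))"
        by (intro eventually_mono[OF eventually_ge_at_top[of 1]])
      have "((\<lambda>R. exp ((R + b) + (u * R + b\<^sup>2 / 2 - R\<^sup>2 / 2))) \<longlongrightarrow> 0) at_top"
        by real_asymp
      then show "((\<lambda>R. K * exp ((R + b) + (u * R + b\<^sup>2 / 2 - R\<^sup>2 / 2))) \<longlongrightarrow> 0) at_top"
        using tendsto_mult_right_zero by blast
    qed
    have "((\<lambda>R. CLINT t:{\<delta>..R}|lborel. q t) \<longlongrightarrow> (CLINT t:{\<delta>..}|lborel. q t)) at_top"
      using \<delta> by (intro tendsto_set_lebesgue_integral_at_top set_integrable_subset[OF q_int]) auto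
    then have "((\<lambda>R. cmod (CLINT t:{\<delta>..R}|lborel. q t)) \<longlongrightarrow> cmod (CLINT t:{\<delta>..}|lborel. q t)) at_top"
      by (rule tendsto_norm)
    then have large: "cmod (CLINT t:{\<delta>..}|lborel. q t) \<le> B + 0"
    proof (rule tendsto_le[OF _ tendsto_add[OF tendsto_const V0], rotated])
      show "\<forall>\<^sub>F R in at_top. cmod (CLINT t:{\<delta>..R}|lborel. q t) \<le> B + V R"
        by (intro eventually_mono[OF eventually_ge_at_top[of 1]] truncated)
    qed simp

    have "gauss_laplace a \<sigma> = (CLINT t:{0<..<\<delta>} \<union> {\<delta>..}|lborel. q t)"
      unfolding gauss_laplace_def q_def[symmetric] using \<delta> by (intro arg_cong2[where f="\<lambda>A. set_lebesgue_integral lborel A"]) auto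
    also have "\<dots> = (CLINT t:{0<..<\<delta>}|lborel. q t) + (CLINT t:{\<delta>..}|lborel. q t)"
      using \<delta> by (intro set_integral_Un set_integrable_subset[OF q_int]) auto
    finally have "cmod (gauss_laplace a \<sigma>) \<le> cmod (CLINT t:{0<..<\<delta>}|lborel. q t) + cmod (CLINT t:{\<delta>..}|lborel. q t)"
      by (simp only: norm_triangle_ineq)
    also have "\<dots> \<le> exp 2 * Gamma a * b powr (- a) + B"
      using small large by linarith
    also have "\<dots> \<le> C * b powr (- a) + C * (b powr (a - 1) * exp ((u\<^sup>2 - b\<^sup>2) / 2))"
    proof -
      have "exp 2 * Gamma a + 4 * exp 1 * I1 \<le> C" "2 powr a * I2 \<le> C"
        using \<open>I1 \<ge> 0\<close> \<open>I2 \<ge> 0\<close> \<open>Gamma a > 0\<close> by (auto simp: C_def)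
      then have "(exp 2 * Gamma a + 4 * exp 1 * I1) * b powr (- a) \<le> C * b powr (- a)"
        "2 powr a * I2 * (b powr (a - 1) * exp ((u\<^sup>2 - b\<^sup>2) / 2)) \<le> C * (b powr (a - 1) * exp ((u\<^sup>2 - b\<^sup>2) / 2))"
        using b by (auto intro!: mult_right_mono)
      then show ?thesis
        unfolding B_def distrib_right by linarith
    qed
    finally show ?thesis by (simp add: \<sigma>_def distrib_left)
  qed
  have "C \<ge> 0"
    using \<open>I1 \<ge> 0\<close> \<open>I2 \<ge> 0\<close> \<open>Gamma a > 0\<close> by (simp add: C_def)
  with main show ?thesis by blast
qed

section \<open>The Laplace transform of the heat kernel at a complex point\<close>

text \<open>
An odd primitive of \<open>e\<^bsup>-w\<^sup>2\<^esup>\<close> (half of \<open>sqrt \<pi>\<close> times the error function). Its limit at infinity is the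
same along all curves that stay in a sector \<open>|Im w| \<le> c Re w\<close> with \<open>c < 1\<close>, because there the vertical
segment from the real axis to \<open>w\<close> contributes at most \<open>|w| e\<^bsup>-(1-c\<^sup>2) (Re w)\<^sup>2\<^esup>\<close>.
\<close>
lemma gauss_primitive:
  obtains E :: "complex \<Rightarrow> complex"
  where "\<And>w. (E has_field_derivative exp (- w\<^sup>2)) (at w)" "\<And>w. E (- w) = - E w"
    "\<And>(F :: real filter) r m c. filterlim r at_top F \<Longrightarrow> c < 1 \<Longrightarrow>
       (\<forall>\<^sub>F x in F. \<bar>m x\<bar> \<le> c * r x) \<Longrightarrow> ((\<lambda>x. E (Complex (r x) (m x))) \<longlongrightarrow> of_real (sqrt pi / 2)) F"
proof -
  have "(\<lambda>w::complex. exp (- w\<^sup>2)) holomorphic_on UNIV"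
    by (intro holomorphic_intros)
  from holomorphic_convex_primitive'[OF convex_UNIV open_UNIV this]
  obtain \<Psi> :: "complex \<Rightarrow> complex" where "\<And>w. w \<in> UNIV \<Longrightarrow> (\<Psi> has_field_derivative exp (- w\<^sup>2)) (at w)" by blast
  then have \<Psi>: "(\<Psi> has_field_derivative exp (- w\<^sup>2)) (at w)" for w by simp
  define E where "E = (\<lambda>w. (\<Psi> w - \<Psi> (- w)) / 2)"
  have der: "(E has_field_derivative exp (- w\<^sup>2)) (at w)" for w
    unfolding E_def
    by (auto intro!: derivative_eq_intros DERIV_chain2[OF \<Psi>])
  have odd: "E (- w) = - E w" for w
    by (simp add: E_def field_simps)
  have cont: "continuous_on UNIV (\<lambda>w::complex. exp (- w\<^sup>2))"
    by (intro continuous_intros)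
  have "set_integrable lborel {0..} (\<lambda>t::real. exp (- t\<^sup>2))"
    using gaussian_moment_0 by (simp add: set_integrable_def has_bochner_integral_iff)
  then have "((\<lambda>R. LINT t:{0..R}|lborel. exp (- t\<^sup>2)) \<longlongrightarrow> (LINT t:{0::real..}|lborel. exp (- t\<^sup>2))) at_top"
    by (intro tendsto_set_lebesgue_integral_at_top) auto
  then have "((\<lambda>R. of_real (LINT t:{0..R}|lborel. exp (- t\<^sup>2)) :: complex) \<longlongrightarrow> of_real (LINT t:{0..}|lborel. exp (- t\<^sup>2))) at_top"
    by (rule tendsto_of_real)
  also have "(LINT t:{0..}|lborel. exp (- t\<^sup>2)) = sqrt pi / 2"
    using gaussian_moment_0 by (simp add: set_lebesgue_integral_def has_bochner_integral_iff)
  also have "(\<lambda>R. of_real (LINT t:{0..R}|lborel. exp (- t\<^sup>2)) :: complex) = (\<lambda>R. if R \<ge> 0 then E (of_real R) else 0)"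
  proof
    fix R :: real
    show "of_real (LINT t:{0..R}|lborel. exp (- t\<^sup>2)) = (if R \<ge> 0 then E (of_real R) else 0)"
    proof (cases "R \<ge> 0")
      case True
      have "of_real (LINT t:{0..R}|lborel. exp (- t\<^sup>2)) = (CLINT t:{0..R}|lborel. 1 * exp (- (0 + of_real t * 1 :: complex)\<^sup>2))"
        by (subst set_integral_complex_of_real[symmetric]) (simp flip: exp_of_real)
      also have "\<dots> = E (0 + of_real R * 1) - E (0 + of_real 0 * 1)"
        using True by (intro segment_integral[OF _ cont, of _ _ E]) (auto simp: der)
      finally show ?thesis using True odd[of 0] by simp
    qed (simp add: set_lebesgue_integral_def)
  qed
  finally have real_lim: "((\<lambda>R. E (of_real R)) \<longlongrightarrow> of_real (sqrt pi / 2)) at_top"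
    by (rule Lim_transform_eventually) (auto intro: eventually_mono[OF eventually_ge_at_top[of 0]])
  have near: "cmod (E (Complex r m) - E (of_real r)) \<le> \<bar>m\<bar> * exp (m\<^sup>2 - r\<^sup>2)" for r m
  proof -
    define d where "d = (if m \<ge> 0 then \<i> else - \<i>)"
    have "cmod (E (of_real r + of_real \<bar>m\<bar> * d) - E (of_real r + of_real 0 * d))
      \<le> cmod d * (LINT y:{0..\<bar>m\<bar>}|lborel. exp (m\<^sup>2 - r\<^sup>2))"
    proof (rule segment_bound[OF _ cont, of _ _ E])
      fix y assume y: "y \<in> {0..\<bar>m\<bar>}"
      have "Re ((of_real r + of_real y * d)\<^sup>2) = r\<^sup>2 - y\<^sup>2"
        by (simp add: d_def Re_power2)
      moreover have "y\<^sup>2 \<le> m\<^sup>2" using y by (simp add: abs_le_square_iff[symmetric])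
      ultimately show "cmod (exp (- (of_real r + of_real y * d)\<^sup>2)) \<le> exp (m\<^sup>2 - r\<^sup>2)"
        by simp
    qed (auto simp: der set_integrable_def)
    also have "of_real r + of_real \<bar>m\<bar> * d = Complex r m"
      by (simp add: d_def complex_eq_iff)
    finally show ?thesis by (simp add: set_lebesgue_integral_def d_def split: if_splits)
  qed
  show thesis
  proof (rule that[of E])
    fix F :: "real filter" and r m :: "real \<Rightarrow> real" and c :: real
    assume r: "filterlim r at_top F" and c: "c < 1" and m: "\<forall>\<^sub>F x in F. \<bar>m x\<bar> \<le> c * r x"
    have pos: "\<forall>\<^sub>F x in F. r x > 1"
      using filterlim_at_top_dense[THEN iffD1, OF r] by blast
    define c0 where "c0 = max c 0"
    have c0: "0 \<le> c0" "c0 < 1" using c by (auto simp: c0_def)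
    have "((\<lambda>x. E (Complex (r x) (m x)) - E (of_real (r x))) \<longlongrightarrow> 0) F"
    proof (rule Lim_null_comparison)
      show "\<forall>\<^sub>F x in F. norm (E (Complex (r x) (m x)) - E (of_real (r x))) \<le> r x * exp (- ((1 - c0\<^sup>2) * (r x)\<^sup>2))"
        using m pos
      proof eventually_elim
        case (elim x)
        then have "\<bar>m x\<bar> \<le> c0 * r x"
          by (smt (verit) c0_def max.cobounded1 mult_right_mono)
        then have "(m x)\<^sup>2 \<le> (c0 * r x)\<^sup>2"
          by (metis abs_ge_zero power2_abs power_mono)
        moreover have "c0 * r x \<le> 1 * r x" using c0 elim by (intro mult_right_mono) auto
        ultimately have "\<bar>m x\<bar> * exp ((m x)\<^sup>2 - (r x)\<^sup>2) \<le> r x * exp (- ((1 - c0\<^sup>2) * (r x)\<^sup>2))"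
          using \<open>\<bar>m x\<bar> \<le> c0 * r x\<close> elim
          by (intro mult_mono) (linarith, auto simp: power_mult_distrib algebra_simps)
        with near[of "r x" "m x"] show ?case by linarith
      qed
      have "1 - c0\<^sup>2 > 0" using c0 by (simp add: power_less_one_iff abs_square_less_1)
      then have "((\<lambda>y. y * exp (- ((1 - c0\<^sup>2) * y\<^sup>2))) \<longlongrightarrow> 0) at_top"
        by real_asymp
      then show "((\<lambda>x. r x * exp (- ((1 - c0\<^sup>2) * (r x)\<^sup>2))) \<longlongrightarrow> 0) F"
        using r by (rule filterlim_compose)
    qed
    from tendsto_add[OF this filterlim_compose[OF real_lim r]]
    show "((\<lambda>x. E (Complex (r x) (m x))) \<longlongrightarrow> of_real (sqrt pi / 2)) F" by simp
  qed (use der odd in auto)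
qed

text \<open>
With \<open>y = sqrt x\<close> and \<open>\<zeta> = z / sqrt 2\<close> the exponent is \<open>-(sqrt q y \<mp> \<zeta>/y)\<^sup>2 \<mp> kz\<close> for either sign,
\<open>k = sqrt(2q)\<close>. The derivatives of the two arguments \<open>sqrt q y \<mp> \<zeta>/y\<close> add up to \<open>2 sqrt q\<close>, so a
combination of two error functions is an explicit primitive, also for complex \<open>z\<close>. The condition on
\<open>z\<close> keeps the arguments in the sector where the error function has a limit.
\<close>
lemma laplace_inverse_gauss:
  fixes z :: complex and q :: real
  assumes "q > 0" and z: "\<bar>Im z\<bar> < Re z"
  shows "(CLINT x:{0<..}|lborel. of_real (exp (- (q * x)) * x powr (- 1 / 2)) * exp (- z\<^sup>2 / of_real (2 * x)))
    = of_real (sqrt (pi / q)) * exp (- (of_real (sqrt (2 * q)) * z))"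
proof -
  let ?y = "\<lambda>x. x powr (- 1/2) / sqrt 2"
  obtain E where der: "\<And>w. (E has_field_derivative exp (- w\<^sup>2)) (at w)" and odd: "\<And>w. E (- w) = - E w"
    and lim: "\<And>(F :: real filter) r m c. filterlim r at_top F \<Longrightarrow> c < 1 \<Longrightarrow>
       (\<forall>\<^sub>F x in F. \<bar>m x\<bar> \<le> c * r x) \<Longrightarrow> ((\<lambda>x. E (Complex (r x) (m x))) \<longlongrightarrow> of_real (sqrt pi / 2)) F"
    using gauss_primitive by blast
  have "Re z > 0" using z by linarith
  define k where "k = sqrt (2 * q)"
  define P where "P = (\<lambda>\<epsilon> x. of_real (sqrt q * x powr (1/2)) + of_real \<epsilon> * z * of_real (?y x) :: complex)"
  define \<Theta> where "\<Theta> = (\<lambda>x. E (P (-1) x) + exp (2 * (of_real k * z)) * E (P 1 x))"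
  define f where "f = (\<lambda>x. of_real (exp (- (q * x)) * x powr (- 1 / 2)) * exp (- z\<^sup>2 / of_real (2 * x)))"
  define g where "g = (\<lambda>x. of_real (sqrt q) * exp (of_real k * z) * f x)"
  have f_int: "set_integrable lborel {0<..} f"
  proof (rule set_integrable_bound)
    show "set_integrable lborel {0<..} (\<lambda>t. t powr (1/2 - 1) * exp (- (q * t)))"
      using assms by (intro set_integrable_Gamma) auto
    show "set_borel_measurable lborel {0<..} f"
      unfolding set_borel_measurable_def f_def by measurable
    have "(Im z)\<^sup>2 \<le> (Re z)\<^sup>2"
      using z by (simp add: abs_le_square_iff[symmetric])
    then have "Re (- z\<^sup>2 / of_real (2 * x)) \<le> 0" if "x > 0" for x
      using that by (simp add: Re_power2 Re_divide_of_real field_simps del: of_real_mult)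
    then show "AE x in lborel. x \<in> {0<..} \<longrightarrow> norm (f x) \<le> norm (x powr (1/2 - 1) * exp (- (q * x)))"
      by (auto simp: f_def norm_mult mult.commute simp del: of_real_mult intro!: mult_left_le)
  qed
  \<comment> \<open>\<open>P (-1)\<close> and \<open>P 1\<close> are the two arguments of the error function, with the sign of \<open>\<zeta>/y\<close>.\<close>
  have P_sq: "(P \<epsilon> x)\<^sup>2 = of_real (q * x) + of_real (\<epsilon> * k) * z + z\<^sup>2 / of_real (2 * x)" if "x > 0" "\<epsilon>\<^sup>2 = 1" for x \<epsilon>
  proof -
    have "(x powr (1/2)) * (x powr (- 1/2)) = 1" "(x powr (1/2))\<^sup>2 = x" "(x powr (- 1/2))\<^sup>2 = 1 / x"
      using that by (auto simp: powr_minus_divide powr_half_sqrt power_divide simp flip: powr_add)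
    moreover have "2 * sqrt q / sqrt 2 = k"
    proof -
      have "2 * sqrt q / sqrt 2 = (2 / sqrt 2) * sqrt q" by simp
      then show ?thesis by (simp only: k_def real_sqrt_mult real_div_sqrt)
    qed
    moreover have "(sqrt q)\<^sup>2 = q" "(sqrt 2)\<^sup>2 = (2::real)"
      using \<open>q > 0\<close> by auto
    moreover have "(P \<epsilon> x)\<^sup>2 = of_real ((sqrt q)\<^sup>2 * (x powr (1/2))\<^sup>2)
       + of_real (\<epsilon> * (2 * sqrt q / sqrt 2) * ((x powr (1/2)) * (x powr (- 1/2)))) * z
       + z\<^sup>2 * of_real (\<epsilon>\<^sup>2 * (x powr (- 1/2))\<^sup>2 / (sqrt 2)\<^sup>2)"
    proof -
      have "(of_real (A * a) + of_real \<epsilon> * z * of_real (b / B))\<^sup>2 = of_real (A\<^sup>2 * a\<^sup>2)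
        + of_real (\<epsilon> * (2 * A / B) * (a * b)) * z + z\<^sup>2 * of_real (\<epsilon>\<^sup>2 * b\<^sup>2 / B\<^sup>2)" for A B a b :: real
        by (simp add: power2_eq_square algebra_simps)
      then show ?thesis unfolding P_def .
    qed
    ultimately show ?thesis using that by simp
  qed
  have P_der: "(P \<epsilon> has_vector_derivative of_real (sqrt q / 2 * x powr (- 1/2)) - of_real \<epsilon> * z * of_real (x powr (- 3/2) / (2 * sqrt 2))) (at x)"
    if "x > 0" for x \<epsilon>
  proof -
    have 1: "((\<lambda>x. sqrt q * x powr (1/2)) has_real_derivative sqrt q / 2 * x powr (- 1/2)) (at x)"
      using that by (auto intro!: derivative_eq_intros)
    have 2: "((\<lambda>x. (?y x)) has_real_derivative - (x powr (- 3/2) / (2 * sqrt 2))) (at x)"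
      using that by (auto intro!: derivative_eq_intros) (simp add: field_simps)
    have "(P \<epsilon> has_vector_derivative of_real (sqrt q / 2 * x powr (- 1/2)) + of_real \<epsilon> * z * of_real (- (x powr (- 3/2) / (2 * sqrt 2)))) (at x)"
      unfolding P_def
      by (intro has_vector_derivative_add has_vector_derivative_mult_right has_vector_derivative_of_real)
         (use 1 2 in \<open>auto simp: has_real_derivative_iff_has_vector_derivative\<close>)
    then show ?thesis by simp
  qed
  have \<Theta>_der: "(\<Theta> has_vector_derivative g x) (at x)" if "x > 0" for x
  proof -
    have E: "((\<lambda>x. E (P \<epsilon> x)) has_vector_derivative
        (of_real (sqrt q / 2 * x powr (- 1/2)) - of_real \<epsilon> * z * of_real (x powr (- 3/2) / (2 * sqrt 2))) * exp (- (P \<epsilon> x)\<^sup>2)) (at x)" for \<epsilon>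
      using field_vector_diff_chain_at[OF P_der[OF that] der] by (simp add: o_def)
    have "g x = (of_real (sqrt q / 2 * x powr (- 1/2)) - of_real (-1) * z * of_real (x powr (- 3/2) / (2 * sqrt 2))) * exp (- (P (-1) x)\<^sup>2)
       + exp (2 * (of_real k * z)) * ((of_real (sqrt q / 2 * x powr (- 1/2)) - of_real 1 * z * of_real (x powr (- 3/2) / (2 * sqrt 2))) * exp (- (P 1 x)\<^sup>2))"
    proof -
      define W where "W = exp (of_real k * z) * exp (- of_real (q * x)) * exp (- z\<^sup>2 / of_real (2 * x))"
      have 1: "exp (- (P (-1) x)\<^sup>2) = W"
        using that by (simp add: P_sq W_def mult_exp_exp algebra_simps)
      have 2: "exp (2 * (of_real k * z)) * (c * exp (- (P 1 x)\<^sup>2)) = c * W" for c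
        using that by (simp add: P_sq W_def mult_exp_exp algebra_simps)
      have "g x = of_real (sqrt q) * of_real (x powr (- 1/2)) * W"
        by (simp add: g_def f_def W_def flip: exp_of_real)
      also have "\<dots> = (of_real (sqrt q / 2 * x powr (- 1/2)) - of_real (-1) * z * of_real (x powr (- 3/2) / (2 * sqrt 2))) * W
        + (of_real (sqrt q / 2 * x powr (- 1/2)) - of_real 1 * z * of_real (x powr (- 3/2) / (2 * sqrt 2))) * W"
        unfolding distrib_right[symmetric] by simp
      finally show ?thesis unfolding 1 2 .
    qed
    then show ?thesis
      unfolding \<Theta>_def by (simp only:) (intro has_vector_derivative_add has_vector_derivative_mult_right E)
  qed
  have P_Complex: "P \<epsilon> x = Complex (sqrt q * x powr (1/2) + \<epsilon> * Re z * (?y x)) (\<epsilon> * Im z * (?y x))" for \<epsilon> x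
    by (simp add: P_def complex_eq_iff)
  have top: "(\<Theta> \<longlongrightarrow> of_real (sqrt pi / 2) + exp (2 * (of_real k * z)) * of_real (sqrt pi / 2)) at_top"
  proof -
    have "((\<lambda>x. E (P \<epsilon> x)) \<longlongrightarrow> of_real (sqrt pi / 2)) at_top" for \<epsilon>
      unfolding P_Complex
    proof (rule lim[where c = "1/2"])
      have "sqrt q > 0" using \<open>q > 0\<close> by simp
      then show "filterlim (\<lambda>x. sqrt q * x powr (1/2) + \<epsilon> * Re z * (?y x)) at_top at_top"
        by real_asymp
      have "filterlim (\<lambda>x. (1/2) * (sqrt q * x powr (1/2) + \<epsilon> * Re z * (?y x)) - \<bar>\<epsilon> * Im z\<bar> * (?y x)) at_top at_top"
        using \<open>sqrt q > 0\<close> by real_asymp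
      then have "\<forall>\<^sub>F x in at_top. 0 \<le> (1/2) * (sqrt q * x powr (1/2) + \<epsilon> * Re z * (?y x)) - \<bar>\<epsilon> * Im z\<bar> * (?y x)"
        unfolding filterlim_at_top by (rule spec)
      then show "\<forall>\<^sub>F x in at_top. \<bar>\<epsilon> * Im z * (?y x)\<bar> \<le> 1/2 * (sqrt q * x powr (1/2) + \<epsilon> * Re z * (?y x))"
        by eventually_elim (simp add: abs_mult)
    qed auto
    then show ?thesis unfolding \<Theta>_def by (intro tendsto_intros)
  qed
  have bot: "(\<Theta> \<longlongrightarrow> - of_real (sqrt pi / 2) + exp (2 * (of_real k * z)) * of_real (sqrt pi / 2)) (at_right 0)"
  proof -
    define c where "c = (1 + \<bar>Im z\<bar> / Re z) / 2"
    have c: "c < 1" "\<bar>Im z\<bar> < c * Re z" "c > 0"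
      using z \<open>Re z > 0\<close> by (auto simp: c_def field_simps intro: add_pos_nonneg)
    have small: "\<forall>\<^sub>F x in at_right 0. \<bar>Im z\<bar> * (?y x) \<le> c * (Re z * (?y x) + \<epsilon> * (sqrt q * x powr (1/2)))"
       if "\<epsilon> = -1 \<or> \<epsilon> = 1" for \<epsilon>
    proof -
      define x0 where "x0 = (c * Re z - \<bar>Im z\<bar>) / (sqrt 2 * sqrt q)"
      have "x0 > 0" using c \<open>q > 0\<close> by (simp add: x0_def)
      then have "\<forall>\<^sub>F x in at_right 0. x \<in> {0<..<x0}"
        by (rule eventually_at_right_real)
      then show ?thesis
      proof eventually_elim
        case (elim x)
        then have "sqrt 2 * (sqrt q * x) \<le> c * Re z - \<bar>Im z\<bar>"
          using \<open>q > 0\<close> by (simp add: x0_def field_simps)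
        moreover have "c * (sqrt q * x) \<le> 1 * (sqrt q * x)"
          using c elim \<open>q > 0\<close> by (intro mult_right_mono) auto
        then have "sqrt 2 * (c * (sqrt q * x)) \<le> sqrt 2 * (sqrt q * x)" by simp
        ultimately have "sqrt 2 * (c * (sqrt q * x)) \<le> c * Re z - \<bar>Im z\<bar>" by linarith
        moreover have "- (sqrt 2 * (c * (sqrt q * x))) \<le> c * \<epsilon> * (sqrt 2 * (sqrt q * x))"
          using that c elim \<open>q > 0\<close> by auto
        ultimately have "\<bar>Im z\<bar> \<le> c * Re z + c * \<epsilon> * (sqrt 2 * (sqrt q * x))"
          by linarith
        then have "\<bar>Im z\<bar> * (?y x) \<le> (c * Re z + c * \<epsilon> * (sqrt 2 * (sqrt q * x))) * (?y x)"
          by (intro mult_right_mono) auto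
        also have "x * x powr (- 1/2) = x powr (1/2)"
          using elim powr_add[of x 1 "- 1/2"] by simp
        then have "(c * Re z + c * \<epsilon> * (sqrt 2 * (sqrt q * x))) * (?y x) = c * (Re z * (?y x) + \<epsilon> * (sqrt q * x powr (1/2)))"
          by (simp add: field_simps)
        finally show ?case .
      qed
    qed
    have "((\<lambda>x. E (P 1 x)) \<longlongrightarrow> of_real (sqrt pi / 2)) (at_right 0)"
      unfolding P_Complex
    proof (rule lim[OF _ c(1)])
      have "sqrt q > 0" using \<open>q > 0\<close> by simp
      then show "filterlim (\<lambda>x. sqrt q * x powr (1/2) + 1 * Re z * (?y x)) at_top (at_right 0)"
        using \<open>Re z > 0\<close> by real_asymp
      show "\<forall>\<^sub>F x in at_right 0. \<bar>1 * Im z * (?y x)\<bar> \<le> c * (sqrt q * x powr (1/2) + 1 * Re z * (?y x))"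
        using small[of 1] by (simp add: abs_mult add.commute)
    qed
    moreover have "((\<lambda>x. - E (- P (-1) x)) \<longlongrightarrow> - of_real (sqrt pi / 2)) (at_right 0)"
    proof (rule tendsto_minus)
      have *: "- P (-1) x = Complex (Re z * (?y x) - sqrt q * x powr (1/2)) (Im z * (?y x))" for x
        by (simp add: P_Complex complex_eq_iff)
      show "((\<lambda>x. E (- P (-1) x)) \<longlongrightarrow> of_real (sqrt pi / 2)) (at_right 0)"
        unfolding *
      proof (rule lim[OF _ c(1)])
        have "sqrt q > 0" using \<open>q > 0\<close> by simp
        then show "filterlim (\<lambda>x. Re z * (?y x) - sqrt q * x powr (1/2)) at_top (at_right 0)"
          using \<open>Re z > 0\<close> by real_asymp
        show "\<forall>\<^sub>F x in at_right 0. \<bar>Im z * (?y x)\<bar> \<le> c * (Re z * (?y x) - sqrt q * x powr (1/2))"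
          using small[of "-1"] by (simp add: abs_mult)
      qed
    qed
    then have "((\<lambda>x. E (P (-1) x)) \<longlongrightarrow> - of_real (sqrt pi / 2)) (at_right 0)"
      by (simp add: odd)
    ultimately show ?thesis unfolding \<Theta>_def by (intro tendsto_intros)
  qed
  have "(LBINT x=ereal 0..\<infinity>. g x) = of_real (sqrt pi / 2) + exp (2 * (of_real k * z)) * of_real (sqrt pi / 2)
     - (- of_real (sqrt pi / 2) + exp (2 * (of_real k * z)) * of_real (sqrt pi / 2))"
  proof (rule interval_integral_FTC_integrable[where F = \<Theta>])
    show "(\<Theta> has_vector_derivative g x) (at x)" if "ereal 0 < ereal x" for x
      using that \<Theta>_der by simp
    show "isCont g x" if "ereal 0 < ereal x" for x
      using that unfolding g_def f_def by (auto intro!: continuous_intros)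
    show "set_integrable lborel (einterval (ereal 0) \<infinity>) g"
      using f_int unfolding g_def einterval_eq_Icc by (auto simp: einterval_def greaterThan_def intro!: set_integrable_mult_right)
    show "((\<Theta> \<circ> real_of_ereal) \<longlongrightarrow> of_real (sqrt pi / 2) + exp (2 * (of_real k * z)) * of_real (sqrt pi / 2)) (at_left \<infinity>)"
      using top by (simp add: ereal_tendsto_simps1)
    show "((\<Theta> \<circ> real_of_ereal) \<longlongrightarrow> - of_real (sqrt pi / 2) + exp (2 * (of_real k * z)) * of_real (sqrt pi / 2)) (at_right (ereal 0))"
      using bot by (simp add: ereal_tendsto_simps1)
  qed auto
  then have "of_real (sqrt q) * exp (of_real k * z) * (CLINT x:{0<..}|lborel. f x) = of_real (sqrt pi)"
    unfolding g_def interval_integral_to_infinity_eq by simp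
  then have "(CLINT x:{0<..}|lborel. f x) = of_real (sqrt pi / sqrt q) * exp (- (of_real k * z))"
    using \<open>q > 0\<close> by (simp add: exp_minus field_simps)
  then show ?thesis
    unfolding f_def k_def by (simp add: real_sqrt_divide)
qed

section \<open>Injectivity of the Laplace transform\<close>

text \<open>
If \<open>D\<close> is positive at \<open>x0\<close>, then by right-continuity it is positive on an interval \<open>(x0, b)\<close>. A bump
over that interval, as a function of \<open>u = e\<^bsup>-x\<^esup> \<in> [0,1]\<close>, is a uniform limit of polynomials in \<open>u\<close>, and the
hypothesis says that \<open>e\<^bsup>-x\<^esup> D(x)\<close> is orthogonal to all of these.
\<close>
lemma laplace_zero_imp_nonpos:
  fixes D :: "real \<Rightarrow> real"
  assumes int: "set_integrable lborel {0<..} (\<lambda>x. exp (- x) * D x)"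
    and zero: "\<And>k::nat. (LINT x:{0<..}|lborel. exp (- (real (Suc k) * x)) * D x) = 0"
    and x0: "x0 > 0" "continuous (at_right x0) D"
  shows "D x0 \<le> 0"
proof (rule ccontr)
  assume "\<not> D x0 \<le> 0"
  then have "D x0 > 0" by simp
  then have "\<forall>\<^sub>F x in at_right x0. D x > 0"
    using x0(2) by (intro order_tendstoD) (simp add: continuous_within)
  then obtain b where b: "b > x0" "\<And>x. x0 < x \<Longrightarrow> x < b \<Longrightarrow> D x > 0"
    by (auto simp: eventually_at_right_field)
  define \<phi> where "\<phi> = (\<lambda>u. max 0 ((u - exp (- b)) * (exp (- x0) - u)))"
  define h where "h = (\<lambda>x. indicator {0<..} x *\<^sub>R (exp (- x) * D x))"
  have h: "integrable lborel h"
    using int by (simp add: h_def set_integrable_def)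
  then have h_abs: "integrable lborel (\<lambda>x. \<bar>h x\<bar>)" by simp
  have [measurable]: "h \<in> borel_measurable borel"
    using borel_measurable_integrable[OF h] by simp
  have \<phi>_cont: "continuous_on {0..1} \<phi>"
    unfolding \<phi>_def by (intro continuous_intros)
  have [measurable]: "\<phi> \<in> borel_measurable borel"
    unfolding \<phi>_def by measurable
  have \<phi>_bound: "\<bar>\<phi> (exp (- x))\<bar> \<le> 1" if "x > 0" for x
  proof -
    have "\<bar>(exp (- x) - exp (- b)) * (exp (- x0) - exp (- x))\<bar> \<le> 1 * 1"
    proof -
      have "\<bar>exp (- s) - exp (- t)\<bar> \<le> 1" if "s > 0" "t > 0" for s t :: real
        using that exp_gt_zero[of "- s"] exp_gt_zero[of "- t"] exp_le_one_iff[of "- s"] exp_le_one_iff[of "- t"]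
        by linarith
      then show ?thesis
        unfolding abs_mult using that x0 b by (intro mult_mono) auto
    qed
    then show ?thesis unfolding \<phi>_def by auto
  qed
  have h\<phi>: "integrable lborel (\<lambda>x. h x * \<phi> (exp (- x)))"
  proof (rule Bochner_Integration.integrable_bound[OF h_abs])
    show "AE x in lborel. norm (h x * \<phi> (exp (- x))) \<le> norm \<bar>h x\<bar>"
      using \<phi>_bound by (auto simp: h_def abs_mult indicator_def intro!: mult_left_le AE_I2)
  qed measurable
  have moment: "integrable lborel (\<lambda>x. h x * exp (- x) ^ k) \<and> (LINT x|lborel. h x * exp (- x) ^ k) = 0" for k
  proof
    show "integrable lborel (\<lambda>x. h x * exp (- x) ^ k)"
    proof (rule Bochner_Integration.integrable_bound[OF h_abs])
      show "AE x in lborel. norm (h x * exp (- x) ^ k) \<le> norm \<bar>h x\<bar>"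
        by (auto simp: h_def abs_mult indicator_def intro!: mult_left_le AE_I2 power_le_one)
    qed measurable
    have "h x * exp (- x) ^ k = indicator {0<..} x *\<^sub>R (exp (- (real (Suc k) * x)) * D x)" for x
    proof -
      have "exp (- x) * exp (- x) ^ k = exp (- x + real k * - x)"
        by (simp only: exp_of_nat_mult exp_add)
      also have "- x + real k * - x = - (real (Suc k) * x)"
        by (simp add: algebra_simps)
      finally show ?thesis by (simp add: h_def mult_ac)
    qed
    then show "(LINT x|lborel. h x * exp (- x) ^ k) = 0"
      using zero[of k] by (simp add: set_lebesgue_integral_def)
  qed
  have small: "\<bar>LINT x|lborel. h x * \<phi> (exp (- x))\<bar> \<le> e * (LINT x|lborel. \<bar>h x\<bar>)" if "e > 0" for e
  proof -
    obtain p where p: "real_polynomial_function p" "\<And>u. u \<in> {0..1} \<Longrightarrow> \<bar>\<phi> u - p u\<bar> < e"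
      using Stone_Weierstrass_real_polynomial_function[OF compact_Icc \<phi>_cont \<open>e > 0\<close>] by blast
    then obtain c N where pc: "p = (\<lambda>u. \<Sum>i\<le>N. c i * u ^ i)"
      using real_polynomial_function_iff_sum by blast
    have hp_eq: "h x * p (exp (- x)) = (\<Sum>i\<le>N. c i * (h x * exp (- x) ^ i))" for x
      by (simp add: pc sum_distrib_left mult_ac)
    have hp: "integrable lborel (\<lambda>x. h x * p (exp (- x)))"
      unfolding hp_eq using moment by (intro Bochner_Integration.integrable_sum integrable_mult_right) auto
    have "(LINT x|lborel. h x * p (exp (- x))) = 0"
      unfolding hp_eq using moment by (subst Bochner_Integration.integral_sum) auto
    then have "(LINT x|lborel. h x * \<phi> (exp (- x))) = (LINT x|lborel. h x * \<phi> (exp (- x)) - h x * p (exp (- x)))"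
      using h\<phi> hp by (simp add: Bochner_Integration.integral_diff)
    also have "norm \<dots> \<le> (LINT x|lborel. norm (h x * \<phi> (exp (- x)) - h x * p (exp (- x))))"
      by (rule integral_norm_bound)
    also have "\<dots> \<le> (LINT x|lborel. e * \<bar>h x\<bar>)"
    proof (rule integral_mono)
      fix x
      show "norm (h x * \<phi> (exp (- x)) - h x * p (exp (- x))) \<le> e * \<bar>h x\<bar>"
      proof (cases "x > 0")
        case True
        then have "\<bar>\<phi> (exp (- x)) - p (exp (- x))\<bar> \<le> e"
          using p(2)[of "exp (- x)"] by auto
        then have "\<bar>h x\<bar> * \<bar>\<phi> (exp (- x)) - p (exp (- x))\<bar> \<le> \<bar>h x\<bar> * e"
          by (intro mult_left_mono) auto
        then show ?thesis by (simp add: abs_mult[symmetric] right_diff_distrib mult.commute)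
      qed (simp add: h_def)
    qed (use h_abs hp h\<phi> in auto)
    finally show ?thesis by simp
  qed
  have "(LINT x|lborel. h x * \<phi> (exp (- x))) = 0"
  proof (rule ccontr)
    define I where "I = \<bar>LINT x|lborel. h x * \<phi> (exp (- x))\<bar>"
    define H where "H = (LINT x|lborel. \<bar>h x\<bar>)"
    assume "(LINT x|lborel. h x * \<phi> (exp (- x))) \<noteq> 0"
    then have "I > 0" by (simp add: I_def)
    have "H \<ge> 0" by (simp add: H_def)
    have "I \<le> I / (2 * (H + 1)) * H"
      using small[of "I / (2 * (H + 1))"] \<open>I > 0\<close> \<open>H \<ge> 0\<close> by (simp add: I_def[symmetric] H_def[symmetric])
    also have "\<dots> = I * (H / (2 * (H + 1)))" by simp
    also have "\<dots> \<le> I * (1/2)"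
      using \<open>I > 0\<close> \<open>H \<ge> 0\<close> by (intro mult_left_mono) (auto simp: field_simps)
    finally show False using \<open>I > 0\<close> by simp
  qed
  moreover have "h x * \<phi> (exp (- x)) \<ge> 0" for x
  proof (cases "x0 < x \<and> x < b")
    case True
    then show ?thesis using x0 b by (auto simp: h_def \<phi>_def less_imp_le)
  next
    case False
    then have "(exp (- x) - exp (- b)) * (exp (- x0) - exp (- x)) \<le> 0"
      using b by (auto simp: mult_le_0_iff)
    then show ?thesis by (simp add: \<phi>_def)
  qed
  ultimately have "AE x in lborel. h x * \<phi> (exp (- x)) = 0"
    using integral_nonneg_eq_0_iff_AE[OF h\<phi>] by auto
  moreover have "h x * \<phi> (exp (- x)) > 0" if "x \<in> {x0<..<b}" for x
    using that x0 b by (auto simp: h_def \<phi>_def less_max_iff_disj)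
  ultimately have "AE x in lborel. x \<notin> {x0<..<b}"
    by (elim eventually_mono) (metis less_irrefl)
  then have "emeasure lborel {x0<..<b} = 0"
    by (subst (asm) AE_iff_measurable[where N="{x0<..<b}"]) auto
  then show False using b by simp
qed

lemma laplace_injective:
  fixes D :: "real \<Rightarrow> real"
  assumes int: "set_integrable lborel {0<..} (\<lambda>x. exp (- x) * D x)"
    and zero: "\<And>k::nat. (LINT x:{0<..}|lborel. exp (- (real (Suc k) * x)) * D x) = 0"
    and x0: "x0 > 0" "continuous (at_right x0) D"
  shows "D x0 = 0"
proof (rule antisym)
  show "D x0 \<le> 0" by (rule laplace_zero_imp_nonpos[OF assms])
  have "- D x0 \<le> 0"
  proof (rule laplace_zero_imp_nonpos[where D = "\<lambda>x. - D x"])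
    show "set_integrable lborel {0<..} (\<lambda>x. exp (- x) * - D x)"
      using int by (simp add: set_integrable_def)
    show "(LINT x:{0<..}|lborel. exp (- (real (Suc k) * x)) * - D x) = 0" for k
      using zero[of k] by (simp add: set_lebesgue_integral_def)
  qed (use x0 in \<open>auto intro: continuous_minus\<close>)
  then show "0 \<le> D x0" by simp
qed

section \<open>Fourier inversion\<close>

text \<open>
Most interchanges of integrals below rest on a majorant of product form.
\<close>
lemma (in pair_sigma_finite) integrable_pair_bound:
  fixes h :: "'a \<times> 'b \<Rightarrow> 'c::{banach, second_countable_topology}" and f :: "'a \<Rightarrow> real" and g :: "'b \<Rightarrow> real"
  assumes "h \<in> borel_measurable (M1 \<Otimes>\<^sub>M M2)" and f: "integrable M1 f" and g: "integrable M2 g"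
    and le: "AE x in M1. AE y in M2. norm (h (x, y)) \<le> f x * g y"
  shows "integrable (M1 \<Otimes>\<^sub>M M2) h"
proof (rule Fubini_integrable)
  note [measurable] = assms(1) borel_measurable_integrable[OF f] borel_measurable_integrable[OF g]
  have sec: "AE x in M1. integrable M2 (\<lambda>y. h (x, y)) \<and> (LINT y|M2. norm (h (x, y))) \<le> f x * (LINT y|M2. g y)"
    using le AE_space
  proof eventually_elim
    case (elim x)
    have i: "integrable M2 (\<lambda>y. f x * g y)" using g by simp
    have "integrable M2 (\<lambda>y. h (x, y))"
      using elim by (intro Bochner_Integration.integrable_bound[OF i]) auto
    moreover have "(LINT y|M2. norm (h (x, y))) \<le> (LINT y|M2. f x * g y)"
      using elim calculation g by (intro integral_mono_AE) auto
    ultimately show ?case by simp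
  qed
  then show "AE x in M1. integrable M2 (\<lambda>y. h (x, y))" by (auto elim: eventually_mono)
  have i: "integrable M1 (\<lambda>x. f x * (LINT y|M2. g y))" using f by simp
  show "integrable M1 (\<lambda>x. LINT y|M2. norm (h (x, y)))"
  proof (rule Bochner_Integration.integrable_bound[OF i])
    show "AE x in M1. norm (LINT y|M2. norm (h (x, y))) \<le> norm (f x * (LINT y|M2. g y))"
      using sec
    proof eventually_elim
      case (elim x)
      have "0 \<le> (LINT y|M2. norm (h (x, y)))" by simp
      with elim show ?case by (simp only: real_norm_def) linarith
    qed
  qed measurable
qed fact

lemma gauss_fourier:
  fixes d m :: real
  assumes "m > 0"
  shows "(CLINT y|lborel. of_real (exp (- (y / m)\<^sup>2 / 2)) * iexp (d * y)) = of_real (m * sqrt (2 * pi) * exp (- (m * d)\<^sup>2 / 2))"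
proof -
  have "of_real (exp (- (m * d)\<^sup>2 / 2)) = (CLINT x|std_normal_distribution. iexp (m * d * x))"
    using fun_cong[OF char_std_normal_distribution, of "m * d"] by (simp add: char_def)
  also have "\<dots> = (CLINT x|lborel. std_normal_density x *\<^sub>R iexp (m * d * x))"
    by (rule integral_density) auto
  also have "\<dots> = (CLINT x|lborel. of_real (1 / sqrt (2 * pi)) * (of_real (exp (- x\<^sup>2 / 2)) * iexp (d * (m * x))))"
    by (simp add: std_normal_density_def scaleR_conv_of_real mult_ac)
  also have "\<dots> = of_real (1 / sqrt (2 * pi)) * (CLINT x|lborel. of_real (exp (- x\<^sup>2 / 2)) * iexp (d * (m * x)))"
    by (rule integral_mult_right_zero)
  finally have *: "(CLINT x|lborel. of_real (exp (- x\<^sup>2 / 2)) * iexp (d * (m * x))) = of_real (sqrt (2 * pi) * exp (- (m * d)\<^sup>2 / 2))"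
    by (simp add: field_simps)
  have "(CLINT y|lborel. of_real (exp (- (y / m)\<^sup>2 / 2)) * iexp (d * y))
      = m *\<^sub>R (CLINT x|lborel. of_real (exp (- ((0 + m * x) / m)\<^sup>2 / 2)) * iexp (d * (0 + m * x)))"
    using assms by (subst lborel_integral_real_affine[where c = m and t = 0]) auto
  also have "\<dots> = m *\<^sub>R (CLINT x|lborel. of_real (exp (- x\<^sup>2 / 2)) * iexp (d * (m * x)))"
    using assms by simp
  finally show ?thesis unfolding * by (simp add: scaleR_conv_of_real)
qed

text \<open>
A Gaussian factor of width \<open>m\<close> makes the double integral absolutely convergent; interchanging the
integrals replaces it by a Gaussian average of \<open>\<rho>\<close> around \<open>k\<close> with width \<open>1/m\<close>, and \<open>m\<close> tends to infinity.
\<close>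
lemma fourier_inversion:
  fixes \<rho> :: "real \<Rightarrow> real" and k :: real
  assumes \<rho>: "integrable lborel \<rho>" and bound: "\<And>r. \<bar>\<rho> r\<bar> \<le> B" and cont: "isCont \<rho> k"
    and hat: "integrable lborel (\<lambda>y. CLINT r|lborel. of_real (\<rho> r) * iexp (- (y * r)))"
  shows "(CLINT y|lborel. (CLINT r|lborel. of_real (\<rho> r) * iexp (- (y * r))) * iexp (k * y)) = of_real (2 * pi * \<rho> k)"
proof -
  define F where "F = (\<lambda>y. CLINT r|lborel. of_real (\<rho> r) * iexp (- (y * r)))"
  note [measurable] = borel_measurable_integrable[OF \<rho>]
  have [measurable]: "F \<in> borel_measurable borel" using borel_measurable_integrable[OF hat] by (simp add: F_def)
  have gauss_int: "integrable lborel (\<lambda>y. exp (- (y / m)\<^sup>2 / 2))" if "m > 0" for m :: real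
  proof -
    have "integrable lborel (\<lambda>y. sqrt (2 * pi * m\<^sup>2) * normal_density 0 m y)"
      using that by (intro integrable_mult_right integrable_normal_density)
    then show ?thesis using that by (simp add: normal_density_def power_divide mult.commute)
  qed
  define J where "J = (\<lambda>i::nat. CLINT y|lborel. F y * iexp (k * y) * of_real (exp (- (y / real (Suc i))\<^sup>2 / 2)))"
  have J: "J i = of_real (sqrt (2 * pi)) * (CLINT u|lborel. of_real (\<rho> (k + u / real (Suc i)) * exp (- u\<^sup>2 / 2)))" for i
  proof -
    define m where "m = real (Suc i)"
    have "m > 0" by (simp add: m_def)
    define h where "h = (\<lambda>y r. of_real (\<rho> r) * iexp (- (y * r)) * iexp (k * y) * of_real (exp (- (y / m)\<^sup>2 / 2)))"
    have "integrable (lborel \<Otimes>\<^sub>M lborel) (\<lambda>(y, r). h y r)"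
    proof (rule lborel_pair.integrable_pair_bound[OF _ gauss_int[OF \<open>m > 0\<close>] integrable_abs[OF \<rho>]])
      show "AE y in lborel. AE r in lborel. norm (case (y, r) of (y, r) \<Rightarrow> h y r) \<le> exp (- (y / m)\<^sup>2 / 2) * \<bar>\<rho> r\<bar>"
        by (auto simp: h_def norm_mult)
      show "(\<lambda>(y, r). h y r) \<in> borel_measurable (lborel \<Otimes>\<^sub>M lborel)"
        unfolding h_def by measurable
    qed
    then have "(CLINT r|lborel. CLINT y|lborel. h y r) = (CLINT y|lborel. CLINT r|lborel. h y r)"
      by (rule lborel_pair.Fubini_integral)
    also have "\<dots> = J i"
    proof -
      have "(CLINT r|lborel. h y r) = F y * iexp (k * y) * of_real (exp (- (y / m)\<^sup>2 / 2))" for y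
        unfolding h_def F_def by (simp only: integral_mult_left_zero)
      then show ?thesis by (simp add: J_def m_def)
    qed
    finally have "J i = (CLINT r|lborel. CLINT y|lborel. h y r)" by simp
    also have "\<dots> = (CLINT r|lborel. of_real (\<rho> r * (m * sqrt (2 * pi) * exp (- (m * (k - r))\<^sup>2 / 2))))"
    proof (rule Bochner_Integration.integral_cong)
      fix r
      have "(CLINT y|lborel. h y r) = (CLINT y|lborel. of_real (\<rho> r) * (of_real (exp (- (y / m)\<^sup>2 / 2)) * iexp ((k - r) * y)))"
        unfolding h_def by (intro Bochner_Integration.integral_cong) (auto simp: mult_ac mult_exp_exp algebra_simps)
      also have "\<dots> = of_real (\<rho> r) * (CLINT y|lborel. of_real (exp (- (y / m)\<^sup>2 / 2)) * iexp ((k - r) * y))"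
        by (rule integral_mult_right_zero)
      finally show "(CLINT y|lborel. h y r) = of_real (\<rho> r * (m * sqrt (2 * pi) * exp (- (m * (k - r))\<^sup>2 / 2)))"
        unfolding gauss_fourier[OF \<open>m > 0\<close>] by simp
    qed simp
    also have "\<dots> = (1 / m) *\<^sub>R (CLINT u|lborel. of_real (\<rho> (k + 1 / m * u) * (m * sqrt (2 * pi) * exp (- (m * (k - (k + 1 / m * u)))\<^sup>2 / 2))))"
      using \<open>m > 0\<close> by (subst lborel_integral_real_affine[where c = "1 / m" and t = k]) auto
    also have "\<dots> = (1 / m) *\<^sub>R (CLINT u|lborel. of_real (m * sqrt (2 * pi)) * of_real (\<rho> (k + u / m) * exp (- u\<^sup>2 / 2)))"
      using \<open>m > 0\<close> by (simp add: right_diff_distrib mult_ac)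
    also have "\<dots> = of_real (sqrt (2 * pi)) * (CLINT u|lborel. of_real (\<rho> (k + u / m) * exp (- u\<^sup>2 / 2)))"
      using \<open>m > 0\<close> by (subst integral_mult_right_zero) (simp add: scaleR_conv_of_real)
    finally show ?thesis by (simp add: m_def)
  qed
  have "J \<longlonglongrightarrow> (CLINT y|lborel. F y * iexp (k * y))"
    unfolding J_def
  proof (rule integral_dominated_convergence[where w = "\<lambda>y. norm (F y)"])
    show "integrable lborel (\<lambda>y. norm (F y))" using hat by (simp add: F_def)
    show "AE y in lborel. (\<lambda>i. F y * iexp (k * y) * of_real (exp (- (y / real (Suc i))\<^sup>2 / 2))) \<longlonglongrightarrow> F y * iexp (k * y)"
    proof (rule AE_I2)
      fix y
      have "(\<lambda>i. y / real (Suc i)) \<longlonglongrightarrow> 0" by real_asymp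
      then have "(\<lambda>i. F y * iexp (k * y) * of_real (exp (- (y / real (Suc i))\<^sup>2 / 2))) \<longlonglongrightarrow> F y * iexp (k * y) * of_real (exp (- 0\<^sup>2 / 2))"
        by (intro tendsto_intros) auto
      then show "(\<lambda>i. F y * iexp (k * y) * of_real (exp (- (y / real (Suc i))\<^sup>2 / 2))) \<longlonglongrightarrow> F y * iexp (k * y)" by simp
    qed
  qed (auto simp: norm_mult mult_left_le)
  moreover have "J \<longlonglongrightarrow> of_real (sqrt (2 * pi)) * (CLINT u|lborel. of_real (\<rho> k * exp (- u\<^sup>2 / 2)))"
    unfolding J
  proof (intro tendsto_mult tendsto_const integral_dominated_convergence[where w = "\<lambda>u. B * exp (- (u / 1)\<^sup>2 / 2)"])
    show "integrable lborel (\<lambda>u. B * exp (- (u / 1)\<^sup>2 / 2))"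
      using gauss_int[of 1] by simp
    show "AE u in lborel. (\<lambda>i. of_real (\<rho> (k + u / real (Suc i)) * exp (- u\<^sup>2 / 2)) :: complex) \<longlonglongrightarrow> of_real (\<rho> k * exp (- u\<^sup>2 / 2))"
    proof (rule AE_I2)
      fix u
      have "(\<lambda>i. k + u / real (Suc i)) \<longlonglongrightarrow> k" by real_asymp
      then have "(\<lambda>i. \<rho> (k + u / real (Suc i))) \<longlonglongrightarrow> \<rho> k"
        using cont by (rule isCont_tendsto_compose[rotated])
      then show "(\<lambda>i. of_real (\<rho> (k + u / real (Suc i)) * exp (- u\<^sup>2 / 2)) :: complex) \<longlonglongrightarrow> of_real (\<rho> k * exp (- u\<^sup>2 / 2))"
        by (intro tendsto_intros) 
    qed
    show "AE u in lborel. norm (of_real (\<rho> (k + u / real (Suc i)) * exp (- u\<^sup>2 / 2)) :: complex) \<le> B * exp (- (u / 1)\<^sup>2 / 2)" for i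
      using bound by (auto simp: norm_mult abs_mult intro!: AE_I2 mult_right_mono)
  qed measurable
  moreover have "(CLINT u|lborel. of_real (\<rho> k * exp (- u\<^sup>2 / 2))) = of_real (\<rho> k * sqrt (2 * pi))"
    using gauss_fourier[of 1 0] by simp
  ultimately have "(CLINT y|lborel. F y * iexp (k * y)) = of_real (sqrt (2 * pi)) * of_real (\<rho> k * sqrt (2 * pi))"
    using LIMSEQ_unique by metis
  then show ?thesis by (simp add: F_def flip: of_real_mult)
qed

section \<open>Polar decomposition of independent gamma variables\<close>

abbreviation gamma_law :: "real \<Rightarrow> real measure" where
  "gamma_law a \<equiv> density lborel (\<lambda>t. ennreal (gamma_density a t))"

lemma gamma_density_eq: "gamma_density a t = indicator {0<..} t * (t powr (a - 1) * exp (- t) / Gamma a)"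
  by (simp add: gamma_density_def indicator_def)

lemma gamma_density_measurable [measurable]: "gamma_density a \<in> borel_measurable borel"
  unfolding gamma_density_eq[abs_def] by measurable

lemma gamma_density_nonneg: "a > 0 \<Longrightarrow> 0 \<le> gamma_density a t"
  by (simp add: gamma_density_def less_imp_le[OF Gamma_real_pos])

lemma gamma_density_has_integral:
  assumes "a > 0"
  shows "integrable lborel (gamma_density a)" "(LINT t|lborel. gamma_density a t) = 1"
proof -
  have eq: "gamma_density a = (\<lambda>t. (indicator {0<..} t *\<^sub>R (t powr (a - 1) * exp (- t))) / Gamma a)"
    by (simp add: gamma_density_eq fun_eq_iff)
  have "integrable lborel (\<lambda>t. indicator {0<..} t *\<^sub>R (t powr (a - 1) * exp (- t)))"
    using set_integrable_Gamma[of a 1] assms by (simp add: set_integrable_def)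
  then show "integrable lborel (gamma_density a)" unfolding eq by (rule integrable_divide)
  show "(LINT t|lborel. gamma_density a t) = 1"
    using set_integral_Gamma_one[OF assms] Gamma_real_pos[OF assms]
    by (simp add: eq set_lebesgue_integral_def)
qed

lemma prob_space_gamma_law:
  assumes "a > 0"
  shows "prob_space (gamma_law a)"
proof
  have "(\<integral>\<^sup>+t. ennreal (gamma_density a t) \<partial>lborel) = ennreal (LINT t|lborel. gamma_density a t)"
    using gamma_density_nonneg[OF assms] gamma_density_has_integral[OF assms]
    by (intro nn_integral_eq_integral) auto
  then show "emeasure (gamma_law a) (space (gamma_law a)) = 1"
    using gamma_density_has_integral[OF assms] by (simp add: emeasure_density)
qed

text \<open>
Scaling a gamma variable by \<open>\<kappa>\<close> changes its law by the density \<open>\<kappa>\<^bsup>-a\<^esup> e\<^bsup>t - t/\<kappa>\<^esup>\<close>.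
\<close>
lemma gamma_law_scale:
  fixes a \<kappa> :: real
  assumes "a > 0" "\<kappa> > 0" and [measurable]: "f \<in> borel_measurable borel"
  shows "(\<integral>\<^sup>+t. f (\<kappa> * t) \<partial>gamma_law a) = (\<integral>\<^sup>+t. ennreal (\<kappa> powr (- a) * exp (t - t / \<kappa>)) * f t \<partial>gamma_law a)"
proof -
  let ?g = "\<lambda>t. ennreal (gamma_density a (0 + \<kappa> * t)) * (ennreal (\<kappa> powr (- a) * exp ((0 + \<kappa> * t) - (0 + \<kappa> * t) / \<kappa>)) * f (0 + \<kappa> * t))"
  have "(\<integral>\<^sup>+t. ennreal (\<kappa> powr (- a) * exp (t - t / \<kappa>)) * f t \<partial>gamma_law a)
      = (\<integral>\<^sup>+t. ennreal (gamma_density a t) * (ennreal (\<kappa> powr (- a) * exp (t - t / \<kappa>)) * f t) \<partial>lborel)"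
    by (rule nn_integral_density) auto
  also have "\<dots> = ennreal \<bar>\<kappa>\<bar> * (\<integral>\<^sup>+t. (?g t) \<partial>lborel)"
    using assms by (intro nn_integral_real_affine) auto
  also have "\<dots> = (\<integral>\<^sup>+t. ennreal \<bar>\<kappa>\<bar> * (?g t) \<partial>lborel)"
    by (rule nn_integral_cmult[symmetric]) auto
  also have "\<dots> = (\<integral>\<^sup>+t. ennreal (gamma_density a t) * f (\<kappa> * t) \<partial>lborel)"
  proof (rule nn_integral_cong)
    fix t
    have "\<bar>\<kappa>\<bar> * (gamma_density a (\<kappa> * t) * (\<kappa> powr (- a) * exp (\<kappa> * t - t))) = gamma_density a t"
    proof (cases "t > 0")
      case True
      have "\<kappa> * (\<kappa> powr (a - 1) * \<kappa> powr (- a)) = 1"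
        using assms by (simp add: powr_diff powr_minus field_simps)
      moreover have "exp (- (\<kappa> * t)) * exp (\<kappa> * t - t) = exp (- t)"
        by (simp add: mult_exp_exp)
      moreover have "\<bar>\<kappa>\<bar> * (gamma_density a (\<kappa> * t) * (\<kappa> powr (- a) * exp (\<kappa> * t - t)))
        = (\<kappa> * (\<kappa> powr (a - 1) * \<kappa> powr (- a))) * ((exp (- (\<kappa> * t)) * exp (\<kappa> * t - t)) * t powr (a - 1) / Gamma a)"
        using True assms by (simp add: gamma_density_def powr_mult)
      ultimately show ?thesis using True by (simp add: gamma_density_def)
    qed (use assms in \<open>simp add: gamma_density_def zero_less_mult_iff\<close>)
    then show "ennreal \<bar>\<kappa>\<bar> * (?g t)
        = ennreal (gamma_density a t) * f (\<kappa> * t)"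
      using assms gamma_density_nonneg[OF assms(1)]
      by (simp add: mult.assoc[symmetric] flip: ennreal_mult)
  qed
  also have "\<dots> = (\<integral>\<^sup>+t. f (\<kappa> * t) \<partial>gamma_law a)"
    by (rule nn_integral_density[symmetric]) auto
  finally show ?thesis by simp
qed

locale gamma_vector =
  fixes I :: "'i set" and \<alpha> :: "'i \<Rightarrow> real"
  assumes I: "finite I" "I \<noteq> {}" and \<alpha>_pos: "\<And>j. j \<in> I \<Longrightarrow> \<alpha> j > 0"
begin

definition N where "N = PiM I (\<lambda>j. gamma_law (\<alpha> j))"
definition A where "A = (\<Sum>j\<in>I. \<alpha> j)"
definition S where "S t = (\<Sum>j\<in>I. t j :: real)"
text \<open>
This is \<open>U\<^sub>n\<^sup>2\<close>; its invariance under positive scaling of the vector is what makes it independent of \<open>S\<close>.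
\<close>
definition V where "V t = S t powi (- 2) * (\<Sum>j\<in>I. (t j)\<^sup>2)"

lemma A_pos: "A > 0"
  unfolding A_def using I \<alpha>_pos by (intro sum_pos) auto

lemma sets_N [measurable_cong]: "sets N = sets (PiM I (\<lambda>_. borel))"
  unfolding N_def by (intro sets_PiM_cong) auto

lemma S_measurable [measurable]: "S \<in> borel_measurable N"
  unfolding S_def[abs_def] by measurable

lemma V_measurable [measurable]: "V \<in> borel_measurable N"
  unfolding V_def[abs_def] power_int_def by measurable

text \<open>
The product measure theory asks for a probability measure at every index, also outside \<open>I\<close>.
\<close>
definition P where "P j = (if j \<in> I then gamma_law (\<alpha> j) else gamma_law 1)"

lemma prob_space_P: "prob_space (P j)"
  unfolding P_def using \<alpha>_pos prob_space_gamma_law by auto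

lemma N_P: "N = PiM I P"
  unfolding N_def by (intro PiM_cong) (auto simp: P_def)

lemma sets_P [measurable_cong, simp]: "sets (P j) = sets borel"
  by (simp add: P_def)

sublocale N: product_prob_space P I
  using prob_space_P by (intro product_prob_spaceI)

sublocale N: prob_space N
  unfolding N_P by (rule N.P.prob_space_axioms)

text \<open>
The densities of the coordinates multiply to a function of \<open>S\<close> alone.
\<close>
lemma scale_law:
  assumes "\<kappa> > 0"
  shows "distr N (PiM I (\<lambda>_. borel)) (\<lambda>t. \<lambda>j\<in>I. \<kappa> * t j) = density N (\<lambda>t. ennreal (\<kappa> powr (- A) * exp (S t - S t / \<kappa>)))"
proof -
  let ?w = "\<lambda>t. ennreal (\<kappa> powr (- A) * exp (S t - S t / \<kappa>))"
  define w where "w j t = ennreal (\<kappa> powr (- \<alpha> j) * exp (t - t / \<kappa>))" for j and t :: real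
  have [measurable]: "w j \<in> borel_measurable borel" for j unfolding w_def by measurable
  define P' where "P' j = distr (P j) borel (\<lambda>t. \<kappa> * t)" for j
  have "prob_space (P' j)" for j
    unfolding P'_def using prob_space_P by (intro prob_space.prob_space_distr) auto
  then interpret P': product_prob_space P' I by (intro product_prob_spaceI)
  have sets_P' [simp, measurable_cong]: "sets (P' j) = sets borel" for j by (simp add: P'_def)
  have sets_PiM_P': "sets (PiM I P') = sets (PiM I (\<lambda>_. borel))" by (intro sets_PiM_cong) auto
  have one: "distr N (PiM I (\<lambda>_. borel)) (\<lambda>t. \<lambda>j\<in>I. \<kappa> * t j) = PiM I P'"
  proof (rule P'.PiM_eqI)
    fix B assume B: "\<And>i. i \<in> I \<Longrightarrow> B i \<in> sets (P' i)"
    then have [measurable]: "\<And>i. i \<in> I \<Longrightarrow> B i \<in> sets borel" by simp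
    have "emeasure (distr N (PiM I (\<lambda>_. borel)) (\<lambda>t. \<lambda>j\<in>I. \<kappa> * t j)) (Pi\<^sub>E I B)
        = emeasure N ((\<lambda>t. \<lambda>j\<in>I. \<kappa> * t j) -` Pi\<^sub>E I B \<inter> space N)"
      using I by (intro emeasure_distr sets_PiM_I_finite) auto
    also have "(\<lambda>t. \<lambda>j\<in>I. \<kappa> * t j) -` Pi\<^sub>E I B \<inter> space N = Pi\<^sub>E I (\<lambda>j. (\<lambda>t. \<kappa> * t) -` B j)"
      by (auto simp: N_P space_PiM PiE_iff P_def)
    also have "emeasure N \<dots> = (\<Prod>j\<in>I. emeasure (P j) ((\<lambda>t. \<kappa> * t) -` B j))"
      unfolding N_P using I
    proof (intro N.emeasure_PiM)
      fix i assume "i \<in> I"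
      then show "(\<lambda>t. \<kappa> * t) -` B i \<in> sets (P i)"
        using measurable_sets[of "\<lambda>t. \<kappa> * t" borel borel "B i"] by simp
    qed
    also have "\<dots> = (\<Prod>j\<in>I. emeasure (P' j) (B j))"
    proof (intro prod.cong refl)
      fix j assume "j \<in> I"
      have "space (P j) = UNIV" by (simp add: P_def)
      with \<open>j \<in> I\<close> show "emeasure (P j) ((\<lambda>t. \<kappa> * t) -` B j) = emeasure (P' j) (B j)"
        unfolding P'_def by (subst emeasure_distr) auto
    qed
    finally show "emeasure (distr N (PiM I (\<lambda>_. borel)) (\<lambda>t. \<lambda>j\<in>I. \<kappa> * t j)) (Pi\<^sub>E I B) = (\<Prod>j\<in>I. emeasure (P' j) (B j))" .
  qed (use I sets_PiM_P' in auto)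
  have two: "density N (\<lambda>t. (?w t)) = PiM I P'"
  proof (rule P'.PiM_eqI)
    fix B assume B: "\<And>i. i \<in> I \<Longrightarrow> B i \<in> sets (P' i)"
    then have [measurable]: "\<And>i. i \<in> I \<Longrightarrow> B i \<in> sets borel" by simp
    have weight: "(?w t) = (\<Prod>j\<in>I. w j (t j))" for t
    proof -
      have "(\<Prod>j\<in>I. w j (t j)) = ennreal (\<Prod>j\<in>I. \<kappa> powr (- \<alpha> j) * exp (t j - t j / \<kappa>))"
        unfolding w_def by (rule prod_ennreal) auto
      also have "(\<Prod>j\<in>I. \<kappa> powr (- \<alpha> j) * exp (t j - t j / \<kappa>)) = \<kappa> powr (\<Sum>j\<in>I. - \<alpha> j) * exp (\<Sum>j\<in>I. t j - t j / \<kappa>)"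
        using I assms by (simp add: prod.distrib exp_sum powr_sum)
      finally show ?thesis by (simp add: A_def S_def sum_negf sum_subtractf sum_divide_distrib)
    qed
    have "emeasure (density N (\<lambda>t. (?w t))) (Pi\<^sub>E I B)
      = (\<integral>\<^sup>+t. (?w t) * indicator (Pi\<^sub>E I B) t \<partial>N)"
      using I by (intro emeasure_density) (auto simp: sets_N intro!: sets_PiM_I_finite)
    also have "\<dots> = (\<integral>\<^sup>+t. (\<Prod>j\<in>I. w j (t j) * indicator (B j) (t j)) \<partial>PiM I P)"
      unfolding N_P[symmetric]
    proof (rule nn_integral_cong)
      fix t assume "t \<in> space N"
      then have "t \<in> extensional I" by (auto simp: N_P space_PiM PiE_iff)
      then have "indicator (Pi\<^sub>E I B) t = (\<Prod>j\<in>I. indicator (B j) (t j) :: ennreal)"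
        using I by (auto simp: indicator_def PiE_iff prod_zero_iff)
      then show "(?w t) * indicator (Pi\<^sub>E I B) t = (\<Prod>j\<in>I. w j (t j) * indicator (B j) (t j))"
        by (simp add: weight prod.distrib)
    qed
    also have "\<dots> = (\<Prod>j\<in>I. \<integral>\<^sup>+t. w j t * indicator (B j) t \<partial>P j)"
      using I by (intro N.product_nn_integral_prod) auto
    also have "\<dots> = (\<Prod>j\<in>I. emeasure (P' j) (B j))"
    proof (intro prod.cong refl)
      fix j assume j: "j \<in> I"
      then have [measurable]: "B j \<in> sets borel" by simp
      have "(\<integral>\<^sup>+t. w j t * indicator (B j) t \<partial>P j) = (\<integral>\<^sup>+t. indicator (B j) (\<kappa> * t) \<partial>P j)"
        using j \<alpha>_pos assms unfolding P_def w_def by (simp add: gamma_law_scale)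
      also have "\<dots> = (\<integral>\<^sup>+t. indicator (B j) t \<partial>P' j)"
        unfolding P'_def using j by (intro nn_integral_distr[symmetric]) auto
      finally show "(\<integral>\<^sup>+t. w j t * indicator (B j) t \<partial>P j) = emeasure (P' j) (B j)"
        using j by simp
    qed
    finally show "emeasure (density N (\<lambda>t. (?w t))) (Pi\<^sub>E I B) = (\<Prod>j\<in>I. emeasure (P' j) (B j))" .
  qed (use I sets_PiM_P' in \<open>auto simp: sets_N\<close>)
  show ?thesis using one two by simp
qed

lemma scale_nn_integral:
  assumes "\<kappa> > 0" and [measurable]: "G \<in> borel_measurable N"
  shows "(\<integral>\<^sup>+t. G (\<lambda>j\<in>I. \<kappa> * t j) \<partial>N) = (\<integral>\<^sup>+t. ennreal (\<kappa> powr (- A) * exp (S t - S t / \<kappa>)) * G t \<partial>N)"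
proof -
  have "(\<integral>\<^sup>+t. G (\<lambda>j\<in>I. \<kappa> * t j) \<partial>N) = (\<integral>\<^sup>+t. G t \<partial>distr N (PiM I (\<lambda>_. borel)) (\<lambda>t. \<lambda>j\<in>I. \<kappa> * t j))"
    by (subst nn_integral_distr) auto
  also have "\<dots> = (\<integral>\<^sup>+t. ennreal (\<kappa> powr (- A) * exp (S t - S t / \<kappa>)) * G t \<partial>N)"
    unfolding scale_law[OF assms(1)] by (rule nn_integral_density) auto
  finally show ?thesis .
qed

lemma S_scale: "S (\<lambda>j\<in>I. \<kappa> * t j) = \<kappa> * S t"
  by (simp add: S_def sum_distrib_left)

lemma V_scale: "\<kappa> > 0 \<Longrightarrow> V (\<lambda>j\<in>I. \<kappa> * t j) = V t"
  by (simp add: V_def S_scale power_int_mult_distrib power_mult_distrib power_int_minus field_simps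
      flip: sum_distrib_left)

lemma AE_component_pos: "AE t in N. \<forall>j\<in>I. t j > 0"
proof (rule AE_finite_allI[OF I(1)])
  fix j assume j: "j \<in> I"
  have "AE t in gamma_law (\<alpha> j). t > 0"
    by (subst AE_density) (auto simp: gamma_density_def)
  moreover have "P j = gamma_law (\<alpha> j)" using j by (simp add: P_def)
  ultimately have "AE t in P j. t > 0" by (simp only:)
  then show "AE t in N. t j > 0"
    unfolding N_P using j prob_space_P by (intro AE_PiM_component) auto
qed

lemma AE_S_pos: "AE t in N. S t > 0"
  using AE_component_pos by eventually_elim (use I in \<open>auto simp: S_def intro: sum_pos\<close>)

text \<open>
Independence of \<open>V\<close> and \<open>S\<close>, and the gamma law of \<open>S\<close>, without a change of variables in several
dimensions. Substituting \<open>r = \<kappa> S\<close> in the inner integral and undoing the scaling by \<open>\<kappa>\<close> on the vector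
gives the right-hand side, except for a factor \<open>c\<close> that depends neither on \<open>\<phi>\<close> nor on the vector. The
choice \<open>\<phi> = 1\<close> shows that \<open>c = 1\<close>, so the integral that defines \<open>c\<close> need not be computed.
\<close>
lemma polar_nn_integral:
  assumes [measurable]: "\<phi> \<in> borel_measurable (borel \<Otimes>\<^sub>M borel)"
  shows "(\<integral>\<^sup>+t. (\<integral>\<^sup>+r. \<phi> (V t, r) \<partial>gamma_law A) \<partial>N) = (\<integral>\<^sup>+t. \<phi> (V t, S t) \<partial>N)"
proof -
  let ?W = "\<lambda>\<kappa> t. indicator {0<..} \<kappa> * (\<kappa> powr (- A) * exp (S t - S t / \<kappa>)) * (S t / \<kappa> * gamma_density A (S t))"
  let ?U = "\<lambda>\<kappa> t. indicator {0<..} \<kappa> * S t * gamma_density A (\<kappa> * S t)"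
  define c where "c = (\<integral>\<^sup>+\<mu>. ennreal (indicator {0<..} \<mu> * (\<mu> powr (- A - 1) * exp (- 1 / \<mu>) / Gamma A)) \<partial>lborel)"
  have main: "(\<integral>\<^sup>+t. (\<integral>\<^sup>+r. \<phi> (V t, r) \<partial>gamma_law A) \<partial>N) = c * (\<integral>\<^sup>+t. \<phi> (V t, S t) \<partial>N)"
    if [measurable]: "\<phi> \<in> borel_measurable (borel \<Otimes>\<^sub>M borel)" for \<phi> :: "real \<times> real \<Rightarrow> ennreal"
  proof -
    interpret pair_sigma_finite N lborel ..
    have "(\<integral>\<^sup>+t. (\<integral>\<^sup>+r. \<phi> (V t, r) \<partial>gamma_law A) \<partial>N)
        = (\<integral>\<^sup>+t. (\<integral>\<^sup>+\<kappa>. ennreal (?U \<kappa> t) * \<phi> (V t, \<kappa> * S t) \<partial>lborel) \<partial>N)"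
    proof (rule nn_integral_cong_AE, use AE_S_pos in eventually_elim)
      case (elim t)
      have "(\<integral>\<^sup>+r. \<phi> (V t, r) \<partial>gamma_law A) = (\<integral>\<^sup>+r. ennreal (gamma_density A r) * \<phi> (V t, r) \<partial>lborel)"
        by (rule nn_integral_density) auto
      also have "\<dots> = ennreal \<bar>S t\<bar> * (\<integral>\<^sup>+\<kappa>. ennreal (gamma_density A (0 + S t * \<kappa>)) * \<phi> (V t, 0 + S t * \<kappa>) \<partial>lborel)"
        using elim by (intro nn_integral_real_affine) auto
      also have "\<dots> = (\<integral>\<^sup>+\<kappa>. ennreal \<bar>S t\<bar> * (ennreal (gamma_density A (0 + S t * \<kappa>)) * \<phi> (V t, 0 + S t * \<kappa>)) \<partial>lborel)"
        by (rule nn_integral_cmult[symmetric]) auto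
      also have "\<dots> = (\<integral>\<^sup>+\<kappa>. ennreal (?U \<kappa> t) * \<phi> (V t, \<kappa> * S t) \<partial>lborel)"
      proof (rule nn_integral_cong)
        fix \<kappa> :: real
        show "ennreal \<bar>S t\<bar> * (ennreal (gamma_density A (0 + S t * \<kappa>)) * \<phi> (V t, 0 + S t * \<kappa>))
          = ennreal (?U \<kappa> t) * \<phi> (V t, \<kappa> * S t)"
        proof (cases "\<kappa> > 0")
          case True
          then show ?thesis
            using elim gamma_density_nonneg[OF A_pos]
            by (simp add: mult.assoc[symmetric] mult.commute[of \<kappa>] flip: ennreal_mult)
        next
          case False
          then show ?thesis using elim by (simp add: gamma_density_def zero_less_mult_iff)
        qed
      qed
      finally show ?case .
    qed
    also have "\<dots> = (\<integral>\<^sup>+\<kappa>. (\<integral>\<^sup>+t. ennreal (?U \<kappa> t) * \<phi> (V t, \<kappa> * S t) \<partial>N) \<partial>lborel)"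
      by (rule Fubini'[symmetric]) measurable
    also have "\<dots> = (\<integral>\<^sup>+\<kappa>. (\<integral>\<^sup>+t. ennreal (?W \<kappa> t) * \<phi> (V t, S t) \<partial>N) \<partial>lborel)"
    proof (rule nn_integral_cong)
      fix \<kappa> :: real
      show "(\<integral>\<^sup>+t. ennreal (?U \<kappa> t) * \<phi> (V t, \<kappa> * S t) \<partial>N)
        = (\<integral>\<^sup>+t. ennreal (?W \<kappa> t) * \<phi> (V t, S t) \<partial>N)"
      proof (cases "\<kappa> > 0")
        case True
        define G where "G t = ennreal (S t / \<kappa> * gamma_density A (S t)) * \<phi> (V t, S t)" for t
        have [measurable]: "G \<in> borel_measurable N" unfolding G_def by measurable
        have "(\<integral>\<^sup>+t. G (\<lambda>j\<in>I. \<kappa> * t j) \<partial>N) = (\<integral>\<^sup>+t. ennreal (\<kappa> powr (- A) * exp (S t - S t / \<kappa>)) * G t \<partial>N)"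
          by (rule scale_nn_integral[OF True]) measurable
        moreover have "ennreal (\<kappa> powr (- A) * exp (S t - S t / \<kappa>)) * G t
          = ennreal (?W \<kappa> t) * \<phi> (V t, S t)" for t
        proof -
          have "ennreal (\<kappa> powr (- A) * exp (S t - S t / \<kappa>)) * ennreal (S t / \<kappa> * gamma_density A (S t))
            = ennreal (?W \<kappa> t)"
            using True by (subst ennreal_mult'[symmetric]) auto
          then show ?thesis by (simp add: G_def mult.assoc[symmetric])
        qed
        ultimately show ?thesis
          using True by (simp add: G_def S_scale V_scale)
      qed simp
    qed
    also have "\<dots> = (\<integral>\<^sup>+t. (\<integral>\<^sup>+\<kappa>. ennreal (?W \<kappa> t) * \<phi> (V t, S t) \<partial>lborel) \<partial>N)"
      by (rule Fubini') measurable
    also have "\<dots> = (\<integral>\<^sup>+t. c * \<phi> (V t, S t) \<partial>N)"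
    proof (rule nn_integral_cong_AE, use AE_S_pos in eventually_elim)
      case (elim t)
      have "(\<integral>\<^sup>+\<kappa>. ennreal (?W \<kappa> t) \<partial>lborel)
         = ennreal \<bar>S t\<bar> * (\<integral>\<^sup>+\<mu>. ennreal (indicator {0<..} (0 + S t * \<mu>) * ((0 + S t * \<mu>) powr (- A) * exp (S t - S t / (0 + S t * \<mu>))) * (S t / (0 + S t * \<mu>) * gamma_density A (S t))) \<partial>lborel)"
        using elim by (intro nn_integral_real_affine) auto
      also have "\<dots> = (\<integral>\<^sup>+\<mu>. ennreal \<bar>S t\<bar> * ennreal (indicator {0<..} (0 + S t * \<mu>) * ((0 + S t * \<mu>) powr (- A) * exp (S t - S t / (0 + S t * \<mu>))) * (S t / (0 + S t * \<mu>) * gamma_density A (S t))) \<partial>lborel)"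
        by (rule nn_integral_cmult[symmetric]) auto
      also have "\<dots> = c"
        unfolding c_def
      proof (rule nn_integral_cong)
        fix \<mu> :: real
        have "S t * (indicator {0<..} (S t * \<mu>) * ((S t * \<mu>) powr (- A) * exp (S t - S t / (S t * \<mu>))) * (S t / (S t * \<mu>) * gamma_density A (S t)))
           = indicator {0<..} \<mu> * (\<mu> powr (- A - 1) * exp (- 1 / \<mu>) / Gamma A)"
        proof (cases "\<mu> > 0")
          case True
          have "(S t * \<mu>) powr (- A) = S t powr (- A) * \<mu> powr (- A)" using True elim by (simp add: powr_mult)
          moreover have "\<mu> powr (- A) / \<mu> = \<mu> powr (- A - 1)" using True by (simp add: powr_diff)
          moreover have "S t * S t powr (- A) * S t powr (A - 1) = 1" using elim by (simp add: powr_diff powr_minus field_simps)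
          moreover have "exp (S t - 1 / \<mu>) * exp (- S t) = exp (- 1 / \<mu>)" by (simp add: mult_exp_exp)
          moreover have "S t * (indicator {0<..} (S t * \<mu>) * ((S t * \<mu>) powr (- A) * exp (S t - S t / (S t * \<mu>))) * (S t / (S t * \<mu>) * gamma_density A (S t)))
            = (S t * (S t * \<mu>) powr (- A) * S t powr (A - 1)) * (exp (S t - 1 / \<mu>) * exp (- S t)) / \<mu> / Gamma A"
            using True elim by (simp add: gamma_density_def)
          ultimately show ?thesis using True by (simp add: field_simps)
        qed (use elim in \<open>simp add: zero_less_mult_iff\<close>)
        then show "ennreal \<bar>S t\<bar> * ennreal (indicator {0<..} (0 + S t * \<mu>) * ((0 + S t * \<mu>) powr (- A) * exp (S t - S t / (0 + S t * \<mu>))) * (S t / (0 + S t * \<mu>) * gamma_density A (S t)))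
          = ennreal (indicator {0<..} \<mu> * (\<mu> powr (- A - 1) * exp (- 1 / \<mu>) / Gamma A))"
          using elim by (simp flip: ennreal_mult')
      qed
      finally show ?case
        by (subst nn_integral_multc) auto
    qed
    also have "\<dots> = c * (\<integral>\<^sup>+t. \<phi> (V t, S t) \<partial>N)"
      by (rule nn_integral_cmult) measurable
    finally show ?thesis .
  qed
  have "emeasure (gamma_law A) UNIV = 1"
    using prob_space.emeasure_space_1[OF prob_space_gamma_law[OF A_pos]] by simp
  then have "c = 1"
    using main[of "\<lambda>_. 1"] N.emeasure_space_1 by simp
  then show ?thesis using main[OF assms] by simp
qed

lemma polar_law: "distr N (borel \<Otimes>\<^sub>M borel) (\<lambda>t. (V t, S t)) = distr N borel V \<Otimes>\<^sub>M gamma_law A"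
proof (rule measure_eqI)
  interpret G: prob_space "gamma_law A" by (rule prob_space_gamma_law[OF A_pos])
  show sets_eq: "sets (distr N (borel \<Otimes>\<^sub>M borel) (\<lambda>t. (V t, S t))) = sets (distr N borel V \<Otimes>\<^sub>M gamma_law A)"
    by (simp cong: sets_pair_measure_cong)
  fix B assume "B \<in> sets (distr N (borel \<Otimes>\<^sub>M borel) (\<lambda>t. (V t, S t)))"
  then have [measurable]: "B \<in> sets (borel \<Otimes>\<^sub>M borel)" by simp
  have "emeasure (distr N borel V \<Otimes>\<^sub>M gamma_law A) B = (\<integral>\<^sup>+v. (\<integral>\<^sup>+r. indicator B (v, r) \<partial>gamma_law A) \<partial>distr N borel V)"
    using sets_eq by (intro G.emeasure_pair_measure) auto
  also have "\<dots> = (\<integral>\<^sup>+t. (\<integral>\<^sup>+r. indicator B (V t, r) \<partial>gamma_law A) \<partial>N)"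
    by (rule nn_integral_distr) auto
  also have "\<dots> = (\<integral>\<^sup>+t. indicator B (V t, S t) \<partial>N)"
    by (rule polar_nn_integral) auto
  also have "\<dots> = (\<integral>\<^sup>+z. indicator B z \<partial>distr N (borel \<Otimes>\<^sub>M borel) (\<lambda>t. (V t, S t)))"
    by (rule nn_integral_distr[symmetric]) auto
  finally show "emeasure (distr N (borel \<Otimes>\<^sub>M borel) (\<lambda>t. (V t, S t))) B = emeasure (distr N borel V \<Otimes>\<^sub>M gamma_law A) B"
    by simp
qed

end

section \<open>Decay along rays and on horizontal lines\<close>

lemma gauss_laplace_bounded:
  assumes "a > 0" "Re z \<le> u"
  shows "cmod (gauss_laplace a z) \<le> (LINT t:{0<..}|lborel. t powr (a - 1) * exp (u * t - t\<^sup>2 / 2))"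
proof -
  have "cmod (gauss_laplace a z) \<le> (LINT t:{0<..}|lborel. t powr (a - 1) * exp (Re z * t - t\<^sup>2 / 2))"
    by (rule norm_gauss_laplace_le[OF assms(1)])
  also have "\<dots> \<le> (LINT t:{0<..}|lborel. t powr (a - 1) * exp (u * t - t\<^sup>2 / 2))"
    using assms by (intro set_integral_mono real_gauss_laplace_integrable) (auto intro!: mult_left_mono mult_right_mono)
  finally show ?thesis .
qed

lemma continuous_gauss_laplace:
  assumes "a > 0"
  shows "continuous_on UNIV (gauss_laplace a)"
proof -
  have "isCont (gauss_laplace a) z" for z
    unfolding continuous_at_sequentially o_def
  proof (intro allI impI)
    fix Z assume Z: "Z \<longlonglongrightarrow> z"
    then obtain K where K: "\<And>n. cmod (Z n) \<le> K"
      using convergent_imp_Bseq[of Z] by (auto simp: convergent_def Bseq_def)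
    show "(\<lambda>n. gauss_laplace a (Z n)) \<longlonglongrightarrow> gauss_laplace a z"
      unfolding gauss_laplace_def set_lebesgue_integral_def
    proof (rule integral_dominated_convergence[where w = "\<lambda>t. indicator {0<..} t *\<^sub>R (t powr (a - 1) * exp (K * t - t\<^sup>2 / 2))"])
      show "integrable lborel (\<lambda>t. indicator {0<..} t *\<^sub>R (t powr (a - 1) * exp (K * t - t\<^sup>2 / 2)))"
        using real_gauss_laplace_integrable[OF assms] by (simp add: set_integrable_def)
      show "AE t in lborel. (\<lambda>n. indicator {0<..} t *\<^sub>R (of_real (t powr (a - 1)) * exp (Z n * of_real t - of_real (t\<^sup>2) / 2)))
        \<longlonglongrightarrow> indicator {0<..} t *\<^sub>R (of_real (t powr (a - 1)) * exp (z * of_real t - of_real (t\<^sup>2) / 2))"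
        by (intro AE_I2 tendsto_intros Z)
      show "AE t in lborel. norm (indicator {0<..} t *\<^sub>R (of_real (t powr (a - 1)) * exp (Z n * of_real t - of_real (t\<^sup>2) / 2)))
        \<le> indicator {0<..} t *\<^sub>R (t powr (a - 1) * exp (K * t - t\<^sup>2 / 2))" for n
      proof (rule AE_I2)
        fix t :: real
        have "Re (Z n) * t \<le> K * t" if "t > 0"
          using order_trans[OF complex_Re_le_cmod K[of n]] that by (intro mult_right_mono) auto
        then show "norm (indicator {0<..} t *\<^sub>R (of_real (t powr (a - 1)) * exp (Z n * of_real t - of_real (t\<^sup>2) / 2)))
          \<le> indicator {0<..} t *\<^sub>R (t powr (a - 1) * exp (K * t - t\<^sup>2 / 2))"
          by (auto simp: norm_mult indicator_def intro!: mult_left_mono)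
      qed
    qed measurable
  qed
  then show ?thesis by (simp add: continuous_on_eq_continuous_at)
qed

text \<open>
The ray \<open>arg z = -\<pi>/4\<close>, parametrised by arc length. It bounds the sector of the estimate above, and
\<open>e\<^bsup>z\<^sup>2\<^esup>\<close> has modulus one on it.
\<close>
definition ray :: "real \<Rightarrow> complex" where
  "ray s = Complex (s / sqrt 2) (- (s / sqrt 2))"

lemma powr_comparable:
  fixes b x e :: real
  assumes "x > 0" "x / 4 \<le> b" "b \<le> x"
  shows "b powr e \<le> 4 powr \<bar>e\<bar> * x powr e"
proof (cases "e \<ge> 0")
  case True
  then have "b powr e \<le> x powr e"
    using assms by (intro powr_mono2) auto
  also have "\<dots> \<le> 4 powr \<bar>e\<bar> * x powr e"
    using mult_right_mono[of 1 "4 powr \<bar>e\<bar>" "x powr e"] by (simp add: ge_one_powr_ge_zero)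
  finally show ?thesis .
next
  case False
  then have "b powr e \<le> (x / 4) powr e"
    using assms by (intro powr_mono2') auto
  also have "\<dots> = 4 powr \<bar>e\<bar> * x powr e"
    using assms False by (simp add: powr_divide powr_minus_divide)
  finally show ?thesis .
qed

lemma bound_from_tail:
  fixes g :: "real \<Rightarrow> complex" and e :: real
  assumes "C \<ge> 0" "\<And>s. s \<ge> 4 \<Longrightarrow> cmod (g s) \<le> C * (1 + s) powr e"
    and "\<And>s. 0 \<le> s \<Longrightarrow> s \<le> 4 \<Longrightarrow> cmod (g s) \<le> B"
  shows "\<exists>C\<ge>0. \<forall>s\<ge>0. cmod (g s) \<le> C * (1 + s) powr e"
proof (intro exI conjI allI impI)
  have "0 \<le> B" using order_trans[OF norm_ge_zero assms(3)[of 0]] by simp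
  then show "0 \<le> C + B * 5 powr \<bar>e\<bar>" using \<open>C \<ge> 0\<close> by simp
  fix s :: real assume "s \<ge> 0"
  show "cmod (g s) \<le> (C + B * 5 powr \<bar>e\<bar>) * (1 + s) powr e"
  proof (cases "s \<ge> 4")
    case True
    then have "cmod (g s) \<le> C * (1 + s) powr e" by (rule assms)
    also have "\<dots> \<le> (C + B * 5 powr \<bar>e\<bar>) * (1 + s) powr e"
      using \<open>0 \<le> B\<close> by (intro mult_right_mono) auto
    finally show ?thesis .
  next
    case False
    have "1 \<le> 5 powr \<bar>e\<bar> * (1 + s) powr e"
    proof (cases "e \<ge> 0")
      case True
      then have "1 \<le> 5 powr \<bar>e\<bar>" "1 \<le> (1 + s) powr e"
        using \<open>s \<ge> 0\<close> by (auto intro: ge_one_powr_ge_zero)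
      then show ?thesis using mult_mono[of 1 "5 powr \<bar>e\<bar>" 1 "(1 + s) powr e"] by simp
    next
      case e: False
      have "5 powr e \<le> (1 + s) powr e"
        using \<open>s \<ge> 0\<close> False e by (intro powr_mono2') auto
      then have "5 powr \<bar>e\<bar> * 5 powr e \<le> 5 powr \<bar>e\<bar> * (1 + s) powr e" by simp
      then show ?thesis using e by (simp flip: powr_add)
    qed
    then have "B * 1 \<le> B * (5 powr \<bar>e\<bar> * (1 + s) powr e)"
      using \<open>0 \<le> B\<close> by (intro mult_left_mono)
    moreover have "cmod (g s) \<le> B" using False \<open>s \<ge> 0\<close> by (intro assms) auto
    moreover have "0 \<le> C * (1 + s) powr e" using \<open>C \<ge> 0\<close> by simp
    ultimately show ?thesis by (simp add: algebra_simps)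
  qed
qed

text \<open>
On the ray the end point and the saddle point both contribute a power of \<open>s\<close>; either may dominate.
\<close>
lemma gauss_laplace_ray_bound:
  assumes "a > 0"
  shows "\<exists>C\<ge>0. \<forall>s\<ge>0. cmod (gauss_laplace a (ray s)) \<le> C * (1 + s) powr (max (a - 1) (- a))"
proof -
  define e where "e = max (a - 1) (- a)"
  obtain C where C: "C \<ge> 0" "\<And>u b. 0 \<le> u \<Longrightarrow> u \<le> b \<Longrightarrow> 2 \<le> b \<Longrightarrow>
    cmod (gauss_laplace a (Complex u (- b))) \<le> C * (b powr (- a) + b powr (a - 1) * exp ((u\<^sup>2 - b\<^sup>2) / 2))"
    using gauss_laplace_sector_bound[OF assms] by blast
  have sqrt2: "1 \<le> sqrt 2" "sqrt 2 \<le> 2" using sqrt2_less_2 by auto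
  have "\<exists>C\<ge>0. \<forall>s\<ge>0. cmod (gauss_laplace a (ray s)) \<le> C * (1 + s) powr e"
  proof (rule bound_from_tail)
    fix s :: real assume s: "s \<ge> 4"
    define b where "b = s / sqrt 2"
    have "s / 2 \<le> b" unfolding b_def using s sqrt2 by (intro divide_left_mono) auto
    moreover have "b \<le> s / 1" unfolding b_def using s sqrt2 by (intro divide_left_mono) auto
    ultimately have b: "2 \<le> b" "(1 + s) / 4 \<le> b" "b \<le> 1 + s" using s by auto
    have "cmod (gauss_laplace a (ray s)) \<le> C * (b powr (- a) + b powr (a - 1) * exp ((b\<^sup>2 - b\<^sup>2) / 2))"
      unfolding ray_def b_def[symmetric] using b by (intro C) auto
    also have "\<dots> \<le> C * (b powr e + b powr e)"
      using b C(1) by (intro mult_left_mono add_mono) (auto simp: e_def)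
    also have "\<dots> \<le> C * (2 * (4 powr \<bar>e\<bar> * (1 + s) powr e))"
      using powr_comparable[of "1 + s" b e] b C(1) s by (intro mult_left_mono) auto
    finally show "cmod (gauss_laplace a (ray s)) \<le> (C * 2 * 4 powr \<bar>e\<bar>) * (1 + s) powr e"
      by (simp add: mult_ac)
  next
    fix s :: real assume s: "0 \<le> s" "s \<le> 4"
    have "s / sqrt 2 \<le> s / 1" using s sqrt2 by (intro divide_left_mono) auto
    then show "cmod (gauss_laplace a (ray s)) \<le> (LINT t:{0<..}|lborel. t powr (a - 1) * exp (4 * t - t\<^sup>2 / 2))"
      using s by (intro gauss_laplace_bounded[OF assms]) (auto simp: ray_def)
  qed (use C in auto)
  then show ?thesis unfolding e_def .
qed

text \<open>
On the opposite ray \<open>e\<^bsup>zt\<^esup>\<close> decays in \<open>t\<close>, so a gamma integral suffices.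
\<close>
lemma gauss_laplace_neg_ray_bound:
  assumes "a > 0"
  shows "\<exists>C\<ge>0. \<forall>s\<ge>0. cmod (gauss_laplace a (- ray s)) \<le> C * (1 + s) powr (- a)"
proof (rule bound_from_tail)
  have sqrt2: "1 \<le> sqrt 2" "sqrt 2 \<le> 2" using sqrt2_less_2 by auto
  show "0 \<le> Gamma a * 4 powr \<bar>- a\<bar>" using Gamma_real_pos[OF assms] by simp
  fix s :: real assume s: "s \<ge> 4"
  define b where "b = s / sqrt 2"
  have "s / 2 \<le> b" unfolding b_def using s sqrt2 by (intro divide_left_mono) auto
  moreover have "b \<le> s / 1" unfolding b_def using s sqrt2 by (intro divide_left_mono) auto
  ultimately have b: "2 \<le> b" "(1 + s) / 4 \<le> b" "b \<le> 1 + s" using s by auto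
  have "cmod (gauss_laplace a (- ray s)) \<le> (LINT t:{0<..}|lborel. t powr (a - 1) * exp (Re (- ray s) * t - t\<^sup>2 / 2))"
    by (rule norm_gauss_laplace_le[OF assms])
  also have "\<dots> \<le> (LINT t:{0<..}|lborel. t powr (a - 1) * exp (- (b * t)))"
    using assms b by (intro set_integral_mono real_gauss_laplace_integrable set_integrable_Gamma)
      (auto simp: ray_def b_def intro!: mult_left_mono)
  also have "\<dots> = Gamma a * b powr (- a)"
    using assms b by (intro set_integral_Gamma) auto
  also have "\<dots> \<le> Gamma a * (4 powr \<bar>- a\<bar> * (1 + s) powr (- a))"
    using powr_comparable[of "1 + s" b "- a"] b s Gamma_real_pos[OF assms] by (intro mult_left_mono) auto
  finally show "cmod (gauss_laplace a (- ray s)) \<le> (Gamma a * 4 powr \<bar>- a\<bar>) * (1 + s) powr (- a)"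
    by (simp add: mult_ac)
next
  fix s :: real assume "0 \<le> s" "s \<le> 4"
  then show "cmod (gauss_laplace a (- ray s)) \<le> (LINT t:{0<..}|lborel. t powr (a - 1) * exp (0 * t - t\<^sup>2 / 2))"
    by (intro gauss_laplace_bounded[OF assms]) (auto simp: ray_def)
qed

lemma gauss_laplace_axis_bound:
  assumes "a > 0"
  shows "\<exists>C\<ge>0. \<forall>y\<ge>0. cmod (gauss_laplace a (Complex 0 (- y))) \<le> C * (1 + y) powr (- a)"
proof -
  obtain C where C: "C \<ge> 0" "\<And>u b. 0 \<le> u \<Longrightarrow> u \<le> b \<Longrightarrow> 2 \<le> b \<Longrightarrow>
    cmod (gauss_laplace a (Complex u (- b))) \<le> C * (b powr (- a) + b powr (a - 1) * exp ((u\<^sup>2 - b\<^sup>2) / 2))"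
    using gauss_laplace_sector_bound[OF assms] by blast
  define K where "K = (max 1 (2 * a / 1)) powr (2 * a) * exp (1/2)"
  have "K \<ge> 0" by (simp add: K_def)
  show ?thesis
  proof (rule bound_from_tail)
    fix y :: real assume y: "y \<ge> 4"
    have "y powr (- a) \<le> 4 powr \<bar>- a\<bar> * (1 + y) powr (- a)"
      using y by (intro powr_comparable) auto
    moreover have "y powr (a - 1) * exp ((0\<^sup>2 - y\<^sup>2) / 2) \<le> K * (1 + y) powr (- a)"
    proof -
      have "(1 + y) powr (2 * a) * exp (- (y\<^sup>2 / 2)) \<le> ((max 1 (2 * a / 1)) powr (2 * a) * exp (1 * y)) * exp (- (y\<^sup>2 / 2))"
        using y assms by (intro mult_right_mono powr_le_exp) auto
      also have "\<dots> = (max 1 (2 * a / 1)) powr (2 * a) * exp (y - y\<^sup>2 / 2)"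
        by (simp add: mult_exp_exp mult.assoc)
      also have "\<dots> \<le> K"
        unfolding K_def using zero_le_power2[of "y - 1"]
        by (intro mult_left_mono) (auto simp: power2_eq_square algebra_simps)
      finally have 1: "(1 + y) powr (2 * a) * exp (- (y\<^sup>2 / 2)) \<le> K" .
      have "y powr (a - 1) \<le> y powr a" using y by (intro powr_mono) auto
      also have "\<dots> \<le> (1 + y) powr a" using y assms by (intro powr_mono2) auto
      also have "\<dots> = (1 + y) powr (2 * a) * (1 + y) powr (- a)" by (simp flip: powr_add)
      finally have "y powr (a - 1) * exp (- (y\<^sup>2 / 2)) \<le> ((1 + y) powr (2 * a) * (1 + y) powr (- a)) * exp (- (y\<^sup>2 / 2))"
        by (rule mult_right_mono) auto
      also have "\<dots> = ((1 + y) powr (2 * a) * exp (- (y\<^sup>2 / 2))) * (1 + y) powr (- a)" by simp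
      also have "\<dots> \<le> K * (1 + y) powr (- a)"
        using 1 by (rule mult_right_mono) auto
      finally show ?thesis by simp
    qed
    ultimately have "C * (y powr (- a) + y powr (a - 1) * exp ((0\<^sup>2 - y\<^sup>2) / 2)) \<le> C * (4 powr \<bar>- a\<bar> * (1 + y) powr (- a) + K * (1 + y) powr (- a))"
      using C(1) by (intro mult_left_mono add_mono)
    with C(2)[of 0 y] y show "cmod (gauss_laplace a (Complex 0 (- y))) \<le> (C * (4 powr \<bar>- a\<bar> + K)) * (1 + y) powr (- a)"
      by (simp add: algebra_simps)
  next
    fix y :: real
    show "cmod (gauss_laplace a (Complex 0 (- y))) \<le> (LINT t:{0<..}|lborel. t powr (a - 1) * exp (0 * t - t\<^sup>2 / 2))"
      by (intro gauss_laplace_bounded[OF assms]) auto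
  qed (use C \<open>K \<ge> 0\<close> in auto)
qed

text \<open>
Uniformity in \<open>R\<close> is what allows dominated convergence on the side of the triangle that moves to infinity.
\<close>
lemma gauss_laplace_strip_bound:
  assumes "a > 0"
  shows "\<exists>C\<ge>0. \<forall>u R. 0 \<le> u \<longrightarrow> u \<le> R \<longrightarrow> 2 \<le> R \<longrightarrow> cmod (gauss_laplace a (Complex u (- R))) \<le> C * (1 + u) powr a"
proof -
  obtain C where C: "C \<ge> 0" "\<And>u b. 0 \<le> u \<Longrightarrow> u \<le> b \<Longrightarrow> 2 \<le> b \<Longrightarrow>
    cmod (gauss_laplace a (Complex u (- b))) \<le> C * (b powr (- a) + b powr (a - 1) * exp ((u\<^sup>2 - b\<^sup>2) / 2))"
    using gauss_laplace_sector_bound[OF assms] by blast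
  define K where "K = (max 1 (a / 1)) powr a * exp (1/2)"
  have "K \<ge> 0" by (simp add: K_def)
  have "cmod (gauss_laplace a (Complex u (- R))) \<le> (C * (1 + K)) * (1 + u) powr a" if u: "0 \<le> u" "u \<le> R" "2 \<le> R" for u R
  proof -
    define d where "d = R - u"
    have d: "d \<ge> 0" using u by (simp add: d_def)
    have "R powr (- a) \<le> 1"
      using u assms powr_mono[of "- a" 0 R] by simp
    also have "1 \<le> (1 + u) powr a"
      using u assms by (intro ge_one_powr_ge_zero) auto
    finally have 1: "R powr (- a) \<le> (1 + u) powr a" .
    have "R powr (a - 1) \<le> R powr a" using u by (intro powr_mono) auto
    also have "\<dots> \<le> ((1 + u) * (1 + d)) powr a"
      using u assms d mult_right_mono[of u R u] by (intro powr_mono2) (auto simp: d_def algebra_simps mult_left_mono)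
    also have "\<dots> = (1 + u) powr a * (1 + d) powr a"
      by (rule powr_mult)
    also have "\<dots> \<le> (1 + u) powr a * ((max 1 (a / 1)) powr a * exp (1 * d))"
      using d assms by (intro mult_left_mono powr_le_exp) auto
    finally have "R powr (a - 1) \<le> (1 + u) powr a * ((max 1 (a / 1)) powr a * exp (1 * d))" .
    moreover have "exp ((u\<^sup>2 - R\<^sup>2) / 2) \<le> exp (- (d\<^sup>2 / 2))"
    proof -
      have "u * u \<le> R * u" using u by (intro mult_right_mono) auto
      then have "u * u - R * R \<le> - (d * d)"
        by (simp add: d_def algebra_simps)
      then show ?thesis by (simp add: power2_eq_square)
    qed
    ultimately have "R powr (a - 1) * exp ((u\<^sup>2 - R\<^sup>2) / 2) \<le> ((1 + u) powr a * ((max 1 (a / 1)) powr a * exp (1 * d))) * exp (- (d\<^sup>2 / 2))"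
      by (intro mult_mono) auto
    also have "\<dots> = (1 + u) powr a * ((max 1 (a / 1)) powr a * exp (d - d\<^sup>2 / 2))"
      by (simp add: mult_exp_exp mult.assoc)
    also have "\<dots> \<le> (1 + u) powr a * K"
      unfolding K_def using zero_le_power2[of "d - 1"]
      by (intro mult_left_mono) (auto simp: power2_eq_square algebra_simps)
    finally have "C * (R powr (- a) + R powr (a - 1) * exp ((u\<^sup>2 - R\<^sup>2) / 2)) \<le> C * ((1 + u) powr a + (1 + u) powr a * K)"
      using 1 C(1) by (intro mult_left_mono add_mono)
    with C(2)[of u R] u show ?thesis by (simp add: algebra_simps)
  qed
  then show ?thesis using C(1) \<open>K \<ge> 0\<close> by (intro exI[of _ "C * (1 + K)"]) auto
qed

lemma gauss_laplace_strip_limit: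
  assumes "a > 0" "u \<ge> 0"
  shows "((\<lambda>R. gauss_laplace a (Complex u (- R))) \<longlongrightarrow> 0) at_top"
proof -
  obtain C where C: "C \<ge> 0" "\<And>u b. 0 \<le> u \<Longrightarrow> u \<le> b \<Longrightarrow> 2 \<le> b \<Longrightarrow>
    cmod (gauss_laplace a (Complex u (- b))) \<le> C * (b powr (- a) + b powr (a - 1) * exp ((u\<^sup>2 - b\<^sup>2) / 2))"
    using gauss_laplace_sector_bound[OF assms(1)] by blast
  show ?thesis
  proof (rule Lim_null_comparison)
    show "\<forall>\<^sub>F R in at_top. norm (gauss_laplace a (Complex u (- R))) \<le> C * (R powr (- a) + R powr (a - 1) * exp ((u\<^sup>2 - R\<^sup>2) / 2))"
      by (intro eventually_mono[OF eventually_ge_at_top[of "max 2 u"]] C) (use assms in auto)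
    have "((\<lambda>R. R powr (- a) + R powr (a - 1) * exp ((u\<^sup>2 - R\<^sup>2) / 2)) \<longlongrightarrow> 0) at_top"
      using assms(1) by real_asymp
    then show "((\<lambda>R. C * (R powr (- a) + R powr (a - 1) * exp ((u\<^sup>2 - R\<^sup>2) / 2))) \<longlongrightarrow> 0) at_top"
      using tendsto_mult_right_zero by blast
  qed
qed

lemma prod_norm_bound:
  fixes g :: "'i \<Rightarrow> 'x \<Rightarrow> complex" and b :: "'i \<Rightarrow> 'x \<Rightarrow> real"
  assumes "finite I" and "\<And>j. j \<in> I \<Longrightarrow> \<exists>C\<ge>0. \<forall>x\<in>T. cmod (g j x) \<le> C * b j x"
  shows "\<exists>C\<ge>0. \<forall>x\<in>T. cmod (\<Prod>j\<in>I. g j x) \<le> C * (\<Prod>j\<in>I. b j x)"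
proof -
  obtain C where C: "\<And>j. j \<in> I \<Longrightarrow> C j \<ge> 0" "\<And>j x. j \<in> I \<Longrightarrow> x \<in> T \<Longrightarrow> cmod (g j x) \<le> C j * b j x"
    using assms(2) by metis
  show ?thesis
  proof (intro exI[of _ "prod C I"] conjI ballI)
    show "0 \<le> prod C I" using C by (intro prod_nonneg) auto
    fix x assume "x \<in> T"
    then have "(\<Prod>j\<in>I. cmod (g j x)) \<le> (\<Prod>j\<in>I. C j * b j x)"
      using C by (intro prod_mono) auto
    then show "cmod (\<Prod>j\<in>I. g j x) \<le> prod C I * (\<Prod>j\<in>I. b j x)"
      by (simp add: prod_norm prod.distrib)
  qed
qed

context gamma_vector
begin

definition H :: "complex \<Rightarrow> complex" where
  "H z = (\<Prod>j\<in>I. gauss_laplace (\<alpha> j) z / of_real (Gamma (\<alpha> j)))"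

lemma continuous_H: "continuous_on UNIV H"
  unfolding H_def[abs_def] divide_inverse
  using \<alpha>_pos by (intro continuous_intros continuous_gauss_laplace) auto

lemma H_measurable [measurable]: "H \<in> borel_measurable borel"
  using continuous_H by (rule borel_measurable_continuous_onI)

lemma H_cnj: "H (cnj z) = cnj (H z)"
  by (simp add: H_def gauss_laplace_cnj)

text \<open>
Bounds of the form \<open>B\<^bsup>e\<^esup>\<close> for the factors give a bound for \<open>H\<close> in which the exponents add up.
\<close>
lemma H_bound:
  assumes "\<And>j. j \<in> I \<Longrightarrow> \<exists>C\<ge>0. \<forall>x\<in>T. cmod (gauss_laplace (\<alpha> j) (z x)) \<le> C * B x powr e j" and "\<And>x. x \<in> T \<Longrightarrow> B x > 0"
  shows "\<exists>C\<ge>0. \<forall>x\<in>T. cmod (H (z x)) \<le> C * B x powr (\<Sum>j\<in>I. e j)"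
proof -
  have "\<exists>C\<ge>0. \<forall>x\<in>T. cmod (\<Prod>j\<in>I. gauss_laplace (\<alpha> j) (z x) / of_real (Gamma (\<alpha> j))) \<le> C * (\<Prod>j\<in>I. B x powr e j)"
  proof (rule prod_norm_bound[OF I(1)])
    fix j assume j: "j \<in> I"
    have "Gamma (\<alpha> j) > 0" using \<alpha>_pos[OF j] by (rule Gamma_real_pos)
    obtain C where C: "C \<ge> 0" "\<And>x. x \<in> T \<Longrightarrow> cmod (gauss_laplace (\<alpha> j) (z x)) \<le> C * B x powr e j"
      using assms(1)[OF j] by blast
    show "\<exists>C\<ge>0. \<forall>x\<in>T. cmod (gauss_laplace (\<alpha> j) (z x) / of_real (Gamma (\<alpha> j))) \<le> C * B x powr e j"
      using C \<open>Gamma (\<alpha> j) > 0\<close>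
      by (intro exI[of _ "C / Gamma (\<alpha> j)"]) (auto simp: norm_divide divide_right_mono)
  qed
  then obtain C where C: "C \<ge> 0" "\<And>x. x \<in> T \<Longrightarrow>
      cmod (\<Prod>j\<in>I. gauss_laplace (\<alpha> j) (z x) / of_real (Gamma (\<alpha> j))) \<le> C * (\<Prod>j\<in>I. B x powr e j)"
    by blast
  have "(\<Prod>j\<in>I. B x powr e j) = B x powr (\<Sum>j\<in>I. e j)" if "x \<in> T" for x
    using assms(2)[OF that] I by (intro powr_sum[symmetric]) auto
  with C show ?thesis
    unfolding H_def by (intro exI[of _ C]) auto
qed

lemma H_ray_bound: "\<exists>C\<ge>0. \<forall>s\<ge>0. cmod (H (ray s)) \<le> C * (1 + s) powr (\<Sum>j\<in>I. max (\<alpha> j - 1) (- \<alpha> j))"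
proof -
  have "\<exists>C\<ge>0. \<forall>s\<in>{0..}. cmod (H (ray s)) \<le> C * (1 + s) powr (\<Sum>j\<in>I. max (\<alpha> j - 1) (- \<alpha> j))"
  proof (rule H_bound[of "{0..}" ray "\<lambda>s. 1 + s" "\<lambda>j. max (\<alpha> j - 1) (- \<alpha> j)"])
    fix j assume "j \<in> I"
    from gauss_laplace_ray_bound[OF \<alpha>_pos[OF this]]
    show "\<exists>C\<ge>0. \<forall>s\<in>{0..}. cmod (gauss_laplace (\<alpha> j) (ray s)) \<le> C * (1 + s) powr max (\<alpha> j - 1) (- \<alpha> j)"
      by (simp only: Ball_def atLeast_iff)
  qed auto
  then show ?thesis by (simp only: Ball_def atLeast_iff)
qed

lemma H_axis_bound: "\<exists>C\<ge>0. \<forall>y\<ge>0. cmod (H (Complex 0 (- y))) \<le> C * (1 + y) powr (- A)"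
proof -
  have "\<exists>C\<ge>0. \<forall>y\<in>{0..}. cmod (H (Complex 0 (- y))) \<le> C * (1 + y) powr (\<Sum>j\<in>I. - \<alpha> j)"
  proof (rule H_bound[of "{0..}" "\<lambda>y. Complex 0 (- y)" "\<lambda>y. 1 + y" "\<lambda>j. - \<alpha> j"])
    fix j assume "j \<in> I"
    from gauss_laplace_axis_bound[OF \<alpha>_pos[OF this]]
    show "\<exists>C\<ge>0. \<forall>y\<in>{0..}. cmod (gauss_laplace (\<alpha> j) (Complex 0 (- y))) \<le> C * (1 + y) powr (- \<alpha> j)"
      by (simp only: Ball_def atLeast_iff)
  qed auto
  then show ?thesis by (simp only: Ball_def atLeast_iff A_def sum_negf)
qed

lemma H_strip_bound: "\<exists>C\<ge>0. \<forall>u R. 0 \<le> u \<longrightarrow> u \<le> R \<longrightarrow> 2 \<le> R \<longrightarrow> cmod (H (Complex u (- R))) \<le> C * (1 + u) powr A"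
proof -
  define T where "T = {x :: real \<times> real. 0 \<le> fst x \<and> fst x \<le> snd x \<and> 2 \<le> snd x}"
  have "\<exists>C\<ge>0. \<forall>x\<in>T. cmod (H (Complex (fst x) (- snd x))) \<le> C * (1 + fst x) powr (\<Sum>j\<in>I. \<alpha> j)"
  proof (rule H_bound[of T "\<lambda>x. Complex (fst x) (- snd x)" "\<lambda>x. 1 + fst x" \<alpha>])
    fix j assume "j \<in> I"
    then obtain C where C: "C \<ge> 0" "\<And>u R. 0 \<le> u \<Longrightarrow> u \<le> R \<Longrightarrow> 2 \<le> R \<Longrightarrow> cmod (gauss_laplace (\<alpha> j) (Complex u (- R))) \<le> C * (1 + u) powr \<alpha> j"
      using gauss_laplace_strip_bound[OF \<alpha>_pos] by blast
    show "\<exists>C\<ge>0. \<forall>x\<in>T. cmod (gauss_laplace (\<alpha> j) (Complex (fst x) (- snd x))) \<le> C * (1 + fst x) powr \<alpha> j"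
      using C(1) by (intro exI[of _ C] conjI ballI C(2)) (simp_all add: T_def)
  qed (simp add: T_def)
  then obtain C where C: "C \<ge> 0" "\<And>x. x \<in> T \<Longrightarrow> cmod (H (Complex (fst x) (- snd x))) \<le> C * (1 + fst x) powr A"
    unfolding A_def by blast
  have "cmod (H (Complex u (- R))) \<le> C * (1 + u) powr A" if "0 \<le> u" "u \<le> R" "2 \<le> R" for u R
    using C(2)[of "(u, R)"] that by (simp add: T_def)
  with C(1) show ?thesis by blast
qed

lemma H_strip_limit:
  assumes "u \<ge> 0"
  shows "((\<lambda>R. H (Complex u (- R))) \<longlongrightarrow> 0) at_top"
proof -
  have "((\<lambda>R. H (Complex u (- R))) \<longlongrightarrow> (\<Prod>j\<in>I. 0 / of_real (Gamma (\<alpha> j)))) at_top"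
    unfolding H_def divide_inverse
    by (intro tendsto_prod tendsto_mult tendsto_const gauss_laplace_strip_limit \<alpha>_pos assms)
  also have "(\<Prod>j\<in>I. 0 / of_real (Gamma (\<alpha> j))) = (0::complex)"
    using I by (simp add: card_gt_0_iff)
  finally show ?thesis .
qed

end

section \<open>Superpositions of exponentials\<close>

lemma gamma_law_gauss_laplace:
  assumes "a > 0"
  shows "integrable (gamma_law a) (\<lambda>t. exp (of_real t - of_real (t\<^sup>2) / 2 + z * of_real t) :: complex)"
    and "(CLINT t|gamma_law a. exp (of_real t - of_real (t\<^sup>2) / 2 + z * of_real t)) = gauss_laplace a z / of_real (Gamma a)"
proof -
  have eq: "gamma_density a t *\<^sub>R exp (of_real t - of_real (t\<^sup>2) / 2 + z * of_real t)
    = (indicator {0<..} t *\<^sub>R (of_real (t powr (a - 1)) * exp (z * of_real t - of_real (t\<^sup>2) / 2))) / of_real (Gamma a)" for t :: real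
  proof -
    have "of_real (exp (- t)) * exp (of_real t - of_real (t\<^sup>2) / 2 + z * of_real t) = exp (z * of_real t - of_real (t\<^sup>2) / 2)"
      unfolding exp_of_real[symmetric] mult_exp_exp by (simp add: algebra_simps)
    then show ?thesis
      by (simp add: gamma_density_eq scaleR_conv_of_real mult_ac)
  qed
  have nn: "AE t in lborel. 0 \<le> gamma_density a t" using gamma_density_nonneg[OF assms] by auto
  have "integrable lborel (\<lambda>t. gamma_density a t *\<^sub>R exp (of_real t - of_real (t\<^sup>2) / 2 + z * of_real t))"
    unfolding eq using gauss_laplace_integrable[OF assms, of z, unfolded set_integrable_def] by (rule integrable_divide)
  then show "integrable (gamma_law a) (\<lambda>t. exp (of_real t - of_real (t\<^sup>2) / 2 + z * of_real t) :: complex)"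
    by (subst integrable_density[OF _ _ nn]) auto
  have "(CLINT t|gamma_law a. exp (of_real t - of_real (t\<^sup>2) / 2 + z * of_real t))
      = (CLINT t|lborel. gamma_density a t *\<^sub>R exp (of_real t - of_real (t\<^sup>2) / 2 + z * of_real t))"
    by (rule integral_density[OF _ _ nn]) auto
  then show "(CLINT t|gamma_law a. exp (of_real t - of_real (t\<^sup>2) / 2 + z * of_real t)) = gauss_laplace a z / of_real (Gamma a)"
    unfolding eq gauss_laplace_def set_lebesgue_integral_def by (simp only: integral_divide_zero)
qed

lemma set_integral_Ici_Ioi:
  fixes f :: "real \<Rightarrow> 'b::{banach, second_countable_topology}"
  assumes [measurable]: "f \<in> borel_measurable borel"
  shows "(LINT x:{0..}|lborel. f x) = (LINT x:{0<..}|lborel. f x)"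
  unfolding set_lebesgue_integral_def
proof (rule integral_cong_AE)
  show "AE x in lborel. indicator {0..} x *\<^sub>R f x = indicator {0<..} x *\<^sub>R f x"
    using AE_lborel_singleton[of 0] by eventually_elim (auto simp: indicator_def)
qed measurable

lemma set_integrable_powr_decay:
  assumes "p > 1"
  shows "set_integrable lborel {0..} (\<lambda>y::real. (1 + y) powr (- p))"
proof -
  have "(\<integral>\<^sup>+x. ennreal ((1 + x) powr (- p)) * indicator {0..} x \<partial>lborel)
      = ennreal (0 - 1 / (1 - p) * (1 + 0) powr (1 - p))"
  proof (rule nn_integral_FTC_atLeast[where F = "\<lambda>x. 1 / (1 - p) * (1 + x) powr (1 - p)"])
    fix x :: real assume "0 \<le> x"
    then have "((\<lambda>x. (1 + x) powr (1 - p)) has_real_derivative (1 - p) * (1 + x) powr (- p)) (at x)"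
      by (auto intro!: derivative_eq_intros)
    from DERIV_cmult[OF this, of "1 / (1 - p)"]
    show "((\<lambda>x. 1 / (1 - p) * (1 + x) powr (1 - p)) has_real_derivative (1 + x) powr (- p)) (at x)"
      using assms by simp
  next
    have "((\<lambda>x. (1 + x) powr (1 - p)) \<longlongrightarrow> 0) at_top"
      using assms by real_asymp
    then show "((\<lambda>x. 1 / (1 - p) * (1 + x) powr (1 - p)) \<longlongrightarrow> 0) at_top"
      by (rule tendsto_mult_right_zero)
  qed auto
  moreover have "(\<integral>\<^sup>+x. ennreal ((1 + x) powr (- p)) * indicator {0..} x \<partial>lborel)
      = (\<integral>\<^sup>+x. ennreal (norm (indicator {0..} x *\<^sub>R (1 + x) powr (- p))) \<partial>lborel)"
    by (intro nn_integral_cong) (auto simp: indicator_def)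
  ultimately show ?thesis
    unfolding set_integrable_def integrable_iff_bounded by simp
qed

text \<open>
Each exponential \<open>e\<^bsup>(r-k)z\<^esup>\<close> has a primitive \<open>\<phi> r\<close>, and the integral over \<open>r\<close> may be taken last.
\<close>
lemma exp_segment_superposition:
  fixes \<rho> :: "real \<Rightarrow> real" and k :: real
  assumes \<rho>: "\<And>u. integrable lborel (\<lambda>r. \<rho> r * exp (u * r))" and [measurable]: "\<rho> \<in> borel_measurable borel" and "\<beta> \<ge> 0"
    and \<phi>: "\<And>r z. (\<phi> r has_field_derivative exp (of_real (r - k) * z)) (at z)"
  shows "integrable lborel (\<lambda>r. of_real (\<rho> r) * (\<phi> r (c + of_real \<beta> * d) - \<phi> r c))"
    and "(CLINT \<tau>:{0..\<beta>}|lborel. d * (CLINT r|lborel. of_real (\<rho> r) * exp (of_real (r - k) * (c + of_real \<tau> * d))))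
      = (CLINT r|lborel. of_real (\<rho> r) * (\<phi> r (c + of_real \<beta> * d) - \<phi> r c))"
proof -
  let ?e = "\<lambda>r \<tau>. exp (of_real (r - k) * (c + of_real \<tau> * d))"
  define h where "h \<tau> r = indicator {0..\<beta>} \<tau> *\<^sub>R (d * (of_real (\<rho> r) * (?e r \<tau>)))" for \<tau> r :: real
  define M where "M = cmod c + \<beta> * cmod d"
  have [measurable]: "case_prod h \<in> borel_measurable (lborel \<Otimes>\<^sub>M lborel)"
    unfolding h_def split_beta' by measurable
  have 1: "integrable lborel (\<lambda>\<tau>. indicator {0..\<beta>} \<tau> *\<^sub>R cmod d)"
    by (intro integrable_scaleR_left integrable_real_indicator) (auto simp: emeasure_lborel_Icc_eq)
  have 2: "integrable lborel (\<lambda>r. exp (\<bar>k\<bar> * M) * (\<bar>\<rho> r * exp (M * r)\<bar> + \<bar>\<rho> r * exp (- M * r)\<bar>))"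
    by (intro integrable_mult_right Bochner_Integration.integrable_add integrable_abs \<rho>)
  have int: "integrable (lborel \<Otimes>\<^sub>M lborel) (case_prod h)"
  proof (rule lborel_pair.integrable_pair_bound[OF _ 1 2])
    show "AE \<tau> in lborel. AE r in lborel. norm (case (\<tau>, r) of (\<tau>, r) \<Rightarrow> h \<tau> r)
      \<le> (indicator {0..\<beta>} \<tau> *\<^sub>R cmod d) * (exp (\<bar>k\<bar> * M) * (\<bar>\<rho> r * exp (M * r)\<bar> + \<bar>\<rho> r * exp (- M * r)\<bar>))"
    proof (intro AE_I2)
      fix \<tau> r :: real
      show "norm (case (\<tau>, r) of (\<tau>, r) \<Rightarrow> h \<tau> r)
        \<le> (indicator {0..\<beta>} \<tau> *\<^sub>R cmod d) * (exp (\<bar>k\<bar> * M) * (\<bar>\<rho> r * exp (M * r)\<bar> + \<bar>\<rho> r * exp (- M * r)\<bar>))"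
      proof (cases "\<tau> \<in> {0..\<beta>}")
        case True
        define y where "y = Re (c + of_real \<tau> * d)"
        have "\<bar>y\<bar> \<le> cmod c + \<tau> * cmod d"
          unfolding y_def using True order_trans[OF abs_Re_le_cmod norm_triangle_ineq, of c "of_real \<tau> * d"]
          by (simp add: norm_mult)
        also have "\<dots> \<le> M" using True by (auto simp: M_def intro: mult_right_mono)
        finally have y: "\<bar>y\<bar> \<le> M" .
        have "(r - k) * y \<le> \<bar>k\<bar> * M + \<bar>r\<bar> * M"
        proof -
          have "(r - k) * y \<le> \<bar>r - k\<bar> * \<bar>y\<bar>" by (simp flip: abs_mult)
          also have "\<dots> \<le> (\<bar>k\<bar> + \<bar>r\<bar>) * M" using y by (intro mult_mono) auto
          finally show ?thesis by (simp add: algebra_simps)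
        qed
        then have "exp ((r - k) * y) \<le> exp (\<bar>k\<bar> * M) * exp (\<bar>r\<bar> * M)"
          by (simp add: mult_exp_exp)
        also have "\<dots> \<le> exp (\<bar>k\<bar> * M) * (exp (M * r) + exp (- M * r))"
          by (intro mult_left_mono) (auto simp: abs_if mult.commute)
        finally have "\<bar>\<rho> r\<bar> * exp ((r - k) * y) \<le> \<bar>\<rho> r\<bar> * (exp (\<bar>k\<bar> * M) * (exp (M * r) + exp (- M * r)))"
          by (rule mult_left_mono) auto
        then have "cmod d * (\<bar>\<rho> r\<bar> * exp ((r - k) * y)) \<le> cmod d * (\<bar>\<rho> r\<bar> * (exp (\<bar>k\<bar> * M) * (exp (M * r) + exp (- M * r))))"
          by (rule mult_left_mono) auto
        then show ?thesis
          using True by (simp add: h_def norm_mult y_def abs_mult algebra_simps)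
      qed (simp add: h_def)
    qed
  qed measurable
  have inner: "(CLINT \<tau>|lborel. h \<tau> r) = of_real (\<rho> r) * (\<phi> r (c + of_real \<beta> * d) - \<phi> r c)" for r
  proof -
    have cont: "continuous_on UNIV (\<lambda>z. exp (of_real (r - k) * z :: complex))" by (intro continuous_intros)
    have "(CLINT \<tau>:{0..\<beta>}|lborel. d * (?e r \<tau>)) = \<phi> r (c + of_real \<beta> * d) - \<phi> r (c + of_real 0 * d)"
      by (rule segment_integral[OF \<open>\<beta> \<ge> 0\<close> cont]) (simp_all add: \<phi> del: of_real_diff)
    then have eq: "(CLINT \<tau>|lborel. indicator {0..\<beta>} \<tau> *\<^sub>R (d * (?e r \<tau>))) = \<phi> r (c + of_real \<beta> * d) - \<phi> r c"
      by (simp only: set_lebesgue_integral_def of_real_0 mult_zero_left add_0_right)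
    have "h \<tau> r = of_real (\<rho> r) * (indicator {0..\<beta>} \<tau> *\<^sub>R (d * (?e r \<tau>)))" for \<tau>
      by (simp add: h_def mult_ac scaleR_conv_of_real)
    then have "(CLINT \<tau>|lborel. h \<tau> r) = (CLINT \<tau>|lborel. of_real (\<rho> r) * (indicator {0..\<beta>} \<tau> *\<^sub>R (d * (?e r \<tau>))))"
      by presburger
    also have "\<dots> = of_real (\<rho> r) * (CLINT \<tau>|lborel. indicator {0..\<beta>} \<tau> *\<^sub>R (d * (?e r \<tau>)))"
      by (rule integral_mult_right_zero)
    finally show ?thesis unfolding eq .
  qed
  show "integrable lborel (\<lambda>r. of_real (\<rho> r) * (\<phi> r (c + of_real \<beta> * d) - \<phi> r c))"
    using lborel_pair.integrable_snd[OF int] unfolding inner .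
  have "(CLINT r|lborel. of_real (\<rho> r) * (\<phi> r (c + of_real \<beta> * d) - \<phi> r c)) = (CLINT r|lborel. CLINT \<tau>|lborel. h \<tau> r)"
    unfolding inner ..
  also have "\<dots> = (CLINT \<tau>|lborel. CLINT r|lborel. h \<tau> r)"
    by (rule lborel_pair.Fubini_integral[OF int])
  also have "\<dots> = (CLINT \<tau>:{0..\<beta>}|lborel. d * (CLINT r|lborel. of_real (\<rho> r) * (?e r \<tau>)))"
    unfolding h_def set_lebesgue_integral_def integral_scaleR_right integral_mult_right_zero ..
  finally show "(CLINT \<tau>:{0..\<beta>}|lborel. d * (CLINT r|lborel. of_real (\<rho> r) * (?e r \<tau>)))
      = (CLINT r|lborel. of_real (\<rho> r) * (\<phi> r (c + of_real \<beta> * d) - \<phi> r c))" by simp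
qed

text \<open>
Cauchy's theorem on the triangle with vertices \<open>0\<close>, \<open>-iR\<close> and \<open>R - iR\<close>. For a superposition of
exponentials it reduces to an identity between differences of primitives of the single exponentials.
\<close>
lemma exp_superposition_triangle:
  fixes \<rho> :: "real \<Rightarrow> real" and k R :: real
  assumes \<rho>: "\<And>u. integrable lborel (\<lambda>r. \<rho> r * exp (u * r))" and [measurable]: "\<rho> \<in> borel_measurable borel" and "R \<ge> 0"
  defines "F \<equiv> \<lambda>z. CLINT r|lborel. of_real (\<rho> r) * exp (of_real (r - k) * z)"
  shows "(CLINT \<tau>:{0..R}|lborel. (1 - \<i>) * F (Complex \<tau> (- \<tau>)))
    = (CLINT \<tau>:{0..R}|lborel. (- \<i>) * F (Complex 0 (- \<tau>))) + (CLINT \<tau>:{0..R}|lborel. F (Complex \<tau> (- R)))"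
proof -
  define \<phi> where "\<phi> r z = (if r = k then z else (exp (of_real (r - k) * z) - 1) / of_real (r - k))" for r and z :: complex
  have \<phi>: "(\<phi> r has_field_derivative exp (of_real (r - k) * z)) (at z)" for r z
  proof (cases "r = k")
    case True
    then show ?thesis by (simp add: \<phi>_def[abs_def])
  next
    case False
    then have "of_real (r - k) \<noteq> (0::complex)" by simp
    then have "((\<lambda>z. (exp (of_real (r - k) * z) - 1) / of_real (r - k)) has_field_derivative exp (of_real (r - k) * z)) (at z)"
      by (auto intro!: derivative_eq_intros simp del: of_real_diff)
    moreover have "\<phi> r = (\<lambda>z. (exp (of_real (r - k) * z) - 1) / of_real (r - k))"
      using False by (simp add: \<phi>_def[abs_def])
    ultimately show ?thesis by simp
  qed
  note seg = exp_segment_superposition[OF \<rho> assms(2) \<open>R \<ge> 0\<close>, of \<phi>, OF \<phi>]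
  have e1: "0 + of_real \<tau> * (1 - \<i>) = Complex \<tau> (- \<tau>)"
    and e2: "0 + of_real \<tau> * (- \<i>) = Complex 0 (- \<tau>)"
    and e3: "Complex 0 (- R) + of_real \<tau> * 1 = Complex \<tau> (- R)" for \<tau>
    by (simp_all add: complex_eq_iff)
  have 1: "(CLINT \<tau>:{0..R}|lborel. (1 - \<i>) * F (Complex \<tau> (- \<tau>))) = (CLINT r|lborel. of_real (\<rho> r) * (\<phi> r (Complex R (- R)) - \<phi> r 0))"
    using seg(2)[where c = 0 and d = "1 - \<i>"] by (simp only: F_def e1)
  have 2: "(CLINT \<tau>:{0..R}|lborel. (- \<i>) * F (Complex 0 (- \<tau>))) = (CLINT r|lborel. of_real (\<rho> r) * (\<phi> r (Complex 0 (- R)) - \<phi> r 0))"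
    using seg(2)[where c = 0 and d = "- \<i>"] by (simp only: F_def e2)
  have int2: "integrable lborel (\<lambda>r. of_real (\<rho> r) * (\<phi> r (Complex 0 (- R)) - \<phi> r 0))"
    using seg(1)[where c = 0 and d = "- \<i>"] by (simp only: e2)
  have 3: "(CLINT \<tau>:{0..R}|lborel. F (Complex \<tau> (- R))) = (CLINT r|lborel. of_real (\<rho> r) * (\<phi> r (Complex R (- R)) - \<phi> r (Complex 0 (- R))))"
    using seg(2)[where c = "Complex 0 (- R)" and d = 1] by (simp only: F_def e3 mult_1_left)
  have int3: "integrable lborel (\<lambda>r. of_real (\<rho> r) * (\<phi> r (Complex R (- R)) - \<phi> r (Complex 0 (- R))))"
    using seg(1)[where c = "Complex 0 (- R)" and d = 1] by (simp only: e3)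
  show ?thesis
    unfolding 1 2 3 Bochner_Integration.integral_add[OF int2 int3, symmetric] by (simp add: algebra_simps)
qed

context gamma_vector
begin

lemma V_eq: "V t = (\<Sum>j\<in>I. (t j)\<^sup>2) / (S t)\<^sup>2"
  by (simp add: V_def power_int_minus divide_inverse)

lemma V_nonneg: "0 \<le> V t"
  unfolding V_eq by (intro divide_nonneg_nonneg sum_nonneg) auto

text \<open>
Cauchy-Schwarz; the bound gives \<open>\<rho>\<close> Gaussian decay.
\<close>
lemma AE_V_lower: "AE t in N. 1 / real (card I) \<le> V t"
  using AE_S_pos
proof eventually_elim
  case (elim t)
  have "(S t)\<^sup>2 \<le> (\<Sum>j\<in>I. (t j)\<^sup>2) * card I"
    unfolding S_def by (rule sum_squared_le_sum_of_squares)
  moreover have "card I > 0" using I by (simp add: card_gt_0_iff)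
  ultimately show ?case using elim by (simp add: V_eq field_simps)
qed

lemma H_expectation:
  "integrable N (\<lambda>t. exp (of_real (S t) - of_real ((S t)\<^sup>2 * V t) / 2 + z * of_real (S t)) :: complex)"
  "H z = (CLINT t|N. exp (of_real (S t) - of_real ((S t)\<^sup>2 * V t) / 2 + z * of_real (S t)))"
proof -
  let ?E = "\<lambda>t. exp (of_real (S t) - of_real ((S t)\<^sup>2 * V t) / 2 + z * of_real (S t))"
  define e where "e t = exp (of_real t - of_real (t\<^sup>2) / 2 + z * of_real t)" for t :: real
  have e: "integrable (P j) e" "(CLINT t|P j. e t) = gauss_laplace (\<alpha> j) z / of_real (Gamma (\<alpha> j))" if "j \<in> I" for j
    unfolding P_def e_def[abs_def] using that gamma_law_gauss_laplace[OF \<alpha>_pos[OF that]] by auto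
  have ae: "AE t in N. (\<Prod>j\<in>I. e (t j)) = (?E t)"
    using AE_S_pos
  proof eventually_elim
    case (elim t)
    have "(S t)\<^sup>2 * V t = (\<Sum>j\<in>I. (t j)\<^sup>2)" using elim by (simp add: V_eq)
    then show ?case
      unfolding e_def exp_sum[OF I(1), symmetric]
      by (simp add: S_def sum.distrib sum_subtractf sum_divide_distrib sum_distrib_left)
  qed
  have int: "integrable N (\<lambda>t. \<Prod>j\<in>I. e (t j))"
    unfolding N_P using e by (intro N.product_integrable_prod I) auto
  have [measurable]: "e \<in> borel_measurable borel" unfolding e_def[abs_def] by measurable
  show "integrable N (\<lambda>t. (?E t))"
    using ae by (intro integrable_cong_AE_imp[OF int]) auto
  have "H z = (CLINT t|N. \<Prod>j\<in>I. e (t j))"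
    unfolding N_P using e by (subst N.product_integral_prod[OF I(1)]) (auto simp: H_def)
  also have "\<dots> = (CLINT t|N. (?E t))"
    using ae borel_measurable_integrable[OF int] by (intro integral_cong_AE) auto
  finally show "H z = (CLINT t|N. (?E t))" .
qed

definition L :: "real \<Rightarrow> real" where
  "L r = (LINT t|N. exp (- (r\<^sup>2 * V t) / 2))"

definition \<rho> :: "real \<Rightarrow> real" where
  "\<rho> r = indicator {0<..} r * (r powr (A - 1) / Gamma A) * L r"

lemma L_measurable [measurable]: "L \<in> borel_measurable borel"
  unfolding L_def[abs_def] by measurable

lemma \<rho>_measurable [measurable]: "\<rho> \<in> borel_measurable borel"
  unfolding \<rho>_def[abs_def] by measurable

lemma L_nonneg: "0 \<le> L r"
  unfolding L_def by (rule Bochner_Integration.integral_nonneg) simp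

lemma \<rho>_nonneg: "0 \<le> \<rho> r"
  unfolding \<rho>_def using Gamma_real_pos[OF A_pos] L_nonneg by simp

text \<open>
By independence \<open>H(z) = E exp(S - S\<^sup>2V/2 + zS)\<close>, since \<open>S\<^sup>2V\<close> is the sum of the squares. Under the
polar decomposition the factor \<open>e\<^bsup>S\<^esup>\<close> cancels the exponential in the gamma density of \<open>S\<close>.
\<close>
lemma H_superposition:
  "integrable lborel (\<lambda>r. of_real (\<rho> r) * exp (z * of_real r))"
  "H z = (CLINT r|lborel. of_real (\<rho> r) * exp (z * of_real r))"
proof -
  define g where "g v r = exp (of_real r - of_real (r\<^sup>2 * v) / 2 + z * of_real r)" for v r :: real
  have [measurable]: "case_prod g \<in> borel_measurable (borel \<Otimes>\<^sub>M borel)"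
    unfolding g_def split_beta' by measurable
  interpret G: prob_space "gamma_law A" by (rule prob_space_gamma_law[OF A_pos])
  interpret D: prob_space "distr N borel V" by (rule N.prob_space_distr) measurable
  interpret DG: pair_sigma_finite "distr N borel V" "gamma_law A" ..
  have int: "integrable (distr N borel V \<Otimes>\<^sub>M gamma_law A) (case_prod g)"
    unfolding polar_law[symmetric] using H_expectation(1)[of z]
    by (subst integrable_distr_eq) (auto simp: g_def)
  have inner: "(CLINT v|distr N borel V. g v r) = exp (of_real r + z * of_real r) * of_real (L r)" for r
  proof -
    have "(CLINT v|distr N borel V. g v r) = (CLINT t|N. g (V t) r)"
      unfolding g_def by (rule integral_distr) auto
    also have "\<dots> = (CLINT t|N. exp (of_real r + z * of_real r) * of_real (exp (- (r\<^sup>2 * V t) / 2)))"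
      unfolding g_def exp_of_real[symmetric] mult_exp_exp
      by (intro Bochner_Integration.integral_cong) (auto simp: algebra_simps)
    also have "\<dots> = exp (of_real r + z * of_real r) * (CLINT t|N. of_real (exp (- (r\<^sup>2 * V t) / 2)))"
      by (rule integral_mult_right_zero)
    finally show ?thesis by (simp add: L_def integral_complex_of_real)
  qed
  have nn: "AE r in lborel. 0 \<le> gamma_density A r" using gamma_density_nonneg[OF A_pos] by auto
  have weight: "gamma_density A r *\<^sub>R (exp (of_real r + z * of_real r) * of_real (L r)) = of_real (\<rho> r) * exp (z * of_real r)" for r
  proof -
    have "of_real (exp (- r)) * exp (of_real r + z * of_real r) = exp (z * of_real r)"
      unfolding exp_of_real[symmetric] mult_exp_exp by simp
    then show ?thesis
      by (simp add: gamma_density_eq \<rho>_def scaleR_conv_of_real mult_ac)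
  qed
  have "integrable (gamma_law A) (\<lambda>r. exp (of_real r + z * of_real r) * of_real (L r))"
    using DG.integrable_snd[OF int] unfolding inner .
  then show "integrable lborel (\<lambda>r. of_real (\<rho> r) * exp (z * of_real r))"
    by (subst (asm) integrable_density[OF _ _ nn]) (simp_all add: weight)
  have "H z = (CLINT t|N. case_prod g (V t, S t))"
    unfolding H_expectation(2) g_def by simp
  also have "\<dots> = integral\<^sup>L (distr N (borel \<Otimes>\<^sub>M borel) (\<lambda>t. (V t, S t))) (case_prod g)"
    by (rule integral_distr[symmetric]) auto
  also have "\<dots> = (CLINT r|gamma_law A. CLINT v|distr N borel V. g v r)"
    unfolding polar_law by (rule DG.integral_snd[OF int, symmetric])
  also have "\<dots> = (CLINT r|lborel. of_real (\<rho> r) * exp (z * of_real r))"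
    unfolding inner by (subst integral_density[OF _ _ nn]) (simp_all add: weight)
  finally show "H z = (CLINT r|lborel. of_real (\<rho> r) * exp (z * of_real r))" .
qed

lemma \<rho>_exp_integrable: "integrable lborel (\<lambda>r. \<rho> r * exp (u * r))"
proof -
  have "integrable lborel (\<lambda>r. norm (of_real (\<rho> r) * exp (of_real u * of_real r) :: complex))"
    by (intro integrable_norm H_superposition)
  then show ?thesis using \<rho>_nonneg by (simp add: norm_mult)
qed

lemma H_laplace_kernel: "H z * exp (- (of_real k * z)) = (CLINT r|lborel. of_real (\<rho> r) * exp (of_real (r - k) * z))"
proof -
  have "H z * exp (- (of_real k * z)) = (CLINT r|lborel. (of_real (\<rho> r) * exp (z * of_real r)) * exp (- (of_real k * z)))"
    unfolding H_superposition(2) by (rule integral_mult_left_zero[symmetric])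
  then show ?thesis
    by (simp add: mult.assoc mult_exp_exp algebra_simps)
qed

end

section \<open>From the ray to the imaginary axis\<close>

lemma measurable_Complex [measurable (raw)]:
  assumes [measurable]: "f \<in> borel_measurable M" "g \<in> borel_measurable M"
  shows "(\<lambda>x. Complex (f x) (g x)) \<in> borel_measurable M"
  unfolding Complex_eq by measurable

lemma integrable_even:
  fixes g :: "real \<Rightarrow> real"
  assumes "set_integrable lborel {0..} g" and [simp]: "\<And>y. g (- y) = g y" and [measurable]: "g \<in> borel_measurable borel"
  shows "integrable lborel g"
proof -
  have 1: "integrable lborel (\<lambda>y. indicator {0..} y *\<^sub>R g y)"
    using assms(1) by (simp add: set_integrable_def)
  have "integrable lborel (\<lambda>y. indicator {0..} (0 + (-1) * y) *\<^sub>R g (0 + (-1) * y))"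
    by (rule lborel_integrable_real_affine[OF 1]) simp
  from Bochner_Integration.integrable_add[OF integrable_abs[OF 1] integrable_abs[OF this]] show ?thesis
    by (rule Bochner_Integration.integrable_bound) (auto simp: indicator_def)
qed

context gamma_vector
begin

lemma ray_Complex: "ray (sqrt 2 * \<tau>) = Complex \<tau> (- \<tau>)"
  by (simp add: ray_def)

lemma H_axis_integrable:
  assumes "A > 1"
  shows "integrable lborel (\<lambda>y. H (Complex 0 (- y)))"
proof -
  obtain C where C: "C \<ge> 0" "\<And>y. y \<ge> 0 \<Longrightarrow> cmod (H (Complex 0 (- y))) \<le> C * (1 + y) powr (- A)"
    using H_axis_bound by blast
  have "integrable lborel (\<lambda>y. (1 + \<bar>y\<bar>) powr (- A))"
  proof (rule integrable_even)
    show "set_integrable lborel {0..} (\<lambda>y. (1 + \<bar>y\<bar>) powr (- A))"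
      using set_integrable_powr_decay[OF assms] by (rule set_integrable_cong[THEN iffD1, rotated -1]) auto
  qed auto
  then have dom: "integrable lborel (\<lambda>y. C * (1 + \<bar>y\<bar>) powr (- A))" by simp
  show ?thesis
  proof (rule Bochner_Integration.integrable_bound[OF dom])
    have "cmod (H (Complex 0 (- y))) \<le> C * (1 + \<bar>y\<bar>) powr (- A)" for y
    proof (cases "y \<ge> 0")
      case False
      have "H (Complex 0 (- y)) = cnj (H (Complex 0 (- (- y))))"
        by (simp add: H_cnj[symmetric] complex_cnj)
      then have "cmod (H (Complex 0 (- y))) = cmod (H (Complex 0 (- (- y))))"
        by (simp only: complex_mod_cnj)
      then show ?thesis using C(2)[of "- y"] False by simp
    qed (use C in auto)
    then show "AE y in lborel. norm (H (Complex 0 (- y))) \<le> norm (C * (1 + \<bar>y\<bar>) powr (- A))"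
      using C(1) by auto
  qed measurable
qed

text \<open>
The sides of the triangle tend to the ray and to the imaginary axis, and the third side tends to \<open>0\<close>.
The factor \<open>e\<^bsup>-kz\<^esup>\<close> makes the integral along the ray converge; along the axis it only has modulus one
and the decay of \<open>H\<close> is needed. The quotient
of the directions \<open>-i\<close> and \<open>e\<^bsup>-i\<pi>/4\<^esup>\<close> is \<open>e\<^bsup>-i\<pi>/4\<^esup>\<close>, which \<open>csqrt \<i>\<close>
cancels.
\<close>
lemma H_rotate:
  assumes "A > 1" "k > 0"
  shows "csqrt \<i> * (CLINT s:{0<..}|lborel. H (ray s) * exp (- (of_real k * ray s)))
    = (CLINT y:{0<..}|lborel. H (Complex 0 (- y)) * iexp (k * y))"
proof -
  define F where "F z = H z * exp (- (of_real k * z))" for z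
  have F: "F = (\<lambda>z. CLINT r|lborel. of_real (\<rho> r) * exp (of_real (r - k) * z))"
    by (simp add: F_def[abs_def] H_laplace_kernel)
  let ?ray_F = "\<lambda>\<tau>. F (Complex \<tau> (- \<tau>))"
  let ?axis_F = "\<lambda>\<tau>. F (Complex 0 (- \<tau>))"
  have [measurable]: "F \<in> borel_measurable borel" unfolding F_def[abs_def] by measurable
  have norm_F: "cmod (F (Complex u v)) = cmod (H (Complex u v)) * exp (- (k * u))" for u v
    by (simp add: F_def norm_mult)
  have axis_F: "F (Complex 0 (- y)) = H (Complex 0 (- y)) * iexp (k * y)" for y
    by (simp add: F_def Complex_eq mult_ac)
  have triangle: "(CLINT \<tau>:{0..R}|lborel. (1 - \<i>) * (?ray_F \<tau>))
    = (CLINT \<tau>:{0..R}|lborel. (- \<i>) * (?axis_F \<tau>)) + (CLINT \<tau>:{0..R}|lborel. F (Complex \<tau> (- R)))" if "R \<ge> 0" for R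
    unfolding F by (rule exp_superposition_triangle[OF \<rho>_exp_integrable _ that]) measurable

  have ray_int: "set_integrable lborel {0..} (\<lambda>\<tau>. (1 - \<i>) * (?ray_F \<tau>))"
  proof -
    define e where "e = (\<Sum>j\<in>I. max (\<alpha> j - 1) (- \<alpha> j))"
    obtain C where C: "C \<ge> 0" "\<And>s. s \<ge> 0 \<Longrightarrow> cmod (H (ray s)) \<le> C * (1 + s) powr e"
      using H_ray_bound unfolding e_def by blast
    have "set_integrable lborel {0..} (\<lambda>\<tau>. (?ray_F \<tau>))"
    proof (rule set_integrable_bound)
      show "set_integrable lborel {0..} (\<lambda>\<tau>. C * ((1 + sqrt 2 * \<tau>) powr (\<bar>e\<bar> + 1) * exp (- (k * \<tau>))))"
        using assms by (intro set_integrable_mult_right set_integrable_poly_exp) auto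
      show "set_borel_measurable lborel {0..} (\<lambda>\<tau>. (?ray_F \<tau>))"
        unfolding set_borel_measurable_def by measurable
      have "cmod (?ray_F \<tau>) \<le> C * ((1 + sqrt 2 * \<tau>) powr (\<bar>e\<bar> + 1) * exp (- (k * \<tau>)))" if "\<tau> \<ge> 0" for \<tau>
      proof -
        have "cmod (H (Complex \<tau> (- \<tau>))) \<le> C * (1 + sqrt 2 * \<tau>) powr e"
          using C(2)[of "sqrt 2 * \<tau>"] that by (simp add: ray_Complex)
        also have "\<dots> \<le> C * (1 + sqrt 2 * \<tau>) powr (\<bar>e\<bar> + 1)"
          using C(1) that by (intro mult_left_mono powr_mono) auto
        finally have "cmod (H (Complex \<tau> (- \<tau>))) * exp (- (k * \<tau>)) \<le> (C * (1 + sqrt 2 * \<tau>) powr (\<bar>e\<bar> + 1)) * exp (- (k * \<tau>))"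
          by (rule mult_right_mono) simp
        then show ?thesis unfolding norm_F by (simp only: mult.assoc)
      qed
      then show "AE \<tau> in lborel. \<tau> \<in> {0..} \<longrightarrow> norm (?ray_F \<tau>) \<le> norm (C * ((1 + sqrt 2 * \<tau>) powr (\<bar>e\<bar> + 1) * exp (- (k * \<tau>))))"
        using C(1) by (intro AE_I2 impI) (simp add: abs_mult)
    qed
    then show ?thesis by (rule set_integrable_mult_right)
  qed
  have axis_int: "set_integrable lborel {0..} (\<lambda>\<tau>. (- \<i>) * (?axis_F \<tau>))"
  proof (rule set_integrable_mult_right)
    show "set_integrable lborel {0..} (\<lambda>\<tau>. (?axis_F \<tau>))"
    proof (rule set_integrable_bound)
      show "set_integrable lborel {0..} (\<lambda>y. H (Complex 0 (- y)))"
        unfolding set_integrable_def by (rule integrable_mult_indicator[OF _ H_axis_integrable[OF assms(1)]]) simp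
      show "set_borel_measurable lborel {0..} (\<lambda>\<tau>. (?axis_F \<tau>))"
        unfolding set_borel_measurable_def by measurable
    qed (simp add: norm_F)
  qed
  \<comment> \<open>The bound on the third side requires \<open>R \<ge> 2\<close>.\<close>
  define R where "R n = real n + 2" for n
  have R: "filterlim R at_top sequentially" unfolding R_def by real_asymp
  have top: "(\<lambda>n. CLINT \<tau>:{0..R n}|lborel. F (Complex \<tau> (- R n))) \<longlonglongrightarrow> integral\<^sup>L lborel (\<lambda>_::real. 0)"
  proof -
    obtain C where C: "C \<ge> 0" "\<And>u R. 0 \<le> u \<Longrightarrow> u \<le> R \<Longrightarrow> 2 \<le> R \<Longrightarrow> cmod (H (Complex u (- R))) \<le> C * (1 + u) powr A"
      using H_strip_bound by blast
    show ?thesis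
      unfolding set_lebesgue_integral_def
    proof (rule integral_dominated_convergence[where w = "\<lambda>\<tau>. indicator {0..} \<tau> *\<^sub>R (C * ((1 + 1 * \<tau>) powr A * exp (- (k * \<tau>))))"])
      show "integrable lborel (\<lambda>\<tau>. indicator {0..} \<tau> *\<^sub>R (C * ((1 + 1 * \<tau>) powr A * exp (- (k * \<tau>)))))"
        unfolding set_integrable_def[symmetric] using A_pos assms
        by (intro set_integrable_mult_right set_integrable_poly_exp) auto
      show "AE \<tau> in lborel. (\<lambda>n. indicator {0..R n} \<tau> *\<^sub>R F (Complex \<tau> (- R n))) \<longlonglongrightarrow> 0"
      proof (rule AE_I2)
        fix \<tau> :: real
        show "(\<lambda>n. indicator {0..R n} \<tau> *\<^sub>R F (Complex \<tau> (- R n))) \<longlonglongrightarrow> 0"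
        proof (cases "\<tau> \<ge> 0")
          case True
          have "(\<lambda>n. cmod (H (Complex \<tau> (- R n)))) \<longlonglongrightarrow> 0"
            using tendsto_norm[OF filterlim_compose[OF H_strip_limit[OF True] R]] by simp
          then show ?thesis
          proof (rule Lim_null_comparison[rotated])
            show "\<forall>\<^sub>F n in sequentially. norm (indicator {0..R n} \<tau> *\<^sub>R F (Complex \<tau> (- R n))) \<le> cmod (H (Complex \<tau> (- R n)))"
              using True assms by (intro always_eventually) (auto simp: norm_F indicator_def intro!: mult_left_le)
          qed
        qed simp
      qed
      show "AE \<tau> in lborel. norm (indicator {0..R n} \<tau> *\<^sub>R F (Complex \<tau> (- R n))) \<le> indicator {0..} \<tau> *\<^sub>R (C * ((1 + 1 * \<tau>) powr A * exp (- (k * \<tau>))))" for n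
      proof (rule AE_I2)
        fix \<tau> :: real
        show "norm (indicator {0..R n} \<tau> *\<^sub>R F (Complex \<tau> (- R n))) \<le> indicator {0..} \<tau> *\<^sub>R (C * ((1 + 1 * \<tau>) powr A * exp (- (k * \<tau>))))"
        proof (cases "\<tau> \<in> {0..R n}")
          case True
          then have "cmod (H (Complex \<tau> (- R n))) * exp (- (k * \<tau>)) \<le> (C * (1 + \<tau>) powr A) * exp (- (k * \<tau>))"
            by (intro mult_right_mono C) (auto simp: R_def)
          then show ?thesis using True by (simp add: norm_F mult.assoc)
        qed (use C in auto)
      qed
    qed measurable
  qed
  have lim: "(\<lambda>n. CLINT \<tau>:{0..R n}|lborel. (1 - \<i>) * (?ray_F \<tau>)) \<longlonglongrightarrow> (CLINT \<tau>:{0..}|lborel. (1 - \<i>) * (?ray_F \<tau>))"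
    by (rule filterlim_compose[OF tendsto_set_lebesgue_integral_at_top[OF _ ray_int] R]) auto
  have split: "(\<lambda>n. CLINT \<tau>:{0..R n}|lborel. (1 - \<i>) * (?ray_F \<tau>))
      = (\<lambda>n. (CLINT \<tau>:{0..R n}|lborel. (- \<i>) * (?axis_F \<tau>)) + (CLINT \<tau>:{0..R n}|lborel. F (Complex \<tau> (- R n))))"
    by (intro ext triangle) (simp add: R_def)
  have "(\<lambda>n. (CLINT \<tau>:{0..R n}|lborel. (- \<i>) * (?axis_F \<tau>)) + (CLINT \<tau>:{0..R n}|lborel. F (Complex \<tau> (- R n))))
      \<longlonglongrightarrow> (CLINT \<tau>:{0..}|lborel. (- \<i>) * (?axis_F \<tau>)) + integral\<^sup>L lborel (\<lambda>_::real. 0)"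
    by (intro tendsto_add top filterlim_compose[OF tendsto_set_lebesgue_integral_at_top[OF _ axis_int] R]) auto
  from LIMSEQ_unique[OF lim[unfolded split] this]
  have closed: "(CLINT \<tau>:{0..}|lborel. (1 - \<i>) * (?ray_F \<tau>)) = (CLINT \<tau>:{0..}|lborel. (- \<i>) * (?axis_F \<tau>))"
    by (simp only: Bochner_Integration.integral_zero add_0_right)
  have limit: "(1 - \<i>) * (CLINT \<tau>:{0<..}|lborel. (?ray_F \<tau>)) = (- \<i>) * (CLINT \<tau>:{0<..}|lborel. (?axis_F \<tau>))"
  proof -
    have "(CLINT \<tau>:{0..}|lborel. (?ray_F \<tau>)) = (CLINT \<tau>:{0<..}|lborel. (?ray_F \<tau>))"
      "(CLINT \<tau>:{0..}|lborel. (?axis_F \<tau>)) = (CLINT \<tau>:{0<..}|lborel. (?axis_F \<tau>))"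
      by (rule set_integral_Ici_Ioi, measurable)+
    with closed show ?thesis
      by (simp only: set_integral_mult_right)
  qed
  have "(CLINT s:{0<..}|lborel. F (ray s)) = of_real (sqrt 2) * (CLINT \<tau>:{0<..}|lborel. (?ray_F \<tau>))"
    using set_integral_real_scale[of "sqrt 2" "\<lambda>s. F (ray s)"] by (simp add: ray_Complex scaleR_conv_of_real)
  then have "csqrt \<i> * (CLINT s:{0<..}|lborel. F (ray s)) = (csqrt \<i> * of_real (sqrt 2)) * (CLINT \<tau>:{0<..}|lborel. (?ray_F \<tau>))"
    by (simp only: mult.assoc)
  also have "csqrt \<i> * of_real (sqrt 2) = 1 + \<i>"
    by simp
  also have "1 + \<i> = \<i> * (1 - \<i>)"
    by (simp add: algebra_simps)
  also have "\<i> * (1 - \<i>) * (CLINT \<tau>:{0<..}|lborel. (?ray_F \<tau>)) = \<i> * ((- \<i>) * (CLINT \<tau>:{0<..}|lborel. (?axis_F \<tau>)))"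
    by (simp only: mult.assoc limit)
  finally have "csqrt \<i> * (CLINT s:{0<..}|lborel. F (ray s)) = (CLINT \<tau>:{0<..}|lborel. (?axis_F \<tau>))"
    by simp
  then show ?thesis unfolding axis_F F_def[symmetric] by simp
qed

lemma L_le: "L r \<le> exp (- (r\<^sup>2 / (2 * real (card I))))"
proof -
  have "L r \<le> (LINT t|N. exp (- (r\<^sup>2 / (2 * real (card I)))))"
    unfolding L_def
  proof (rule integral_mono_AE)
    show "integrable N (\<lambda>t. exp (- (r\<^sup>2 * V t) / 2))"
      using V_nonneg by (intro N.integrable_const_bound[where B = 1]) auto
    show "AE t in N. exp (- (r\<^sup>2 * V t) / 2) \<le> exp (- (r\<^sup>2 / (2 * real (card I))))"
      using AE_V_lower
    proof eventually_elim
      case (elim t)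
      then have "r\<^sup>2 * (1 / real (card I)) \<le> r\<^sup>2 * V t" by (intro mult_left_mono) auto
      then show ?case by simp
    qed
  qed simp
  then show ?thesis by (simp add: N.prob_space)
qed

lemma \<rho>_bounded:
  assumes "A > 1"
  shows "\<exists>B. \<forall>r. \<bar>\<rho> r\<bar> \<le> B"
proof -
  define n where "n = real (card I)"
  have "n > 0" using I by (simp add: n_def card_gt_0_iff)
  define K where "K = (max 1 ((A - 1) / 1)) powr (A - 1)"
  have "\<bar>\<rho> r\<bar> \<le> K * exp (n / 2) / Gamma A" for r
  proof (cases "r > 0")
    case True
    have "r powr (A - 1) \<le> (1 + r) powr (A - 1)" using True assms by (intro powr_mono2) auto
    also have "\<dots> \<le> K * exp (1 * r)"
      unfolding K_def using True assms by (intro powr_le_exp) auto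
    finally have "r powr (A - 1) * L r \<le> (K * exp r) * exp (- (r\<^sup>2 / (2 * n)))"
      using L_nonneg L_le[of r] by (intro mult_mono) (auto simp: n_def K_def)
    also have "\<dots> = K * exp (r - r\<^sup>2 / (2 * n))" by (simp add: mult_exp_exp mult.assoc)
    also have "\<dots> \<le> K * exp (n / 2)"
    proof -
      have "0 \<le> (r - n)\<^sup>2 / (2 * n)" using \<open>n > 0\<close> by simp
      also have "(r - n)\<^sup>2 / (2 * n) = r\<^sup>2 / (2 * n) - r + n / 2"
        using \<open>n > 0\<close> by (simp add: power2_eq_square field_simps)
      finally show ?thesis by (intro mult_left_mono) (auto simp: K_def)
    qed
    finally have "r powr (A - 1) * L r / Gamma A \<le> K * exp (n / 2) / Gamma A"
      using Gamma_real_pos[OF A_pos] by (intro divide_right_mono) auto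
    then show ?thesis using \<rho>_nonneg[of r] True by (simp add: \<rho>_def)
  next
    case False
    then show ?thesis using Gamma_real_pos[OF A_pos] by (simp add: \<rho>_def K_def)
  qed
  then show ?thesis by blast
qed

lemma isCont_L: "isCont L r"
  unfolding continuous_at_sequentially o_def
proof (intro allI impI)
  fix X assume X: "X \<longlonglongrightarrow> r"
  show "(\<lambda>n. L (X n)) \<longlonglongrightarrow> L r"
    unfolding L_def
  proof (rule integral_dominated_convergence[where w = "\<lambda>_. 1"])
    show "AE t in N. (\<lambda>n. exp (- ((X n)\<^sup>2 * V t) / 2)) \<longlonglongrightarrow> exp (- (r\<^sup>2 * V t) / 2)"
      by (intro AE_I2 tendsto_intros X) auto
  qed (use V_nonneg in auto)
qed

lemma isCont_\<rho>:
  assumes "k > 0"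
  shows "isCont \<rho> k"
proof -
  have "isCont (\<lambda>r. (r powr (A - 1) / Gamma A) * L r) k"
    using assms Gamma_real_pos[OF A_pos] by (intro continuous_intros isCont_L) auto
  moreover have "\<forall>\<^sub>F r in nhds k. \<rho> r = (r powr (A - 1) / Gamma A) * L r"
  proof -
    have "\<forall>\<^sub>F r in nhds k. r \<in> {0<..}"
      using assms by (intro eventually_nhds_in_open) auto
    then show ?thesis by eventually_elim (simp add: \<rho>_def)
  qed
  ultimately show ?thesis by (simp only: isCont_cong)
qed

text \<open>
On the imaginary axis \<open>H\<close> is the Fourier transform of \<open>\<rho>\<close>, and \<open>H(iy)\<close> is the conjugate of \<open>H(-iy)\<close>;
twice the real part of the half-line integral is therefore the inversion integral over the whole line.
\<close>
lemma H_fourier: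
  assumes "A > 1" "k > 0"
  shows "Re (CLINT y:{0<..}|lborel. H (Complex 0 (- y)) * iexp (k * y)) = pi * \<rho> k"
proof -
  define h where "h y = H (Complex 0 (- y)) * iexp (k * y)" for y
  have h_int: "integrable lborel h"
    unfolding h_def by (rule Bochner_Integration.integrable_bound[OF H_axis_integrable[OF assms(1)]]) (auto simp: norm_mult)
  then have [measurable]: "h \<in> borel_measurable borel" using borel_measurable_integrable by auto
  obtain B where B: "\<And>r. \<bar>\<rho> r\<bar> \<le> B" using \<rho>_bounded[OF assms(1)] by blast
  have hat: "(CLINT r|lborel. of_real (\<rho> r) * iexp (- (y * r))) = H (Complex 0 (- y))" for y
    unfolding H_superposition(2) by (intro Bochner_Integration.integral_cong) (auto simp: Complex_eq mult_ac)
  have "(CLINT y|lborel. (CLINT r|lborel. of_real (\<rho> r) * iexp (- (y * r))) * iexp (k * y)) = of_real (2 * pi * \<rho> k)"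
  proof (rule fourier_inversion[OF _ B isCont_\<rho>[OF assms(2)]])
    show "integrable lborel \<rho>" using \<rho>_exp_integrable[of 0] by simp
    show "integrable lborel (\<lambda>y. CLINT r|lborel. of_real (\<rho> r) * iexp (- (y * r)))"
      unfolding hat by (rule H_axis_integrable[OF assms(1)])
  qed
  then have total: "(CLINT y|lborel. h y) = of_real (2 * pi * \<rho> k)" unfolding hat h_def .
  have h_neg: "h (- y) = cnj (h y)" for y
    by (simp add: h_def H_cnj[symmetric] exp_cnj complex_cnj)
  have pos: "set_integrable lborel {0<..} h" and neg: "set_integrable lborel {..0} h"
    unfolding set_integrable_def by (intro integrable_mult_indicator h_int; simp)+
  have "(CLINT y|lborel. h y) = (CLINT y:{0<..} \<union> {..0}|lborel. h y)"
    unfolding set_lebesgue_integral_def by (intro Bochner_Integration.integral_cong) (auto simp: indicator_def)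
  also have "\<dots> = (CLINT y:{0<..}|lborel. h y) + (CLINT y:{..0}|lborel. h y)"
    by (rule set_integral_Un[OF _ pos neg]) auto
  also have "(CLINT y:{..0}|lborel. h y) = (CLINT y|lborel. indicator {..0} (0 + (-1) * y) *\<^sub>R h (0 + (-1) * y))"
    unfolding set_lebesgue_integral_def by (subst lborel_integral_real_affine[where c = "-1" and t = 0]) auto
  also have "\<dots> = (CLINT y:{0..}|lborel. cnj (h y))"
    unfolding set_lebesgue_integral_def by (intro Bochner_Integration.integral_cong) (auto simp: h_neg indicator_def)
  also have "\<dots> = (CLINT y:{0<..}|lborel. cnj (h y))"
    by (intro set_integral_Ici_Ioi borel_measurable_continuous_on[where f = cnj] continuous_intros) measurable
  also have "\<dots> = cnj (CLINT y:{0<..}|lborel. h y)"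
    unfolding set_lebesgue_integral_def Bochner_Integration.integral_cnj[symmetric]
    by (intro Bochner_Integration.integral_cong) auto
  finally have "(CLINT y:{0<..}|lborel. h y) + cnj (CLINT y:{0<..}|lborel. h y) = of_real (2 * pi * \<rho> k)"
    using total by simp
  then have "2 * Re (CLINT y:{0<..}|lborel. h y) = 2 * (pi * \<rho> k)"
    by (simp add: complex_add_cnj complex_eq_iff)
  then show ?thesis by (simp add: h_def)
qed

end

section \<open>The kernel that carries the parameter of the distribution function\<close>

lemma ray_scale: "ray s * of_real c = ray (s * c)"
  by (simp add: ray_def complex_eq_iff)

lemma ray_sq: "(ray s)\<^sup>2 = - (\<i> * of_real (s\<^sup>2))"
  by (simp add: ray_def complex_eq_iff power2_eq_square)

lemma ray_measurable [measurable]: "ray \<in> borel_measurable borel"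
  unfolding ray_def[abs_def] by measurable

lemma gauss_laplace_measurable:
  assumes "a > 0" and [measurable]: "f \<in> borel_measurable M"
  shows "(\<lambda>x. gauss_laplace a (f x)) \<in> borel_measurable M"
  using borel_measurable_continuous_on[OF continuous_gauss_laplace[OF assms(1)] assms(2)] .

lemma exponential_tail_integral:
  fixes q v :: real
  assumes "q > 0" "v \<ge> 0"
  shows "(LINT x|lborel. indicator {0<..} x * exp (- (q * x)) * indicator {v..} x) = exp (- (q * v)) / q"
proof -
  have "(LINT x|lborel. indicator {0<..} x * exp (- (q * x)) * indicator {v..} x)
      = (LINT y|lborel. indicator {0<..} (v + 1 * y) * exp (- (q * (v + 1 * y))) * indicator {v..} (v + 1 * y))"
    by (subst lborel_integral_real_affine[where c = 1 and t = v]) auto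
  also have "\<dots> = (LINT y|lborel. exp (- (q * v)) * (indicator {0<..} y *\<^sub>R (y powr (1 - 1) * exp (- (q * y)))))"
  proof (rule integral_cong_AE)
    show "AE y in lborel. indicator {0<..} (v + 1 * y) * exp (- (q * (v + 1 * y))) * indicator {v..} (v + 1 * y)
        = exp (- (q * v)) * (indicator {0<..} y *\<^sub>R (y powr (1 - 1) * exp (- (q * y))))"
      using AE_lborel_singleton[of 0]
    proof eventually_elim
      case (elim y)
      then show ?case
        using assms by (cases "y > 0") (auto simp: indicator_def mult_exp_exp algebra_simps)
    qed
  qed measurable
  also have "\<dots> = exp (- (q * v)) * (Gamma 1 * q powr (- 1))"
    using set_integral_Gamma[of 1 q] assms
    unfolding set_lebesgue_integral_def by (subst integral_mult_right_zero) simp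
  finally show ?thesis using assms by (simp add: powr_minus_divide)
qed

context gamma_vector
begin

text \<open>
The factors of the integrand that depend on \<open>x\<close>, including the power \<open>x\<^bsup>(A-1)/2\<^esup>\<close> in front of the
integral. The exponential unites the one in the theorem with the one in the parabolic cylinder function.
\<close>
definition K :: "real \<Rightarrow> real \<Rightarrow> complex" where
  "K x s = of_real (x powr ((A - 1) / 2)) * exp (\<i> * of_real (s\<^sup>2) / (2 * of_real x))
     * gauss_laplace A (- (ray s * of_real (x powr (- 1 / 2)))) / of_real (Gamma A)"

lemma K_measurable [measurable]:
  assumes [measurable]: "f \<in> borel_measurable M" "g \<in> borel_measurable M"
  shows "(\<lambda>z. K (f z) (g z)) \<in> borel_measurable M"
proof -
  have [measurable]: "gauss_laplace A \<in> borel_measurable borel"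
    by (intro gauss_laplace_measurable A_pos) auto
  show ?thesis unfolding K_def by measurable
qed

text \<open>
The difference is the sum of \<open>min 1 (2\<alpha>\<^sub>j)\<close>. If all \<open>\<alpha>\<^sub>j \<le> 1/2\<close>, this is \<open>2A\<close>; otherwise one term is
\<open>1\<close> and there is another positive one.
\<close>
lemma sum_exponents:
  assumes "A > 1" "card I \<ge> 2"
  shows "A - (\<Sum>j\<in>I. max (\<alpha> j - 1) (- \<alpha> j)) > 1"
proof -
  have eq: "A - (\<Sum>j\<in>I. max (\<alpha> j - 1) (- \<alpha> j)) = (\<Sum>j\<in>I. min 1 (2 * \<alpha> j))"
    unfolding A_def sum_subtractf[symmetric] by (intro sum.cong refl) auto
  have pos: "min 1 (2 * \<alpha> j) > 0" if "j \<in> I" for j using \<alpha>_pos[OF that] by simp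
  show ?thesis
  proof (cases "\<forall>j\<in>I. \<alpha> j \<le> 1/2")
    case True
    then have "(\<Sum>j\<in>I. min 1 (2 * \<alpha> j)) = 2 * A"
      unfolding A_def sum_distrib_left by (intro sum.cong refl) auto
    then show ?thesis using eq assms by simp
  next
    case False
    then obtain i where i: "i \<in> I" "\<alpha> i > 1/2" by auto
    have "I - {i} \<noteq> {}"
    proof
      assume "I - {i} = {}"
      then have "I = {i}" using i by auto
      then show False using assms(2) by simp
    qed
    then have "(\<Sum>j\<in>I - {i}. min 1 (2 * \<alpha> j)) > 0"
      using I pos by (intro sum_pos) auto
    moreover have "(\<Sum>j\<in>I. min 1 (2 * \<alpha> j)) = min 1 (2 * \<alpha> i) + (\<Sum>j\<in>I - {i}. min 1 (2 * \<alpha> j))"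
      using I i by (intro sum.remove) auto
    ultimately show ?thesis using eq i by simp
  qed
qed

lemma H_ray_decay:
  assumes "A > 1" "card I \<ge> 2"
  shows "set_integrable lborel {0<..} (\<lambda>s. cmod (H (ray s)) * (1 + s) powr (- A))"
proof -
  define e where "e = (\<Sum>j\<in>I. max (\<alpha> j - 1) (- \<alpha> j))"
  obtain C where C: "C \<ge> 0" "\<And>s. s \<ge> 0 \<Longrightarrow> cmod (H (ray s)) \<le> C * (1 + s) powr e"
    using H_ray_bound unfolding e_def by blast
  have "A - e > 1" unfolding e_def by (rule sum_exponents[OF assms])
  show ?thesis
  proof (rule set_integrable_bound)
    have "set_integrable lborel {0..} (\<lambda>s. C * (1 + s) powr (- (A - e)))"
      by (intro set_integrable_mult_right set_integrable_powr_decay) (simp add: \<open>A - e > 1\<close>)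
    then show "set_integrable lborel {0<..} (\<lambda>s. C * (1 + s) powr (- (A - e)))"
      by (rule set_integrable_subset) auto
    show "set_borel_measurable lborel {0<..} (\<lambda>s. cmod (H (ray s)) * (1 + s) powr (- A))"
      unfolding set_borel_measurable_def by measurable
    have "cmod (H (ray s)) * (1 + s) powr (- A) \<le> C * (1 + s) powr (- (A - e))" if "s > 0" for s
    proof -
      have "cmod (H (ray s)) * (1 + s) powr (- A) \<le> (C * (1 + s) powr e) * (1 + s) powr (- A)"
        using that by (intro mult_right_mono C) auto
      also have "\<dots> = C * (1 + s) powr (- (A - e))"
        by (simp add: mult.assoc flip: powr_add)
      finally show ?thesis .
    qed
    then show "AE s in lborel. s \<in> {0<..} \<longrightarrow> norm (cmod (H (ray s)) * (1 + s) powr (- A)) \<le> norm (C * (1 + s) powr (- (A - e)))"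
      using C(1) by (intro AE_I2 impI) (simp add: abs_mult)
  qed
qed

text \<open>
The decay in \<open>s/sqrt x\<close> is traded for decay in \<open>s\<close> by \<open>1 + s \<le> (1 + sqrt x)(1 + s/sqrt x)\<close>, so that the
majorant is a product of a function of \<open>x\<close> and a function of \<open>s\<close>.
\<close>
lemma K_bound:
  "\<exists>C\<ge>0. \<forall>x>0. \<forall>s\<ge>0. cmod (K x s) \<le> C * (x powr ((A - 1) / 2) * (1 + sqrt x) powr A) * (1 + s) powr (- A)"
proof -
  obtain C where C: "C \<ge> 0" "\<And>s. s \<ge> 0 \<Longrightarrow> cmod (gauss_laplace A (- ray s)) \<le> C * (1 + s) powr (- A)"
    using gauss_laplace_neg_ray_bound[OF A_pos] by blast
  have G: "Gamma A > 0" using A_pos by (rule Gamma_real_pos)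
  have "cmod (K x s) \<le> (C / Gamma A) * (x powr ((A - 1) / 2) * (1 + sqrt x) powr A) * (1 + s) powr (- A)"
    if x: "x > 0" and s: "s \<ge> 0" for x s
  proof -
    define c where "c = x powr (- 1 / 2)"
    have c: "c \<ge> 0" "sqrt x * c = 1"
      using x by (auto simp: c_def powr_half_sqrt[symmetric] simp flip: powr_add)
    have "Re (\<i> * of_real (s\<^sup>2) / (2 * of_real x)) = 0"
      by (simp add: Re_divide)
    then have unit: "cmod (exp (\<i> * of_real (s\<^sup>2) / (2 * of_real x))) = 1"
      unfolding norm_exp_eq_Re by simp
    have "1 + s \<le> (1 + sqrt x) * (1 + s * c)"
    proof -
      have "(1 + sqrt x) * (1 + s * c) = 1 + s * (sqrt x * c) + (s * c + sqrt x)"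
        by (simp add: algebra_simps)
      then show ?thesis using c s x by simp
    qed
    then have "(1 + s) powr A \<le> ((1 + sqrt x) * (1 + s * c)) powr A"
      using s A_pos by (intro powr_mono2) auto
    also have "\<dots> = (1 + sqrt x) powr A * (1 + s * c) powr A"
      by (rule powr_mult)
    finally have le: "(1 + s) powr A \<le> (1 + sqrt x) powr A * (1 + s * c) powr A" .
    have "0 < 1 + s * c" "0 < 1 + s" using s c by (auto intro: add_pos_nonneg)
    then have "0 < (1 + s * c) powr A" "0 < (1 + s) powr A" by auto
    then have "(1 + s * c) powr (- A) \<le> (1 + sqrt x) powr A * (1 + s) powr (- A)"
      using le by (simp add: powr_minus_divide divide_le_eq le_divide_eq mult_ac)
    then have "C * (1 + s * c) powr (- A) \<le> C * ((1 + sqrt x) powr A * (1 + s) powr (- A))"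
      using C(1) by (intro mult_left_mono)
    moreover have "cmod (gauss_laplace A (- ray (s * c))) \<le> C * (1 + s * c) powr (- A)"
      using s c by (intro C) auto
    ultimately have "cmod (gauss_laplace A (- ray (s * c))) \<le> C * ((1 + sqrt x) powr A * (1 + s) powr (- A))"
      by linarith
    then have "x powr ((A - 1) / 2) * cmod (gauss_laplace A (- ray (s * c))) / Gamma A
       \<le> x powr ((A - 1) / 2) * (C * ((1 + sqrt x) powr A * (1 + s) powr (- A))) / Gamma A"
      using G by (intro divide_right_mono mult_left_mono) auto
    moreover have "cmod (K x s) = x powr ((A - 1) / 2) * cmod (gauss_laplace A (- ray (s * c))) / Gamma A"
      unfolding K_def c_def[symmetric] ray_scale norm_divide norm_mult unit using G by simp
    ultimately show ?thesis by (simp add: mult_ac)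
  qed
  then show ?thesis using C(1) G by (intro exI[of _ "C / Gamma A"]) auto
qed

text \<open>
Substitute \<open>t = w / sqrt x\<close> in the half-line transform and complete the square: the exponential in
front is \<open>e\<^bsup>-z\<^sup>2/(2x)\<^esup>\<close> for \<open>z = ray s\<close>, which is exactly the missing square.
\<close>
lemma K_heat:
  assumes "x > 0"
  shows "K x s = of_real (x powr (- 1 / 2)) / of_real (Gamma A)
    * (CLINT w:{0<..}|lborel. of_real (w powr (A - 1)) * exp (- (of_real w + ray s)\<^sup>2 / of_real (2 * x)))"
proof -
  let ?g = "\<lambda>w. exp (- (of_real w + ray s)\<^sup>2 / of_real (2 * x))"
  define c where "c = x powr (- 1 / 2)"
  have c: "c > 0" "c\<^sup>2 = 1 / x"
    using assms by (auto simp: c_def powr_minus_divide power2_eq_square simp flip: powr_add)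
  have "gauss_laplace A (- (ray s * of_real c)) = c *\<^sub>R (CLINT w:{0<..}|lborel.
      of_real ((c * w) powr (A - 1)) * exp (- (ray s * of_real c) * of_real (c * w) - of_real ((c * w)\<^sup>2) / 2))"
    unfolding gauss_laplace_def by (rule set_integral_real_scale[OF c(1)])
  also have "\<dots> = of_real c * (CLINT w:{0<..}|lborel. of_real (c powr (A - 1)) * exp ((ray s)\<^sup>2 / of_real (2 * x))
      * (of_real (w powr (A - 1)) * (?g w)))"
    unfolding scaleR_conv_of_real
  proof (rule arg_cong2[where f = "(*)", OF refl], rule set_lebesgue_integral_cong, simp, intro allI impI)
    fix w :: real assume "w \<in> {0<..}"
    have "- (ray s * of_real c) * of_real (c * w) - of_real ((c * w)\<^sup>2) / 2 = - (ray s * of_real (c\<^sup>2 * w)) - of_real (c\<^sup>2 * w\<^sup>2) / 2"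
      by (simp add: power2_eq_square)
    also have "\<dots> = (ray s)\<^sup>2 / of_real (2 * x) + - (of_real w + ray s)\<^sup>2 / of_real (2 * x)"
      unfolding c(2) using assms by (simp add: power2_sum field_simps)
    finally have "exp (- (ray s * of_real c) * of_real (c * w) - of_real ((c * w)\<^sup>2) / 2)
       = exp ((ray s)\<^sup>2 / of_real (2 * x)) * (?g w)"
      by (simp only: exp_add)
    then show "of_real ((c * w) powr (A - 1)) * exp (- (ray s * of_real c) * of_real (c * w) - of_real ((c * w)\<^sup>2) / 2)
      = of_real (c powr (A - 1)) * exp ((ray s)\<^sup>2 / of_real (2 * x))
      * (of_real (w powr (A - 1)) * (?g w))"
      by (simp only: powr_mult of_real_mult mult_ac)
  qed
  also have "\<dots> = of_real c * (of_real (c powr (A - 1)) * exp ((ray s)\<^sup>2 / of_real (2 * x))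
     * (CLINT w:{0<..}|lborel. of_real (w powr (A - 1)) * (?g w)))"
    by (simp only: set_integral_mult_right)
  finally have gl: "gauss_laplace A (- (ray s * of_real c)) = of_real c * (of_real (c powr (A - 1)) * exp ((ray s)\<^sup>2 / of_real (2 * x))
     * (CLINT w:{0<..}|lborel. of_real (w powr (A - 1)) * (?g w)))" .
  have e: "exp (\<i> * of_real (s\<^sup>2) / (2 * of_real x)) * exp ((ray s)\<^sup>2 / of_real (2 * x)) = 1"
    unfolding mult_exp_exp ray_sq by simp
  have p: "x powr ((A - 1) / 2) * (c * c powr (A - 1)) = c"
    using assms by (simp add: c_def powr_powr diff_divide_distrib flip: powr_add)
  have "K x s = (exp (\<i> * of_real (s\<^sup>2) / (2 * of_real x)) * exp ((ray s)\<^sup>2 / of_real (2 * x)))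
     * of_real (x powr ((A - 1) / 2) * (c * c powr (A - 1)))
     * (CLINT w:{0<..}|lborel. of_real (w powr (A - 1)) * (?g w)) / of_real (Gamma A)"
    unfolding K_def c_def[symmetric] gl by (simp only: of_real_mult mult_ac)
  then show ?thesis unfolding e p by (simp add: c_def)
qed

text \<open>
The Laplace transform of the heat kernel is \<open>sqrt(\<pi>/q) e\<^bsup>-k(w+z)\<^esup>\<close>, and the remaining integral over \<open>w\<close>
is a gamma integral.
\<close>
lemma K_laplace:
  assumes "q > 0" "s > 0"
  shows "(CLINT x:{0<..}|lborel. of_real (exp (- (q * x))) * K x s)
    = of_real (sqrt (pi / q) * sqrt (2 * q) powr (- A)) * exp (- (of_real (sqrt (2 * q)) * ray s))"
proof -
  let ?g = "\<lambda>x w. exp (- (of_real w + ray s)\<^sup>2 / of_real (2 * x))"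
  define k where "k = sqrt (2 * q)"
  have "k > 0" using assms by (simp add: k_def)
  define h where "h x w = indicator {0<..} x *\<^sub>R (indicator {0<..} w *\<^sub>R
    (of_real (exp (- (q * x)) * x powr (- 1 / 2)) * (of_real (w powr (A - 1)) * (?g x w))))" for x w :: real
  have f: "integrable lborel (\<lambda>x. indicator {0<..} x *\<^sub>R (x powr (1/2 - 1) * exp (- ((q/2) * x))))"
    using set_integrable_Gamma[of "1/2" "q/2"] assms by (simp add: set_integrable_def)
  have g: "integrable lborel (\<lambda>w. indicator {0<..} w *\<^sub>R (w powr (A - 1) * exp (- (sqrt q * w))))"
    using set_integrable_Gamma[of A "sqrt q"] assms A_pos by (simp add: set_integrable_def)
  have int: "integrable (lborel \<Otimes>\<^sub>M lborel) (case_prod h)"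
  proof (rule lborel_pair.integrable_pair_bound[OF _ f g])
    show "case_prod h \<in> borel_measurable (lborel \<Otimes>\<^sub>M lborel)"
      unfolding h_def split_beta' by measurable
    have "norm (h x w) \<le> (indicator {0<..} x *\<^sub>R (x powr (1/2 - 1) * exp (- ((q/2) * x)))) * (indicator {0<..} w *\<^sub>R (w powr (A - 1) * exp (- (sqrt q * w))))" for x w
    proof (cases "x > 0 \<and> w > 0")
      case True
      have "Re ((of_real w + ray s)\<^sup>2) = w\<^sup>2 + 2 * w * (s / sqrt 2)"
        by (simp add: ray_def power2_eq_square algebra_simps)
      then have "w\<^sup>2 \<le> Re ((of_real w + ray s)\<^sup>2)" using True assms by simp
      then have "w\<^sup>2 / (2 * x) \<le> Re ((of_real w + ray s)\<^sup>2) / (2 * x)"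
        using True by (intro divide_right_mono) auto
      \<comment> \<open>The arithmetic-geometric mean inequality separates \<open>x\<close> and \<open>w\<close> in the majorant.\<close>
      moreover have "sqrt q * w \<le> (q / 2) * x + w\<^sup>2 / (2 * x)"
      proof -
        have "0 \<le> (sqrt q * x - w)\<^sup>2 / (2 * x)" using True by simp
        also have "\<dots> = ((sqrt q)\<^sup>2 * x\<^sup>2 - 2 * (sqrt q * x * w) + w\<^sup>2) / (2 * x)"
          by (simp add: power2_eq_square algebra_simps)
        also have "\<dots> = (q / 2) * x + w\<^sup>2 / (2 * x) - sqrt q * w"
          using True assms by (simp add: power2_eq_square field_simps)
        finally show ?thesis by simp
      qed
      ultimately have "exp (- (q * x)) * exp (- (Re ((of_real w + ray s)\<^sup>2) / (2 * x))) \<le> exp (- ((q/2) * x)) * exp (- (sqrt q * w))"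
        unfolding mult_exp_exp exp_le_cancel_iff by linarith
      then have "(x powr (- 1 / 2) * w powr (A - 1)) * (exp (- (q * x)) * exp (- (Re ((of_real w + ray s)\<^sup>2) / (2 * x))))
        \<le> (x powr (- 1 / 2) * w powr (A - 1)) * (exp (- ((q/2) * x)) * exp (- (sqrt q * w)))"
        by (rule mult_left_mono) simp
      moreover have "norm (h x w) = (x powr (- 1 / 2) * w powr (A - 1)) * (exp (- (q * x)) * exp (- (Re ((of_real w + ray s)\<^sup>2) / (2 * x))))"
        using True unfolding h_def norm_scaleR norm_mult norm_exp_eq_Re
        by (simp add: Re_divide_of_real del: of_real_mult)
      ultimately show ?thesis using True by (simp add: mult_ac)
    qed (auto simp: h_def)
    then show "AE x in lborel. AE w in lborel. norm (case (x, w) of (x, w) \<Rightarrow> h x w) \<le> (indicator {0<..} x *\<^sub>R (x powr (1/2 - 1) * exp (- ((q/2) * x)))) * (indicator {0<..} w *\<^sub>R (w powr (A - 1) * exp (- (sqrt q * w))))"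
      by (intro AE_I2) simp
  qed
  have inner_w: "(CLINT w|lborel. h x w) = of_real (Gamma A) * (indicator {0<..} x *\<^sub>R (of_real (exp (- (q * x))) * K x s))" for x
  proof (cases "x > 0")
    case True
    have "(CLINT w|lborel. h x w) = of_real (exp (- (q * x)) * x powr (- 1 / 2))
      * (CLINT w:{0<..}|lborel. of_real (w powr (A - 1)) * (?g x w))"
    proof -
      have "(CLINT w|lborel. h x w) = (CLINT w:{0<..}|lborel. of_real (exp (- (q * x)) * x powr (- 1 / 2)) * (of_real (w powr (A - 1)) * (?g x w)))"
        unfolding set_lebesgue_integral_def
        by (intro Bochner_Integration.integral_cong refl) (simp only: h_def True indicator_simps greaterThan_iff scaleR_one)
      then show ?thesis by (simp only: set_integral_mult_right)
    qed
    moreover have "of_real (Gamma A) \<noteq> (0::complex)" using Gamma_real_pos[OF A_pos] by simp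
    ultimately show ?thesis using True unfolding K_heat[OF True] by (simp add: field_simps)
  qed (simp add: h_def)
  have inner_x: "(CLINT x|lborel. h x w) = indicator {0<..} w *\<^sub>R (of_real (w powr (A - 1)) * (of_real (sqrt (pi / q)) * exp (- (of_real k * (of_real w + ray s)))))" for w
  proof (cases "w > 0")
    case True
    have "(CLINT x|lborel. h x w) = of_real (w powr (A - 1))
      * (CLINT x:{0<..}|lborel. of_real (exp (- (q * x)) * x powr (- 1 / 2)) * (?g x w))"
    proof -
      have "(CLINT x|lborel. h x w) = (CLINT x:{0<..}|lborel. of_real (w powr (A - 1)) * (of_real (exp (- (q * x)) * x powr (- 1 / 2)) * (?g x w)))"
        unfolding set_lebesgue_integral_def
        by (intro Bochner_Integration.integral_cong refl) (simp only: h_def True indicator_simps greaterThan_iff scaleR_one mult.left_commute)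
      then show ?thesis by (simp only: set_integral_mult_right)
    qed
    also have "(CLINT x:{0<..}|lborel. of_real (exp (- (q * x)) * x powr (- 1 / 2)) * (?g x w))
      = of_real (sqrt (pi / q)) * exp (- (of_real k * (of_real w + ray s)))"
      unfolding k_def by (rule laplace_inverse_gauss) (use assms True in \<open>auto simp: ray_def\<close>)
    finally show ?thesis using True by simp
  qed (simp add: h_def)
  have "of_real (Gamma A) * (CLINT x:{0<..}|lborel. of_real (exp (- (q * x))) * K x s) = (CLINT x|lborel. CLINT w|lborel. h x w)"
    unfolding inner_w by (simp only: integral_mult_right_zero set_lebesgue_integral_def)
  also have "\<dots> = (CLINT w|lborel. CLINT x|lborel. h x w)"
    by (rule lborel_pair.Fubini_integral[OF int, symmetric])
  also have "\<dots> = (CLINT w:{0<..}|lborel. of_real (sqrt (pi / q)) * exp (- (of_real k * ray s)) * of_real (w powr (A - 1) * exp (- (k * w))))"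
    unfolding inner_x set_lebesgue_integral_def
  proof (intro Bochner_Integration.integral_cong refl)
    fix w :: real
    have "exp (- (of_real k * (of_real w + ray s))) = exp (- (of_real k * ray s)) * of_real (exp (- (k * w)))"
      unfolding exp_of_real[symmetric] mult_exp_exp by (simp add: algebra_simps)
    then show "indicator {0<..} w *\<^sub>R (of_real (w powr (A - 1)) * (of_real (sqrt (pi / q)) * exp (- (of_real k * (of_real w + ray s)))))
      = indicator {0<..} w *\<^sub>R (of_real (sqrt (pi / q)) * exp (- (of_real k * ray s)) * of_real (w powr (A - 1) * exp (- (k * w))))"
      by (simp add: mult_ac)
  qed
  also have "\<dots> = of_real (sqrt (pi / q)) * exp (- (of_real k * ray s)) * of_real (LINT w:{0<..}|lborel. w powr (A - 1) * exp (- (k * w)))"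
    by (simp only: set_integral_mult_right set_integral_complex_of_real)
  also have "(LINT w:{0<..}|lborel. w powr (A - 1) * exp (- (k * w))) = Gamma A * k powr (- A)"
    by (rule set_integral_Gamma[OF A_pos \<open>k > 0\<close>])
  finally show ?thesis
    using Gamma_real_pos[OF A_pos] unfolding k_def[symmetric] by (simp add: mult_ac)
qed

text \<open>
The integral of the theorem with its power of \<open>x\<close>, without the factor \<open>csqrt \<i>\<close> and before taking
real parts.
\<close>
definition \<Psi> :: "real \<Rightarrow> complex" where
  "\<Psi> x = (CLINT s:{0<..}|lborel. H (ray s) * K x s)"

lemma HK_bound:
  assumes "A > 1"
  obtains C where "C \<ge> 0" "\<And>x s. x > 0 \<Longrightarrow> s \<ge> 0 \<Longrightarrow>
    cmod (H (ray s) * K x s) \<le> C * (x powr ((A - 1) / 2) * (1 + sqrt x) powr A) * (cmod (H (ray s)) * (1 + s) powr (- A))"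
proof -
  obtain C where C: "C \<ge> 0" "\<And>x s. x > 0 \<Longrightarrow> s \<ge> 0 \<Longrightarrow>
    cmod (K x s) \<le> C * (x powr ((A - 1) / 2) * (1 + sqrt x) powr A) * (1 + s) powr (- A)"
    using K_bound by blast
  have "cmod (H (ray s) * K x s) \<le> C * (x powr ((A - 1) / 2) * (1 + sqrt x) powr A) * (cmod (H (ray s)) * (1 + s) powr (- A))"
    if "x > 0" "s \<ge> 0" for x s
    using mult_left_mono[OF C(2)[OF that], of "cmod (H (ray s))"] by (simp add: norm_mult mult_ac)
  with C(1) show thesis by (rule that)
qed

lemma HK_integrable:
  assumes "A > 1" "card I \<ge> 2" "x > 0"
  shows "set_integrable lborel {0<..} (\<lambda>s. H (ray s) * K x s)"
proof -
  obtain C where C: "C \<ge> 0" "\<And>x s. x > 0 \<Longrightarrow> s \<ge> 0 \<Longrightarrow>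
    cmod (H (ray s) * K x s) \<le> C * (x powr ((A - 1) / 2) * (1 + sqrt x) powr A) * (cmod (H (ray s)) * (1 + s) powr (- A))"
    using HK_bound[OF assms(1)] by blast
  show ?thesis
  proof (rule set_integrable_bound)
    show "set_integrable lborel {0<..} (\<lambda>s. C * (x powr ((A - 1) / 2) * (1 + sqrt x) powr A) * (cmod (H (ray s)) * (1 + s) powr (- A)))"
      by (intro set_integrable_mult_right H_ray_decay assms)
    show "set_borel_measurable lborel {0<..} (\<lambda>s. H (ray s) * K x s)"
      unfolding set_borel_measurable_def by measurable
    show "AE s in lborel. s \<in> {0<..} \<longrightarrow> norm (H (ray s) * K x s) \<le> norm (C * (x powr ((A - 1) / 2) * (1 + sqrt x) powr A) * (cmod (H (ray s)) * (1 + s) powr (- A)))"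
      by (intro AE_I2 impI order_trans[OF C(2)] abs_ge_self[unfolded real_norm_def[symmetric]]) (use assms in auto)
  qed
qed

text \<open>
The majorant of the integrand increases with \<open>x\<close>, so an upper bound for a convergent sequence suffices.
\<close>
lemma continuous_\<Psi>:
  assumes "A > 1" "card I \<ge> 2"
  shows "continuous_on {0<..} \<Psi>"
  unfolding continuous_on_sequentially o_def
proof (intro allI ballI impI, elim conjE)
  fix X :: "nat \<Rightarrow> real" and x :: real
  assume x: "x \<in> {0<..}" and Xpos: "\<forall>n. X n \<in> {0<..}" and X: "X \<longlonglongrightarrow> x"
  then obtain B where B: "\<And>n. X n \<le> B"
    using convergent_imp_Bseq[of X] by (auto simp: convergent_def Bseq_def abs_le_iff)
  have "B > 0" using Xpos B[of 0] by (auto intro: less_le_trans)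
  obtain C where C: "C \<ge> 0" "\<And>x s. x > 0 \<Longrightarrow> s \<ge> 0 \<Longrightarrow>
    cmod (H (ray s) * K x s) \<le> C * (x powr ((A - 1) / 2) * (1 + sqrt x) powr A) * (cmod (H (ray s)) * (1 + s) powr (- A))"
    using HK_bound[OF assms(1)] by blast
  let ?w = "\<lambda>s. indicator {0<..} s *\<^sub>R (C * (B powr ((A - 1) / 2) * (1 + sqrt B) powr A) * (cmod (H (ray s)) * (1 + s) powr (- A)))"
  show "(\<lambda>n. \<Psi> (X n)) \<longlonglongrightarrow> \<Psi> x"
    unfolding \<Psi>_def set_lebesgue_integral_def
  proof (rule integral_dominated_convergence[where w = "\<lambda>s. (?w s)"])
    show "integrable lborel (\<lambda>s. (?w s))"
      unfolding set_integrable_def[symmetric] by (intro set_integrable_mult_right H_ray_decay assms)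
    show "AE s in lborel. (\<lambda>n. indicator {0<..} s *\<^sub>R (H (ray s) * K (X n) s)) \<longlonglongrightarrow> indicator {0<..} s *\<^sub>R (H (ray s) * K x s)"
    proof (rule AE_I2)
      fix s :: real
      have gl: "isCont (gauss_laplace A) z" for z
        using continuous_gauss_laplace[OF A_pos] by (simp add: continuous_on_eq_continuous_at)
      show "(\<lambda>n. indicator {0<..} s *\<^sub>R (H (ray s) * K (X n) s)) \<longlonglongrightarrow> indicator {0<..} s *\<^sub>R (H (ray s) * K x s)"
        unfolding K_def using x Gamma_real_pos[OF A_pos]
        by (intro tendsto_intros X isCont_tendsto_compose[OF gl]) auto
    qed
    show "AE s in lborel. norm (indicator {0<..} s *\<^sub>R (H (ray s) * K (X n) s))
        \<le> (?w s)" for n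
    proof (rule AE_I2)
      fix s :: real
      have Xn: "0 < X n" using Xpos by auto
      have mono: "X n powr ((A - 1) / 2) * (1 + sqrt (X n)) powr A \<le> B powr ((A - 1) / 2) * (1 + sqrt B) powr A"
        using Xn B[of n] assms A_pos by (intro mult_mono powr_mono2) auto
      show "norm (indicator {0<..} s *\<^sub>R (H (ray s) * K (X n) s))
        \<le> (?w s)"
      proof (cases "s > 0")
        case True
        have "cmod (H (ray s) * K (X n) s) \<le> C * (X n powr ((A - 1) / 2) * (1 + sqrt (X n)) powr A) * (cmod (H (ray s)) * (1 + s) powr (- A))"
          using True Xn by (intro C) auto
        also have "\<dots> \<le> C * (B powr ((A - 1) / 2) * (1 + sqrt B) powr A) * (cmod (H (ray s)) * (1 + s) powr (- A))"
          using mono C(1) by (intro mult_right_mono mult_left_mono) auto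
        finally show ?thesis using True by simp
      qed simp
    qed
  qed measurable
qed

lemma \<Psi>_laplace:
  assumes "A > 1" "card I \<ge> 2" "q > 0"
  shows "set_integrable lborel {0<..} (\<lambda>x. of_real (exp (- (q * x))) * \<Psi> x)"
    and "(CLINT x:{0<..}|lborel. of_real (exp (- (q * x))) * \<Psi> x)
      = of_real (sqrt (pi / q) * sqrt (2 * q) powr (- A)) * (CLINT s:{0<..}|lborel. H (ray s) * exp (- (of_real (sqrt (2 * q)) * ray s)))"
proof -
  obtain C where C: "C \<ge> 0" "\<And>x s. x > 0 \<Longrightarrow> s \<ge> 0 \<Longrightarrow>
    cmod (H (ray s) * K x s) \<le> C * (x powr ((A - 1) / 2) * (1 + sqrt x) powr A) * (cmod (H (ray s)) * (1 + s) powr (- A))"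
    using HK_bound[OF assms(1)] by blast
  define Q where "Q = (max 1 (A / (q / 2))) powr A * 2 powr A"
  have "Q \<ge> 0" by (simp add: Q_def)
  define h where "h x s = indicator {0<..} x *\<^sub>R (of_real (exp (- (q * x))) * (indicator {0<..} s *\<^sub>R (H (ray s) * K x s)))" for x s
  have f: "integrable lborel (\<lambda>x. (C * Q) * (indicator {0<..} x *\<^sub>R (x powr ((A + 1) / 2 - 1) * exp (- ((q/2) * x)))))"
    using set_integrable_Gamma[of "(A + 1) / 2" "q/2"] assms by (intro integrable_mult_right) (simp add: set_integrable_def)
  have g: "integrable lborel (\<lambda>s. indicator {0<..} s *\<^sub>R (cmod (H (ray s)) * (1 + s) powr (- A)))"
    using H_ray_decay[OF assms(1,2)] by (simp add: set_integrable_def)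
  have int: "integrable (lborel \<Otimes>\<^sub>M lborel) (case_prod h)"
  proof (rule lborel_pair.integrable_pair_bound[OF _ f g])
    show "case_prod h \<in> borel_measurable (lborel \<Otimes>\<^sub>M lborel)"
      unfolding h_def split_beta' by measurable
    have "norm (h x s) \<le> ((C * Q) * (indicator {0<..} x *\<^sub>R (x powr ((A + 1) / 2 - 1) * exp (- ((q/2) * x))))) * (indicator {0<..} s *\<^sub>R (cmod (H (ray s)) * (1 + s) powr (- A)))" for x s
    proof (cases "x > 0 \<and> s > 0")
      case True
      have "sqrt x \<le> 1 + x"
        using True by (intro real_le_lsqrt) (auto simp: power2_eq_square algebra_simps)
      then have "(1 + sqrt x) powr A \<le> (2 * (1 + x)) powr A"
        using True A_pos by (intro powr_mono2) auto
      also have "\<dots> = 2 powr A * (1 + x) powr A" by (rule powr_mult)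
      also have "\<dots> \<le> 2 powr A * ((max 1 (A / (q / 2))) powr A * exp ((q/2) * x))"
        using True A_pos assms by (intro mult_left_mono powr_le_exp) auto
      finally have poly: "(1 + sqrt x) powr A \<le> Q * exp ((q/2) * x)" by (simp add: Q_def mult_ac)
      define U where "U = cmod (H (ray s)) * (1 + s) powr (- A)"
      have "U \<ge> 0" by (simp add: U_def)
      have "norm (h x s) = exp (- (q * x)) * cmod (H (ray s) * K x s)"
        using True by (simp add: h_def norm_mult)
      also have "\<dots> \<le> exp (- (q * x)) * (C * (x powr ((A - 1) / 2) * (1 + sqrt x) powr A) * U)"
        unfolding U_def using True by (intro mult_left_mono C) auto
      also have "\<dots> \<le> exp (- (q * x)) * (C * (x powr ((A - 1) / 2) * (Q * exp ((q/2) * x))) * U)"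
        using poly C(1) \<open>U \<ge> 0\<close> by (intro mult_left_mono mult_right_mono) auto
      also have "\<dots> = (C * Q) * (x powr ((A - 1) / 2) * (exp (- (q * x)) * exp ((q/2) * x))) * U"
        by (simp only: mult_ac)
      also have "exp (- (q * x)) * exp ((q/2) * x) = exp (- ((q/2) * x))"
        unfolding mult_exp_exp by simp
      also have "(A - 1) / 2 = (A + 1) / 2 - 1" by (simp add: field_simps)
      finally show ?thesis using True by (simp add: U_def)
    qed (auto simp: h_def)
    then show "AE x in lborel. AE s in lborel. norm (case (x, s) of (x, s) \<Rightarrow> h x s)
      \<le> ((C * Q) * (indicator {0<..} x *\<^sub>R (x powr ((A + 1) / 2 - 1) * exp (- ((q/2) * x))))) * (indicator {0<..} s *\<^sub>R (cmod (H (ray s)) * (1 + s) powr (- A)))"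
      by (intro AE_I2) simp
  qed
  have inner_s: "(CLINT s|lborel. h x s) = indicator {0<..} x *\<^sub>R (of_real (exp (- (q * x))) * \<Psi> x)" for x
    unfolding h_def \<Psi>_def set_lebesgue_integral_def by (simp only: integral_scaleR_right integral_mult_right_zero)
  have inner_x: "(CLINT x|lborel. h x s) = indicator {0<..} s *\<^sub>R (H (ray s) * (of_real (sqrt (pi / q) * sqrt (2 * q) powr (- A)) * exp (- (of_real (sqrt (2 * q)) * ray s))))" for s
  proof (cases "s > 0")
    case True
    have "(CLINT x|lborel. h x s) = (CLINT x:{0<..}|lborel. H (ray s) * (of_real (exp (- (q * x))) * K x s))"
      unfolding set_lebesgue_integral_def
      by (intro Bochner_Integration.integral_cong refl) (simp only: h_def True indicator_simps greaterThan_iff scaleR_one mult.left_commute)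
    then show ?thesis
      using True by (simp only: set_integral_mult_right K_laplace[OF assms(3) True]) simp
  qed (simp add: h_def)
  show "set_integrable lborel {0<..} (\<lambda>x. of_real (exp (- (q * x))) * \<Psi> x)"
    using lborel_pair.integrable_fst[OF int] unfolding inner_s set_integrable_def .
  have "(CLINT x:{0<..}|lborel. of_real (exp (- (q * x))) * \<Psi> x) = (CLINT x|lborel. CLINT s|lborel. h x s)"
    unfolding inner_s set_lebesgue_integral_def ..
  also have "\<dots> = (CLINT s|lborel. CLINT x|lborel. h x s)"
    by (rule lborel_pair.Fubini_integral[OF int, symmetric])
  also have "\<dots> = (CLINT s:{0<..}|lborel. of_real (sqrt (pi / q) * sqrt (2 * q) powr (- A)) * (H (ray s) * exp (- (of_real (sqrt (2 * q)) * ray s))))"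
    unfolding inner_x set_lebesgue_integral_def by (simp only: mult.left_commute)
  finally show "(CLINT x:{0<..}|lborel. of_real (exp (- (q * x))) * \<Psi> x)
      = of_real (sqrt (pi / q) * sqrt (2 * q) powr (- A)) * (CLINT s:{0<..}|lborel. H (ray s) * exp (- (of_real (sqrt (2 * q)) * ray s)))"
    by (simp only: set_integral_mult_right)
qed

lemma Re_\<Psi>_laplace:
  assumes "A > 1" "card I \<ge> 2" "q > 0"
  shows "set_integrable lborel {0<..} (\<lambda>x. exp (- (q * x)) * Re (csqrt \<i> * \<Psi> x))"
    and "(LINT x:{0<..}|lborel. exp (- (q * x)) * Re (csqrt \<i> * \<Psi> x))
      = sqrt (pi / q) * sqrt (2 * q) powr (- A) * (pi * \<rho> (sqrt (2 * q)))"
proof -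
  have Re_eq: "Re (csqrt \<i> * (of_real (exp (- (q * x))) * \<Psi> x)) = exp (- (q * x)) * Re (csqrt \<i> * \<Psi> x)" for x
    by (simp add: mult.left_commute[of "csqrt \<i>"] del: csqrt_ii)
  have int: "set_integrable lborel {0<..} (\<lambda>x. csqrt \<i> * (of_real (exp (- (q * x))) * \<Psi> x))"
    by (intro set_integrable_mult_right \<Psi>_laplace assms)
  have "integrable lborel (\<lambda>x. Re (indicator {0<..} x *\<^sub>R (csqrt \<i> * (of_real (exp (- (q * x))) * \<Psi> x))))"
    using int unfolding set_integrable_def by (rule integrable_Re)
  then show "set_integrable lborel {0<..} (\<lambda>x. exp (- (q * x)) * Re (csqrt \<i> * \<Psi> x))"
    unfolding set_integrable_def scaleR_complex.simps Re_eq by simp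
  have "(LINT x:{0<..}|lborel. exp (- (q * x)) * Re (csqrt \<i> * \<Psi> x))
      = (LINT x|lborel. Re (indicator {0<..} x *\<^sub>R (csqrt \<i> * (of_real (exp (- (q * x))) * \<Psi> x))))"
    unfolding set_lebesgue_integral_def scaleR_complex.simps Re_eq by simp
  also have "\<dots> = Re (CLINT x:{0<..}|lborel. csqrt \<i> * (of_real (exp (- (q * x))) * \<Psi> x))"
    using int unfolding set_integrable_def set_lebesgue_integral_def by (rule integral_Re)
  also have "(CLINT x:{0<..}|lborel. csqrt \<i> * (of_real (exp (- (q * x))) * \<Psi> x))
     = of_real (sqrt (pi / q) * sqrt (2 * q) powr (- A)) * (csqrt \<i> * (CLINT s:{0<..}|lborel. H (ray s) * exp (- (of_real (sqrt (2 * q)) * ray s))))"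
    by (simp only: set_integral_mult_right \<Psi>_laplace(2)[OF assms] mult.left_commute)
  also have "csqrt \<i> * (CLINT s:{0<..}|lborel. H (ray s) * exp (- (of_real (sqrt (2 * q)) * ray s)))
     = (CLINT y:{0<..}|lborel. H (Complex 0 (- y)) * iexp (sqrt (2 * q) * y))"
    using assms by (intro H_rotate) auto
  also have "Re (of_real (sqrt (pi / q) * sqrt (2 * q) powr (- A)) * (CLINT y:{0<..}|lborel. H (Complex 0 (- y)) * iexp (sqrt (2 * q) * y)))
     = sqrt (pi / q) * sqrt (2 * q) powr (- A) * Re (CLINT y:{0<..}|lborel. H (Complex 0 (- y)) * iexp (sqrt (2 * q) * y))"
    by (simp only: Re_complex_of_real Im_complex_of_real times_complex.sel mult_zero_left diff_zero)
  also have "Re (CLINT y:{0<..}|lborel. H (Complex 0 (- y)) * iexp (sqrt (2 * q) * y)) = pi * \<rho> (sqrt (2 * q))"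
    using assms by (intro H_fourier) auto
  finally show "(LINT x:{0<..}|lborel. exp (- (q * x)) * Re (csqrt \<i> * \<Psi> x))
      = sqrt (pi / q) * sqrt (2 * q) powr (- A) * (pi * \<rho> (sqrt (2 * q)))" .
qed

text \<open>
Here \<open>sqrt(2q)\<close> appears because \<open>L\<close> is \<open>E exp(-k\<^sup>2V/2)\<close>, and \<open>k\<^sup>2/2 = q\<close>.
\<close>
lemma cdf_laplace:
  assumes "q > 0"
  shows "set_integrable lborel {0<..} (\<lambda>x. exp (- (q * x)) * cdf (distr N borel V) x)"
    and "(LINT x:{0<..}|lborel. exp (- (q * x)) * cdf (distr N borel V) x) = L (sqrt (2 * q)) / q"
proof -
  interpret pair_sigma_finite lborel N ..
  define h where "h x t = indicator {0<..} x * exp (- (q * x)) * indicator {V t..} x" for x :: real and t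
  have f: "integrable lborel (\<lambda>x. indicator {0<..} x * exp (- (q * x)))"
  proof -
    have "set_integrable lborel {0<..} (\<lambda>x. exp (- (q * x)))"
      by (rule set_integrable_subset[OF set_integrable_exp_neg[OF assms]]) auto
    then show ?thesis by (simp add: set_integrable_def)
  qed
  have g: "integrable N (\<lambda>_. 1 :: real)" by simp
  have h_eq: "h x t = indicator {0<..} x * exp (- (q * x)) * of_bool (V t \<le> x)" for x t
    by (simp add: h_def indicator_def)
  have int: "integrable (lborel \<Otimes>\<^sub>M N) (case_prod h)"
  proof (rule integrable_pair_bound[OF _ f g])
    show "case_prod h \<in> borel_measurable (lborel \<Otimes>\<^sub>M N)"
      unfolding h_eq split_beta' by measurable
  qed (auto simp: h_def indicator_def)
  have inner_t: "(LINT t|N. h x t) = indicator {0<..} x *\<^sub>R (exp (- (q * x)) * cdf (distr N borel V) x)" for x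
  proof -
    have "cdf (distr N borel V) x = measure N (V -` {..x} \<inter> space N)"
      unfolding cdf_def by (rule measure_distr) auto
    also have "\<dots> = (LINT t|N. indicator (V -` {..x} \<inter> space N) t)"
      by simp
    also have "\<dots> = (LINT t|N. indicator {V t..} x)"
      by (intro Bochner_Integration.integral_cong) (auto simp: indicator_def)
    finally show ?thesis unfolding h_def by (simp add: mult.assoc)
  qed
  have inner_x: "(LINT x|lborel. h x t) = exp (- (q * V t)) / q" for t
    unfolding h_def by (rule exponential_tail_integral[OF assms V_nonneg])
  show "set_integrable lborel {0<..} (\<lambda>x. exp (- (q * x)) * cdf (distr N borel V) x)"
    using integrable_fst[OF int] unfolding inner_t set_integrable_def .
  have "(LINT x:{0<..}|lborel. exp (- (q * x)) * cdf (distr N borel V) x) = (LINT x|lborel. LINT t|N. h x t)"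
    unfolding inner_t set_lebesgue_integral_def ..
  also have "\<dots> = (LINT t|N. LINT x|lborel. h x t)"
    by (rule Fubini_integral[OF int, symmetric])
  also have "\<dots> = L (sqrt (2 * q)) / q"
    unfolding inner_x L_def using assms by simp
  finally show "(LINT x:{0<..}|lborel. exp (- (q * x)) * cdf (distr N borel V) x) = L (sqrt (2 * q)) / q" .
qed

text \<open>
Both sides are right-continuous and have the same Laplace transform at every positive integer.
\<close>
theorem cdf_eq:
  assumes "A > 1" "card I \<ge> 2" "x > 0"
  shows "cdf (distr N borel V) x = pi powr (- 3 / 2) * sqrt 2 * Gamma A * Re (csqrt \<i> * \<Psi> x)"
proof -
  define c where "c = pi powr (- 3 / 2) * sqrt 2 * Gamma A"
  define \<Phi> where "\<Phi> y = Re (csqrt \<i> * \<Psi> y)" for y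
  define D where "D y = cdf (distr N borel V) y - c * \<Phi> y" for y
  have distrib: "exp (- (q * y)) * D y = exp (- (q * y)) * cdf (distr N borel V) y - c * (exp (- (q * y)) * \<Phi> y)" for q y
    by (simp add: D_def algebra_simps)
  have int_c: "set_integrable lborel {0<..} (\<lambda>y. c * (exp (- (q * y)) * \<Phi> y))" if "q > 0" for q
    unfolding \<Phi>_def by (intro set_integrable_mult_right Re_\<Psi>_laplace assms that)
  have "D x = 0"
  proof (rule laplace_injective[where D = D and ?x0.0 = x])
    show "set_integrable lborel {0<..} (\<lambda>y. exp (- y) * D y)"
      using distrib[of 1] set_integral_diff(1)[OF cdf_laplace(1)[of 1] int_c[of 1]] by simp
    show "(LINT y:{0<..}|lborel. exp (- (real (Suc m) * y)) * D y) = 0" for m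
    proof -
      define q where "q = real (Suc m)"
      have "q > 0" by (simp add: q_def)
      define k where "k = sqrt (2 * q)"
      have "k > 0" using \<open>q > 0\<close> by (simp add: k_def)
      have "(LINT y:{0<..}|lborel. exp (- (q * y)) * D y) = L k / q - c * (sqrt (pi / q) * k powr (- A) * (pi * \<rho> k))"
      proof -
        have "(LINT y:{0<..}|lborel. exp (- (q * y)) * D y)
          = (LINT y:{0<..}|lborel. exp (- (q * y)) * cdf (distr N borel V) y) - (LINT y:{0<..}|lborel. c * (exp (- (q * y)) * \<Phi> y))"
          unfolding distrib by (rule set_integral_diff(2)[OF cdf_laplace(1)[OF \<open>q > 0\<close>] int_c[OF \<open>q > 0\<close>]])
        then show ?thesis
          by (simp only: set_integral_mult_right \<Phi>_def Re_\<Psi>_laplace(2)[OF assms(1,2) \<open>q > 0\<close>] cdf_laplace(2)[OF \<open>q > 0\<close>] k_def)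
      qed
      also have "c * (sqrt (pi / q) * k powr (- A) * (pi * \<rho> k)) = (pi powr (- 3 / 2) * (sqrt pi * pi)) * (sqrt 2 / (sqrt q * k)) * (k * (k powr (- A) * k powr (A - 1))) * L k"
        using \<open>k > 0\<close> Gamma_real_pos[OF A_pos] by (simp add: c_def \<rho>_def real_sqrt_divide)
      also have "pi powr (- 3 / 2) * (sqrt pi * pi) = 1"
      proof -
        have "sqrt pi * pi = pi powr (1/2) * pi powr 1" by (simp add: powr_half_sqrt)
        also have "\<dots> = pi powr (3 / 2)" unfolding powr_add[symmetric] by simp
        finally show ?thesis by (simp flip: powr_add)
      qed
      also have "k * (k powr (- A) * k powr (A - 1)) = 1"
      proof -
        have "k * (k powr (- A) * k powr (A - 1)) = k powr 1 * (k powr (- A) * k powr (A - 1))"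
          using \<open>k > 0\<close> by simp
        also have "\<dots> = 1" using \<open>k > 0\<close> unfolding powr_add[symmetric] by simp
        finally show ?thesis .
      qed
      also have "sqrt 2 / (sqrt q * k) = 1 / q"
        using \<open>q > 0\<close> by (simp add: k_def real_sqrt_mult)
      finally show ?thesis by (simp add: q_def)
    qed
    have "continuous_on {0<..} \<Phi>"
      unfolding \<Phi>_def by (intro continuous_intros continuous_\<Psi> assms)
    then have "isCont \<Phi> x"
      using assms by (simp add: continuous_on_eq_continuous_at)
    then have "continuous (at_right x) \<Phi>" by (rule continuous_at_imp_continuous_at_within)
    moreover interpret D: prob_space "distr N borel V" by (rule N.prob_space_distr) measurable
    interpret D: finite_borel_measure "distr N borel V" by unfold_locales auto
    have "continuous (at_right x) (cdf (distr N borel V))" by (rule D.cdf_is_right_cont)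
    ultimately show "continuous (at_right x) D"
      unfolding D_def by (intro continuous_intros)
  qed (use assms in auto)
  then show ?thesis by (simp add: D_def \<Phi>_def c_def)
qed

end

section \<open>The distribution function in terms of parabolic cylinder functions\<close>

lemma parabolic_cylinder_neg_eq:
  "parabolic_cylinder_neg a z = exp (- (z\<^sup>2) / 4) * gauss_laplace a (- z) / of_real (Gamma a)"
proof -
  have "- (of_real (t\<^sup>2) / 2) - z * of_real t = (- z) * of_real t - of_real (t\<^sup>2) / 2" for t
    by simp
  then show ?thesis
    unfolding parabolic_cylinder_neg_def gauss_laplace_def by (simp only: times_divide_eq_left)
qed

lemma csqrt_minus_ii: "csqrt (- \<i>) = (1 - \<i>) / of_real (sqrt 2)"
  by (simp add: complex_eq_iff Re_divide Im_divide real_sqrt_divide real_div_sqrt)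

theorem theorem2:
  fixes M :: "'a measure"
    and X :: "nat \<Rightarrow> 'a \<Rightarrow> real"
    and \<alpha> :: "nat \<Rightarrow> real"
    and n :: nat
    and A x :: real
    and f :: "real \<Rightarrow> complex"
  defines "A \<equiv> (\<Sum>j=1..n. \<alpha> j)"
    and "f \<equiv> (\<lambda>s.
           (\<Prod>j=1..n. exp (- (\<i> * of_real (s\<^sup>2) / 4)) *
              parabolic_cylinder_neg (\<alpha> j) (\<i> * csqrt \<i> * of_real s)) *
           exp (\<i> * of_real (s\<^sup>2) / (4 * of_real x)) *
           parabolic_cylinder_neg A (csqrt (- \<i>) * of_real s * of_real (x powr (- 1 / 2))) *
           csqrt \<i>)"
  assumes "prob_space M"
    and "n \<ge> 2"
    and "\<And>j. j \<in> {1..n} \<Longrightarrow> \<alpha> j > 0"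
    and "prob_space.indep_vars M (\<lambda>_. borel) X {1..n}"
    and "\<And>j. j \<in> {1..n} \<Longrightarrow> distributed M lborel (X j) (\<lambda>t. ennreal (gamma_density (\<alpha> j) t))"
    and "A > 1"
    and "x > 0"
  shows "set_integrable lborel {0<..} (\<lambda>s. Re (f s))
       \<and> measure M {\<omega> \<in> space M. (\<Sum>i=1..n. X i \<omega>) powi (- 2) * (\<Sum>i=1..n. (X i \<omega>)\<^sup>2) \<le> x} =
           pi powr (- 3 / 2) * sqrt 2 * Gamma A * x powr ((A - 1) / 2) *
           (LINT s:{0<..}|lborel. Re (f s))"
proof -
  interpret M: prob_space M by fact
  interpret G: gamma_vector "{1..n}" \<alpha>
    using assms(4,5) by unfold_locales auto
  have A: "A = G.A" unfolding A_def G.A_def ..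
  have card: "card {1..n} \<ge> 2" using assms by simp
  define p where "p = x powr ((A - 1) / 2)"
  have "p > 0" using assms by (simp add: p_def)

  have factor: "exp (- (\<i> * of_real (s\<^sup>2) / 4)) * parabolic_cylinder_neg a (\<i> * csqrt \<i> * of_real s)
      = gauss_laplace a (ray s) / of_real (Gamma a)" for a s
  proof -
    have z: "\<i> * csqrt \<i> * of_real s = - ray s"
      by (simp add: ray_def complex_eq_iff Re_divide_of_real Im_divide_of_real)
    have "exp (- (\<i> * of_real (s\<^sup>2) / 4)) * exp (- ((- ray s)\<^sup>2) / 4) = 1"
      unfolding mult_exp_exp by (simp add: ray_sq)
    then show ?thesis
      unfolding z parabolic_cylinder_neg_eq by (simp add: mult.assoc[symmetric])
  qed
  have last_factor: "of_real p * (exp (\<i> * of_real (s\<^sup>2) / (4 * of_real x)) *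
      parabolic_cylinder_neg A (csqrt (- \<i>) * of_real s * of_real (x powr (- 1 / 2)))) = G.K x s" for s
  proof -
    have z: "csqrt (- \<i>) * of_real s = ray s"
      unfolding csqrt_minus_ii by (simp add: ray_def complex_eq_iff Re_divide_of_real Im_divide_of_real)
    have sq: "(x powr (- 1 / 2))\<^sup>2 = 1 / x"
      using assms by (simp add: powr_minus_divide power2_eq_square flip: powr_add)
    have "exp (\<i> * of_real (s\<^sup>2) / (4 * of_real x)) * exp (- ((ray s * of_real (x powr (- 1 / 2)))\<^sup>2) / 4)
      = exp (\<i> * of_real (s\<^sup>2) / (2 * of_real x))"
      unfolding mult_exp_exp power_mult_distrib ray_sq of_real_power[symmetric] sq
      using assms by (intro arg_cong[where f = exp]) (simp add: field_simps)
    then show ?thesis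
      unfolding z parabolic_cylinder_neg_eq G.K_def p_def A by (simp only: mult.assoc[symmetric] times_divide_eq_right)
  qed
  have f_eq: "of_real p * f s = csqrt \<i> * (G.H (ray s) * G.K x s)" for s
    unfolding f_def factor last_factor[symmetric] G.H_def by (simp only: mult_ac)
  have Re_f: "p * Re (f s) = Re (csqrt \<i> * (G.H (ray s) * G.K x s))" for s
    unfolding f_eq[symmetric] by simp
  have int: "set_integrable lborel {0<..} (\<lambda>s. csqrt \<i> * (G.H (ray s) * G.K x s))"
    using assms card by (intro set_integrable_mult_right G.HK_integrable) (auto simp: A)
  have int_Re: "set_integrable lborel {0<..} (\<lambda>s. p * Re (f s))"
    using integrable_Re[OF int[unfolded set_integrable_def]] unfolding set_integrable_def Re_f by simp
  have int_f: "set_integrable lborel {0<..} (\<lambda>s. Re (f s))"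
    using set_integrable_mult_right[OF int_Re, of "1 / p"] \<open>p > 0\<close> by simp

  have "p * (LINT s:{0<..}|lborel. Re (f s)) = (LINT s:{0<..}|lborel. Re (csqrt \<i> * (G.H (ray s) * G.K x s)))"
    unfolding Re_f[symmetric] by simp
  also have "\<dots> = Re (CLINT s:{0<..}|lborel. csqrt \<i> * (G.H (ray s) * G.K x s))"
    using integral_Re[OF int[unfolded set_integrable_def]] unfolding set_lebesgue_integral_def by simp
  also have "\<dots> = Re (csqrt \<i> * G.\<Psi> x)"
    unfolding G.\<Psi>_def by (simp only: set_integral_mult_right)
  finally have \<Psi>: "p * (LINT s:{0<..}|lborel. Re (f s)) = Re (csqrt \<i> * G.\<Psi> x)" .

  have X: "X j \<in> borel_measurable M" and dist: "distr M borel (X j) = gamma_law (\<alpha> j)" if "j \<in> {1..n}" for j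
  proof -
    show "X j \<in> borel_measurable M"
      using distributed_measurable[OF assms(7)[OF that]] by simp
    have "distr M borel (X j) = distr M lborel (X j)" by (rule distr_cong) auto
    then show "distr M borel (X j) = gamma_law (\<alpha> j)"
      using distributed_distr_eq_density[OF assms(7)[OF that]] by simp
  qed
  define Y where "Y \<omega> = (\<lambda>i\<in>{1..n}. X i \<omega>)" for \<omega>
  have Y: "Y \<in> measurable M (PiM {1..n} (\<lambda>_. borel))"
    unfolding Y_def using X by (intro measurable_restrict) auto
  have "distr M (PiM {1..n} (\<lambda>_. borel)) Y = PiM {1..n} (\<lambda>i. distr M borel (X i))"
    using M.indep_vars_iff_distr_eq_PiM'[where I = "{1..n}" and M' = "\<lambda>_. borel" and X = X] X assms unfolding Y_def by auto
  also have "\<dots> = G.N"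
    unfolding G.N_def using dist by (intro PiM_cong) auto
  finally have law: "distr M (PiM {1..n} (\<lambda>_. borel)) Y = G.N" .
  have V_Y: "G.V (Y \<omega>) = (\<Sum>i=1..n. X i \<omega>) powi (- 2) * (\<Sum>i=1..n. (X i \<omega>)\<^sup>2)" for \<omega>
    unfolding G.V_def G.S_def Y_def by simp
  have "G.V \<in> borel_measurable (PiM {1..n} (\<lambda>_. borel))"
    using G.V_measurable by (simp only: measurable_cong_sets[OF G.sets_N refl])
  then have "cdf (distr G.N borel G.V) x = measure M {\<omega> \<in> space M. G.V (Y \<omega>) \<le> x}"
    unfolding law[symmetric] using Y
    by (simp add: cdf_def distr_distr measure_distr vimage_def Int_def conj_commute)
  also have "cdf (distr G.N borel G.V) x = pi powr (- 3 / 2) * sqrt 2 * Gamma A * (p * (LINT s:{0<..}|lborel. Re (f s)))"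
    unfolding \<Psi> A using assms card by (intro G.cdf_eq) (auto simp: A)
  finally show ?thesis
    using int_f unfolding V_Y p_def by (simp only: mult.assoc)
qed

end
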